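(* Let $p\in(\frac12,1)$, $\alpha=\beta=0$ and $\gamma,\delta\ge0$. Then for all $\varepsilon\in(0,\frac12)$ the $\varepsilon$-mixing time of the simple exclusion process with open boundaries with parameters $(p,0,0,\gamma,\delta)$ satisfies $$\lim_{N\to\infty}\frac{\log\big(t^N_{\mathrm{mix}}(\varepsilon)\big)}{N}=\log\Big(\frac{p}{1-p}\Big)\qquad\text{if }\min(\gamma,\delta)=0\text{ and }\max(\gamma,\delta)>0,$$ and $$\lim_{N\to\infty}\frac{\log\big(t^N_{\mathrm{mix}}(\varepsilon)\big)}{N}=\frac12\log\Big(\frac{p}{1-p}\Big)\qquad\text{if }\min(\gamma,\delta)>0.$$
   Context: For $N\in\mathbb{N}$ let $[N]=\{1,\dots,N\}$ and $\Omega_N=\{0,1\}^N$; site $x$ is occupied by a particle in $\eta\in\Omega_N$ if $\eta(x)=1$ and empty if $\eta(x)=0$. The simple exclusion process with open boundaries with parameters $(p,\alpha,\beta,\gamma,\delta)$, $p\in[0,1]$, $\alpha,\beta,\gamma,\delta\ge0$, is the continuous-time Markov chain $(\eta_t)_{t\ge0}$ on $\Omega_N$ with generator $$\mathcal{L}f(\eta)=\sum_{x=1}^{N-1}p\,\eta(x)(1-\eta(x+1))[f(\eta^{x,x+1})-f(\eta)]+\sum_{x=2}^{N}(1-p)\,\eta(x)(1-\eta(x-1))[f(\eta^{x,x-1})-f(\eta)]$$ $$\qquad+\big(\alpha(1-\eta(1))+\gamma\eta(1)\big)[f(\eta^1)-f(\eta)]+\big(\delta(1-\eta(N))+\beta\eta(N)\big)[f(\eta^N)-f(\eta)],$$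 where $\eta^{x,y}$ is $\eta$ with the values at $x,y$ exchanged and $\eta^x$ is $\eta$ with the value at $x$ flipped. The parameters do not depend on $N$. Parameters are such that there is a unique stationary distribution $\mu$ (depending on $N$; possibly a Dirac measure). The $\varepsilon$-mixing time is $$t^N_{\mathrm{mix}}(\varepsilon)=\inf\Big\{t\ge0:\max_{\eta\in\Omega_N}\|\mathbb{P}(\eta_t\in\cdot\mid\eta_0=\eta)-\mu\|_{\mathrm{TV}}<\varepsilon\Big\},\qquad \|\mu-\nu\|_{\mathrm{TV}}=\tfrac12\sum_{x\in\Omega_N}|\mu(x)-\nu(x)|.$$ *)

theory Defs
  imports "HOL-Probability.Probability"
begin

text \<open>The state space \<open>\<Omega>\<^sub>N = {0,1}\<^sup>N\<close>; configurations are extensional functions on \<open>{1..N}\<close>.\<close>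

type_synonym config = "nat \<Rightarrow> nat"

definition configs :: "nat \<Rightarrow> config set" where
  "configs N = {1..N} \<rightarrow>\<^sub>E {0, 1}"

definition exchange :: "config \<Rightarrow> nat \<Rightarrow> nat \<Rightarrow> config" where
  "exchange \<eta> x y = \<eta>(x := \<eta> y, y := \<eta> x)"

definition flip :: "config \<Rightarrow> nat \<Rightarrow> config" where
  "flip \<eta> x = \<eta>(x := 1 - \<eta> x)"

text \<open>For \<open>N \<ge> 1\<close> and \<open>\<eta> \<in> configs N\<close> the value at \<open>\<eta>\<close> depends on \<open>f\<close> only through its
  restriction to \<open>configs N\<close>. For \<open>N = 0\<close> the boundary terms have no meaning.\<close>

definition generator ::
  "nat \<Rightarrow> real \<Rightarrow> real \<Rightarrow> real \<Rightarrow> real \<Rightarrow> real \<Rightarrow> (config \<Rightarrow> real) \<Rightarrow> config \<Rightarrow> real" where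
  "generator N p \<alpha> \<beta> \<gamma> \<delta> f \<eta> =
     (\<Sum>x = 1..<N. p * real (\<eta> x) * (1 - real (\<eta> (x + 1))) * (f (exchange \<eta> x (x + 1)) - f \<eta>))
   + (\<Sum>x = 2..N. (1 - p) * real (\<eta> x) * (1 - real (\<eta> (x - 1))) * (f (exchange \<eta> x (x - 1)) - f \<eta>))
   + (\<alpha> * (1 - real (\<eta> 1)) + \<gamma> * real (\<eta> 1)) * (f (flip \<eta> 1) - f \<eta>)
   + (\<delta> * (1 - real (\<eta> N)) + \<beta> * real (\<eta> N)) * (f (flip \<eta> N) - f \<eta>)"

text \<open>The Markov semigroup \<open>S(t) f (\<eta>) = E[f(\<eta>\<^sub>t) | \<eta>\<^sub>0 = \<eta>]\<close> of the chain with the above generator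
  \<open>L\<close>. As the state space is finite, it is the exponential series \<open>exp (t L)\<close>.\<close>

definition markov_semigroup ::
  "nat \<Rightarrow> real \<Rightarrow> real \<Rightarrow> real \<Rightarrow> real \<Rightarrow> real \<Rightarrow> real \<Rightarrow> (config \<Rightarrow> real) \<Rightarrow> config \<Rightarrow> real" where
  "markov_semigroup N p \<alpha> \<beta> \<gamma> \<delta> t f \<eta> =
     (\<Sum>n. t ^ n / fact n * (generator N p \<alpha> \<beta> \<gamma> \<delta> ^^ n) f \<eta>)"

text \<open>\<open>P(\<eta>\<^sub>t = \<xi> | \<eta>\<^sub>0 = \<eta>)\<close>\<close>

definition trans_prob ::
  "nat \<Rightarrow> real \<Rightarrow> real \<Rightarrow> real \<Rightarrow> real \<Rightarrow> real \<Rightarrow> real \<Rightarrow> config \<Rightarrow> config \<Rightarrow> real" where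
  "trans_prob N p \<alpha> \<beta> \<gamma> \<delta> t \<eta> \<xi> = markov_semigroup N p \<alpha> \<beta> \<gamma> \<delta> t (indicator {\<xi>}) \<eta>"

definition is_stationary ::
  "nat \<Rightarrow> real \<Rightarrow> real \<Rightarrow> real \<Rightarrow> real \<Rightarrow> real \<Rightarrow> config pmf \<Rightarrow> bool" where
  "is_stationary N p \<alpha> \<beta> \<gamma> \<delta> \<mu> \<longleftrightarrow>
     set_pmf \<mu> \<subseteq> configs N \<and>
     (\<forall>t\<ge>0. \<forall>\<xi>\<in>configs N.
        (\<Sum>\<eta>\<in>configs N. pmf \<mu> \<eta> * trans_prob N p \<alpha> \<beta> \<gamma> \<delta> t \<eta> \<xi>) = pmf \<mu> \<xi>)"

text \<open>Meaningful for parameters with a unique stationary distribution. For \<open>\<alpha> = \<beta> = 0\<close>,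
  \<open>0 < p < 1\<close>, \<open>\<gamma>, \<delta> \<ge> 0\<close>, \<open>max \<gamma> \<delta> > 0\<close> and \<open>N \<ge> 1\<close> this is the case: the full configuration
  (if \<open>\<delta> > 0\<close>) or the empty configuration (if \<open>\<gamma> > 0\<close>) is reachable from every state.\<close>

definition stationary_dist ::
  "nat \<Rightarrow> real \<Rightarrow> real \<Rightarrow> real \<Rightarrow> real \<Rightarrow> real \<Rightarrow> config pmf" where
  "stationary_dist N p \<alpha> \<beta> \<gamma> \<delta> = (THE \<mu>. is_stationary N p \<alpha> \<beta> \<gamma> \<delta> \<mu>)"

definition tv_dist :: "nat \<Rightarrow> (config \<Rightarrow> real) \<Rightarrow> (config \<Rightarrow> real) \<Rightarrow> real" where
  "tv_dist N \<mu> \<nu> = (1 / 2) * (\<Sum>\<eta>\<in>configs N. \<bar>\<mu> \<eta> - \<nu> \<eta>\<bar>)"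

definition mixing_time ::
  "nat \<Rightarrow> real \<Rightarrow> real \<Rightarrow> real \<Rightarrow> real \<Rightarrow> real \<Rightarrow> real \<Rightarrow> real" where
  "mixing_time N p \<alpha> \<beta> \<gamma> \<delta> \<epsilon> =
     Inf {t. t \<ge> 0 \<and>
       Max ((\<lambda>\<eta>. tv_dist N (trans_prob N p \<alpha> \<beta> \<gamma> \<delta> t \<eta>) (pmf (stationary_dist N p \<alpha> \<beta> \<gamma> \<delta>)))
            ` configs N) < \<epsilon>}"

end

theory Submission
  imports Defs "HOL-Real_Asymp.Real_Asymp"
begin

text \<open>Let \<open>lam = p / (1 - p) > 1\<close>. Particles drift to the right but can leave only at the left end, and new
ones come in only at the right end. Starting with \<open>k\<close> particles the system packs itself against the
right end. Then an exit needs a particle to travel \<open>N - k\<close> sites against the drift, which takes a time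
of order \<open>lam ^ (N - k)\<close>; an entry needs a hole to travel \<open>k\<close> sites against its drift, which takes
\<open>lam ^ k\<close>. If only exits are possible, the slowest stage is the exit of the last particle, at time
\<open>lam ^ N\<close>; the case of entries only is its mirror image. If both ends are open, the particle number
relaxes to about \<open>N / 2\<close>, where both times are \<open>lam ^ (N / 2)\<close>. The proof makes this precise up to
factors that are polynomial in \<open>N\<close>.

\<^bold>\<open>Lower bound.\<close> Started from the packed configuration with \<open>k\<close> or with \<open>k + 1\<close> particles, the
particle number stays constant with high probability for a time of the order above (with \<open>k = 0\<close> for
one open end, and \<open>k = N div 2\<close> for two). The two laws are then almost singular, so no law can be much
closer than \<open>1 / 2\<close> to both of them; this is where \<open>\<epsilon> < 1 / 2\<close> enters. The particle number is
controlled by test functions that vanish as soon as an exit or an entry becomes possible and that the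
generator lowers very slowly (\<open>drift_test\<close>, \<open>dist_lower_bound\<close>).

\<^bold>\<open>Upper bound.\<close> The process is driven by independent Poisson clocks, each of which applies a
monotone map to the configuration. Letting the same clocks act on two copies couples them so that their
order is preserved. If \<open>V \<ge> 0\<close> is a function of the pair that decreases at rate \<open>\<kappa>\<close> as long as the
copies differ, they differ at time \<open>t\<close> with probability at most \<open>V / (\<kappa> * t)\<close>. This yields existence and
uniqueness of the stationary law as well as the mixing bound (locale \<open>coalescing\<close>), so what is left is
to find \<open>V\<close> of polynomial size with \<open>\<kappa>\<close> of order \<open>lam ^ (- N)\<close> or \<open>lam ^ (- N / 2)\<close>.

The number of discrepancies alone does not do: it decreases only when the copies differ at an end. It is
corrected by potentials built from \<open>Z x = lam ^ (number of particles in {1..x})\<close>, the microscopic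
Cole-Hopf transform of Gaertner, under which the bulk dynamics becomes linear. The potential \<open>A\<close>
converts the occupation of site 1 into the rate at which exits happen: in the bulk it grows at the rate
\<open>c * lam ^ (k - N)\<close>, up to a constant, and loses \<open>c\<close>, up to exponentially small terms, while site 1 is
occupied (\<open>bulk_drift_A\<close>). Hence, for large \<open>C\<close>, the terms at site 1 help, and otherwise the drift of \<open>C * k - A\<close> strictly
decreases in the particle number \<open>k\<close>, by about \<open>lam ^ (k - N)\<close> per particle. For one open end this suffices (\<open>one_sided_drift\<close>).

For two open ends there is an error term when both copies lose a particle at the same time, namely the
potential \<open>A\<close> of the upper copy just after that exit. It is small in the mean, because it measures a
second particle near the left end. The bilinear potential \<open>A2\<close>, which sees only pairs of particles,
pays for it (\<open>bulk_drift_A2\<close>; products \<open>Z x * Z y\<close> again have a closed evolution, an instance of the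
self-duality of the exclusion process) at the cost \<open>lam ^ (k - N) * A0\<close>. This in turn is paid by \<open>A1\<close> as
long as \<open>lam ^ (k - N)\<close> is below a multiple of \<open>1 / N\<close>, and by a function \<open>U\<close> that punishes very high
densities otherwise. Adding the same function for the holes gives a drift of at most
\<open>- const * (lam ^ (k' - N) + lam ^ (- k))\<close> for copies with \<open>k < k'\<close> particles, and by the inequality of
the means this is at most \<open>- const * lam ^ (- N / 2)\<close> (\<open>pair_drift\<close>, \<open>two_sided_bounds\<close>).\<close>

section \<open>Markov chains driven by random maps\<close>

locale random_maps =
  fixes I :: "'i set" and r :: "'i \<Rightarrow> real" and m :: "'i \<Rightarrow> 'a \<Rightarrow> 'a" and S :: "'a set"
  assumes finite_maps: "finite I"
    and r_nonneg: "\<And>i. i \<in> I \<Longrightarrow> r i \<ge> 0"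
    and rate_pos': "sum r I > 0"
    and closed: "\<And>i x. i \<in> I \<Longrightarrow> x \<in> S \<Longrightarrow> m i x \<in> S"
begin

definition rate :: real where "rate = sum r I"

definition gen :: "('a \<Rightarrow> real) \<Rightarrow> 'a \<Rightarrow> real" where
  "gen f x = (\<Sum>i\<in>I. r i * (f (m i x) - f x))"

definition step :: "('a \<Rightarrow> real) \<Rightarrow> 'a \<Rightarrow> real" where
  "step f x = (\<Sum>i\<in>I. r i * f (m i x)) / rate"

definition poisson :: "real \<Rightarrow> nat \<Rightarrow> real" where
  "poisson t n = exp (- rate * t) * ((rate * t) ^ n / fact n)"

definition semigroup :: "real \<Rightarrow> ('a \<Rightarrow> real) \<Rightarrow> 'a \<Rightarrow> real" where
  "semigroup t f x = (\<Sum>n. t ^ n / fact n * (gen ^^ n) f x)"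

lemma rate_pos: "rate > 0"
  using rate_pos' by (simp add: rate_def)

lemma gen_eq_step: "gen f x = rate * (step f x - f x)"
  using rate_pos
  by (simp add: gen_def step_def right_diff_distrib sum_subtractf rate_def flip: sum_distrib_right)

lemma step_mono:
  assumes "\<And>x. x \<in> S \<Longrightarrow> f x \<le> g x" "x \<in> S"
  shows "step f x \<le> step g x"
  unfolding step_def using assms rate_pos
  by (intro divide_right_mono sum_mono mult_left_mono) (auto simp: r_nonneg closed)

lemma step_const: "step (\<lambda>_. c) x = c"
  using rate_pos by (simp add: step_def rate_def flip: sum_distrib_right)

lemma steps_mono:
  assumes "\<And>x. x \<in> S \<Longrightarrow> f x \<le> g x" "x \<in> S"
  shows "(step ^^ n) f x \<le> (step ^^ n) g x"
  using assms(2) by (induction n arbitrary: x) (auto intro!: step_mono assms(1))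

lemma steps_cong:
  assumes "\<And>x. x \<in> S \<Longrightarrow> f x = g x" "x \<in> S"
  shows "(step ^^ n) f x = (step ^^ n) g x"
  using steps_mono[of f g x n] steps_mono[of g f x n] assms by force

lemma steps_const: "(step ^^ n) (\<lambda>_. c) = (\<lambda>_. c)"
proof (induction n)
  case (Suc n)
  show ?case unfolding funpow.simps o_apply Suc.IH by (simp add: step_const fun_eq_iff)
qed simp

lemma step_sum: "step (\<lambda>x. \<Sum>j\<in>J. c j * f j x) = (\<lambda>x. \<Sum>j\<in>J. c j * step (f j) x)"
proof
  fix x
  have "(\<Sum>i\<in>I. r i * (\<Sum>j\<in>J. c j * f j (m i x))) = (\<Sum>j\<in>J. c j * (\<Sum>i\<in>I. r i * f j (m i x)))"
    by (simp add: sum_distrib_left mult.left_commute sum.swap[of _ I J])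
  then show "step (\<lambda>x. \<Sum>j\<in>J. c j * f j x) x = (\<Sum>j\<in>J. c j * step (f j) x)"
    by (simp add: step_def sum_divide_distrib[of "\<lambda>j. c j * _ j"] flip: times_divide_eq_right)
qed

lemma steps_sum:
  "(step ^^ n) (\<lambda>x. \<Sum>j\<in>J. c j * f j x) = (\<lambda>x. \<Sum>j\<in>J. c j * (step ^^ n) (f j) x)"
  by (induction n) (auto simp: step_sum)

lemma step_affine: "step (\<lambda>x. a * f x + b * g x) x = a * step f x + b * step g x"
  by (simp add: step_def sum.distrib sum_distrib_left algebra_simps add_divide_distrib)

lemma steps_affine:
  "(step ^^ n) (\<lambda>x. a * f x + b * g x) = (\<lambda>x. a * (step ^^ n) f x + b * (step ^^ n) g x)"
proof (induction n)
  case (Suc n)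
  show ?case unfolding funpow.simps o_apply Suc.IH by (simp add: step_affine fun_eq_iff)
qed simp

lemma steps_bounded:
  assumes "\<And>x. x \<in> S \<Longrightarrow> \<bar>f x\<bar> \<le> B" "x \<in> S"
  shows "\<bar>(step ^^ n) f x\<bar> \<le> B"
  using steps_mono[of f "\<lambda>_. B" x n] steps_mono[of "\<lambda>_. - B" f x n] assms
  by (fastforce simp: steps_const abs_le_iff)

text \<open>The generator is \<open>rate\<close> times (averaging operator minus identity), so its powers follow
  from the binomial theorem; dividing by factorials makes them a Cauchy product.\<close>

lemma gen_power:
  "(gen ^^ n) f x / fact n =
    (\<Sum>i\<le>n. (rate ^ i / fact i * (step ^^ i) f x) * ((- rate) ^ (n - i) / fact (n - i)))"
proof -
  define c d where "c i = rate ^ i / fact i" and "d j = (- rate) ^ j / fact j" for i j :: nat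
  define s where "s i = (step ^^ i) f" for i
  have fact_Suc': "real (Suc i) * (y * z / fact (Suc i)) = y * (z / fact i)" for i and y z :: real
    by (simp only: fact_Suc of_nat_mult of_nat_fact) (simp del: of_nat_Suc)
  have c_Suc: "rate * c i = real (Suc i) * c (Suc i)" for i
    by (simp only: c_def power_Suc fact_Suc')
  have d_Suc: "- rate * d j = real (Suc j) * d (Suc j)" for j
    by (simp only: d_def power_Suc fact_Suc')
  have "(gen ^^ n) f x = fact n * (\<Sum>i\<le>n. c i * s i x * d (n - i))" for x
  proof (induction n arbitrary: x)
    case 0
    then show ?case by (simp add: c_def d_def s_def)
  next
    case (Suc n)
    let ?E = "\<lambda>n x. \<Sum>i\<le>n. c i * s i x * d (n - i)"
    have E_eq: "?E n = (\<lambda>x. \<Sum>i\<le>n. (c i * d (n - i)) * s i x)"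
      by (simp add: mult_ac)
    have "gen (?E n) x = (\<Sum>i\<le>n. rate * (c i * d (n - i)) * (s (Suc i) x - s i x))"
      unfolding E_eq gen_eq_step step_sum
      by (simp add: s_def sum_distrib_left sum_subtractf algebra_simps)
    also have "\<dots> = (\<Sum>i\<le>n. (rate * c i) * s (Suc i) x * d (n - i))
        + (\<Sum>i\<le>n. c i * s i x * (- rate * d (n - i)))"
      by (simp add: algebra_simps sum_subtractf flip: sum.distrib)
    also have "(\<Sum>i\<le>n. (rate * c i) * s (Suc i) x * d (n - i))
        = (\<Sum>i\<le>Suc n. real i * c i * s i x * d (Suc n - i))"
      unfolding c_Suc by (subst sum.atMost_Suc_shift) (simp del: of_nat_Suc)
    also have "(\<Sum>i\<le>n. c i * s i x * (- rate * d (n - i)))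
        = (\<Sum>i\<le>n. c i * s i x * (real (Suc n - i) * d (Suc n - i)))"
      by (intro sum.cong refl) (simp only: d_Suc, simp only: Suc_diff_le atMost_iff)
    also have "\<dots> = (\<Sum>i\<le>Suc n. c i * s i x * (real (Suc n - i) * d (Suc n - i)))"
      by simp
    also have "(\<Sum>i\<le>Suc n. real i * c i * s i x * d (Suc n - i)) + \<dots>
        = (\<Sum>i\<le>Suc n. real (Suc n) * (c i * s i x * d (Suc n - i)))"
      unfolding sum.distrib[symmetric]
    proof (intro sum.cong refl, goal_cases)
      case (1 i)
      then have "real (Suc n) = real i + real (Suc n - i)" by simp
      then have "real (Suc n) * (c i * s i x * d (Suc n - i))
          = (real i + real (Suc n - i)) * (c i * s i x * d (Suc n - i))" by (rule arg_cong)
      moreover have "(real i + real (Suc n - i)) * (c i * s i x * d (Suc n - i))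
          = real i * c i * s i x * d (Suc n - i) + c i * s i x * (real (Suc n - i) * d (Suc n - i))"
        by (simp only: distrib_right mult.assoc mult.left_commute[of "real (Suc n - i)"])
      ultimately show ?case by simp
    qed
    finally have *: "gen (?E n) x = real (Suc n) * ?E (Suc n) x"
      by (simp only: sum_distrib_left)
    have "(gen ^^ n) f = (\<lambda>x. fact n * ?E n x)"
      using Suc.IH by (rule ext)
    then have "(gen ^^ Suc n) f x = gen (\<lambda>x. fact n * ?E n x) x"
      by (simp only: funpow.simps o_apply)
    also have "\<dots> = fact n * gen (?E n) x"
      by (simp add: gen_def sum_distrib_left algebra_simps)
    finally show ?case unfolding * fact_Suc by (simp only: of_nat_mult of_nat_fact mult_ac)
  qed
  then show ?thesis by (simp add: c_def d_def s_def)
qed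

lemma semigroup_sums_poisson:
  assumes "\<And>x. x \<in> S \<Longrightarrow> \<bar>f x\<bar> \<le> B" "x \<in> S" "t \<ge> 0"
  shows "(\<lambda>n. poisson t n * (step ^^ n) f x) sums semigroup t f x"
proof -
  define a where "a n = (rate * t) ^ n / fact n * (step ^^ n) f x" for n
  define b where "b n = (- rate * t) ^ n / fact n" for n
  have e: "(\<lambda>n. y ^ n / fact n) sums exp y" for y :: real
    using exp_converges[of y] by (simp add: field_simps)
  have a: "summable (\<lambda>n. norm (a n))"
  proof (rule summable_comparison_test')
    show "summable (\<lambda>n. B * ((rate * t) ^ n / fact n))"
      using e[THEN sums_summable] by (rule summable_mult)
    show "norm (norm (a n)) \<le> B * ((rate * t) ^ n / fact n)" for n
    proof -
      have "norm (norm (a n)) = \<bar>(step ^^ n) f x\<bar> * ((rate * t) ^ n / fact n)"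
        using rate_pos assms(3) by (simp add: a_def abs_mult)
      also have "\<dots> \<le> B * ((rate * t) ^ n / fact n)"
        using rate_pos assms(3) steps_bounded[OF assms(1,2)] by (intro mult_right_mono) auto
      finally show ?thesis .
    qed
  qed
  have b: "summable (\<lambda>n. norm (b n))"
    using e[of "\<bar>rate * t\<bar>"] by (auto simp: b_def power_abs abs_mult sums_iff)
  have eq: "t ^ n / fact n * (gen ^^ n) f x = (\<Sum>i\<le>n. a i * b (n - i))" for n
  proof -
    have "t ^ n / fact n * (gen ^^ n) f x = t ^ n * ((gen ^^ n) f x / fact n)"
      by simp
    also have "\<dots> = (\<Sum>i\<le>n. a i * b (n - i))"
      unfolding gen_power sum_distrib_left
    proof (intro sum.cong refl, goal_cases)
      case (1 i)
      then have "t ^ n = t ^ i * t ^ (n - i)" by (simp flip: power_add)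
      then show ?case by (simp add: a_def b_def power_mult_distrib) (simp add: power_minus[of rate] power_minus[of "rate * t"] power_mult_distrib)
    qed
    finally show ?thesis .
  qed
  have "(\<lambda>n. t ^ n / fact n * (gen ^^ n) f x) sums (suminf a * suminf b)"
    unfolding eq by (rule Cauchy_product_sums[OF a b])
  moreover have "suminf b = exp (- rate * t)"
    using sums_unique[OF e[of "- rate * t"]] by (simp add: b_def fun_eq_iff cong: suminf_cong)
  ultimately have "semigroup t f x = suminf a * exp (- rate * t)"
    by (simp add: semigroup_def sums_iff)
  moreover have "(\<lambda>n. exp (- rate * t) * a n) sums (exp (- rate * t) * suminf a)"
    using a by (intro sums_mult summable_sums) (rule summable_norm_cancel)
  ultimately show ?thesis by (simp add: a_def poisson_def mult_ac)
qed

lemma poisson_nonneg: "t \<ge> 0 \<Longrightarrow> poisson t n \<ge> 0"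
  using rate_pos by (simp add: poisson_def)

lemma poisson_sums: "poisson t sums 1"
proof -
  have "(\<lambda>n. exp (- rate * t) * ((rate * t) ^ n / fact n)) sums (exp (- rate * t) * exp (rate * t))"
    using exp_converges[of "rate * t"] by (intro sums_mult) (simp add: field_simps)
  then show ?thesis by (simp add: poisson_def[abs_def] flip: exp_add)
qed

lemma poisson_Suc: "poisson t (Suc n) * real (Suc n) = rate * t * poisson t n"
proof -
  have "fact (Suc n) = (1 + real n) * (fact n :: real)" by simp
  then show ?thesis
    unfolding poisson_def by (simp only: power_Suc of_nat_Suc) (simp add: divide_simps)
qed

text \<open>A function that the generator lowers at rate at most \<open>\<kappa>\<close> loses at most \<open>\<kappa> * t\<close> up to
  time \<open>t\<close>: after \<open>n\<close> steps it lost at most \<open>n * \<kappa> / rate\<close>, and the number of steps is Poisson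
  with mean \<open>rate * t\<close>.\<close>

lemma semigroup_lower_drift:
  assumes bd: "\<And>x. x \<in> S \<Longrightarrow> \<bar>u x\<bar> \<le> B"
    and drift: "\<And>x. x \<in> S \<Longrightarrow> gen u x \<ge> - \<kappa>"
    and "x \<in> S" "t \<ge> 0"
  shows "semigroup t u x \<ge> u x - \<kappa> * t"
proof -
  have "step u x \<ge> u x - \<kappa> / rate" if "x \<in> S" for x
    using drift[OF that] rate_pos by (simp add: gen_eq_step field_simps)
  then have one: "(step ^^ n) (step u) x \<ge> (step ^^ n) (\<lambda>x. 1 * u x + 1 * (- \<kappa> / rate)) x"
    if "x \<in> S" for x n
    using that by (intro steps_mono) auto
  have iter: "(step ^^ n) u x \<ge> u x - real n * (\<kappa> / rate)" for n
  proof (induction n)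
    case (Suc n)
    have "(step ^^ Suc n) u x \<ge> (step ^^ n) u x - \<kappa> / rate"
      using one[OF assms(3), of n] unfolding steps_affine steps_const funpow_Suc_right by simp
    with Suc show ?case by (simp add: algebra_simps add_divide_distrib)
  qed simp
  have mean: "(\<lambda>n. poisson t n * real n) sums (rate * t)"
  proof -
    have "(\<lambda>n. poisson t (Suc n) * real (Suc n)) sums (rate * t * 1)"
      unfolding poisson_Suc by (intro sums_mult poisson_sums)
    then show ?thesis by (subst (asm) sums_Suc_iff) simp
  qed
  have "(\<lambda>n. poisson t n * u x - (\<kappa> / rate) * (poisson t n * real n)) sums (1 * u x - (\<kappa> / rate) * (rate * t))"
    by (intro sums_diff sums_mult2 sums_mult poisson_sums mean)
  moreover have "(\<lambda>n. poisson t n * (step ^^ n) u x) sums semigroup t u x"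
    using bd assms(3,4) by (rule semigroup_sums_poisson)
  ultimately have "1 * u x - (\<kappa> / rate) * (rate * t) \<le> semigroup t u x"
  proof (rule sums_le[rotated])
    fix n
    have "poisson t n * (u x - real n * (\<kappa> / rate)) \<le> poisson t n * (step ^^ n) u x"
      by (intro mult_left_mono iter poisson_nonneg assms)
    then show "poisson t n * u x - (\<kappa> / rate) * (poisson t n * real n) \<le> poisson t n * (step ^^ n) u x"
      by (simp only: right_diff_distrib mult_ac)
  qed
  then show ?thesis using rate_pos by simp
qed

text \<open>If \<open>B\<close> cannot be entered and \<open>V \<ge> 0\<close> decreases at rate \<open>\<kappa>\<close> while the chain is in \<open>B\<close>, the
  expected time in \<open>B\<close> is at most \<open>V / \<kappa>\<close>. As the probability of being in \<open>B\<close> is decreasing, it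
  is at most its running average.\<close>

lemma steps_absorbing:
  assumes inB: "\<And>i x. i \<in> I \<Longrightarrow> x \<in> S \<Longrightarrow> x \<notin> B \<Longrightarrow> m i x \<notin> B"
    and V0: "\<And>x. x \<in> S \<Longrightarrow> V x \<ge> 0"
    and drift: "\<And>x. x \<in> S \<Longrightarrow> gen V x \<le> - \<kappa> * indicator B x"
    and "\<kappa> > 0" "x \<in> S"
  shows "real (Suc n) * (step ^^ n) (indicator B) x \<le> V x * rate / \<kappa>"
proof -
  let ?b = "\<lambda>n. (step ^^ n) (indicator B) x"
  have "step (indicator B) x \<le> indicator B x" if "x \<in> S" for x
  proof (cases "x \<in> B")
    case True
    have "step (indicator B) x \<le> step (\<lambda>_. 1) x"
      using that by (intro step_mono) (auto simp: indicator_def)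
    then show ?thesis using True by (simp add: step_const)
  next
    case False
    then show ?thesis using inB[OF _ that False] by (simp add: step_def)
  qed
  then have dec: "?b (Suc n) \<le> ?b n" for n
    unfolding funpow_Suc_right o_def using assms(5) by (intro steps_mono) auto
  have "step V x \<le> 1 * V x + (- \<kappa> / rate) * indicator B x" if "x \<in> S" for x
    using drift[OF that] rate_pos by (simp add: gen_eq_step field_simps)
  then have "(step ^^ n) (step V) x \<le> (step ^^ n) (\<lambda>x. 1 * V x + (- \<kappa> / rate) * indicator B x) x" for n
    using assms(5) by (intro steps_mono) auto
  then have VSuc: "(step ^^ Suc n) V x \<le> (step ^^ n) V x - (\<kappa> / rate) * ?b n" for n
    unfolding steps_affine funpow_Suc_right by simp
  have "(step ^^ n) V x \<le> V x - (\<kappa> / rate) * (\<Sum>j<n. ?b j)" for n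
  proof (induction n)
    case (Suc n)
    then show ?case using VSuc[of n] by (simp add: algebra_simps)
  qed simp
  moreover have "(step ^^ n) V x \<ge> 0" for n
    using steps_mono[of "\<lambda>_. 0" V x n] V0 assms(5) by (simp add: steps_const)
  ultimately have "0 \<le> V x - (\<kappa> / rate) * (\<Sum>j<Suc n. ?b j)"
    by (rule order_trans[rotated])
  then have sum: "(\<kappa> / rate) * (\<Sum>j<Suc n. ?b j) \<le> V x"
    by (rule diff_ge_0_iff_ge[THEN iffD1])
  have "real (Suc n) * ?b n = (\<Sum>j<Suc n. ?b n)" by simp
  also have "\<dots> \<le> (\<Sum>j<Suc n. ?b j)"
  proof (rule sum_mono)
    fix j assume "j \<in> {..<Suc n}"
    then show "?b n \<le> ?b j"
      by (intro lift_Suc_antimono_le[of ?b, OF dec]) simp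
  qed
  finally have "(\<kappa> / rate) * (real (Suc n) * ?b n) \<le> (\<kappa> / rate) * (\<Sum>j<Suc n. ?b j)"
    using \<open>\<kappa> > 0\<close> rate_pos by (intro mult_left_mono) auto
  with sum have "(\<kappa> / rate) * (real (Suc n) * ?b n) \<le> V x" by (rule order_trans[rotated])
  then show ?thesis using \<open>\<kappa> > 0\<close> rate_pos by (simp add: field_simps)
qed

lemma semigroup_absorbing:
  assumes inB: "\<And>i x. i \<in> I \<Longrightarrow> x \<in> S \<Longrightarrow> x \<notin> B \<Longrightarrow> m i x \<notin> B"
    and V0: "\<And>x. x \<in> S \<Longrightarrow> V x \<ge> 0"
    and drift: "\<And>x. x \<in> S \<Longrightarrow> gen V x \<le> - \<kappa> * indicator B x"
    and "\<kappa> > 0" "x \<in> S" "t > 0"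
  shows "semigroup t (indicator B) x \<le> V x / (\<kappa> * t)"
proof -
  have "(\<lambda>n. poisson t (Suc n)) sums (1 - poisson t 0)"
    using poisson_sums[of t] by (subst sums_Suc_iff) simp
  then have sums: "(\<lambda>n. (V x / (\<kappa> * t)) * poisson t (Suc n)) sums ((V x / (\<kappa> * t)) * (1 - poisson t 0))"
    by (rule sums_mult)
  have "(\<lambda>n. poisson t n * (step ^^ n) (indicator B) x) sums semigroup t (indicator B) x"
    using semigroup_sums_poisson[of "indicator B" 1 x t] assms by auto
  from this sums have "semigroup t (indicator B) x \<le> (V x / (\<kappa> * t)) * (1 - poisson t 0)"
  proof (rule sums_le[rotated])
    fix n
    have "(step ^^ n) (indicator B) x \<le> V x * rate / \<kappa> / real (Suc n)"
      using steps_absorbing[OF assms(1-5), of n]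
      by (subst pos_le_divide_eq) (auto simp: mult.commute simp del: of_nat_Suc)
    then have "poisson t n * (step ^^ n) (indicator B) x \<le> poisson t n * (V x * rate / \<kappa> / real (Suc n))"
      using assms by (intro mult_left_mono poisson_nonneg) auto
    also have "\<dots> = (V x / (\<kappa> * t)) * ((rate * t * poisson t n) / real (Suc n))"
      using assms by (simp del: of_nat_Suc)
    also have "\<dots> = (V x / (\<kappa> * t)) * poisson t (Suc n)"
      unfolding poisson_Suc[symmetric] by (simp del: of_nat_Suc)
    finally show "poisson t n * (step ^^ n) (indicator B) x \<le> (V x / (\<kappa> * t)) * poisson t (Suc n)" .
  qed
  also have "\<dots> \<le> (V x / (\<kappa> * t)) * 1"
    using assms V0[OF assms(5)] poisson_nonneg[of t 0] by (intro mult_left_mono) auto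
  finally show ?thesis by simp
qed

end

context random_maps
begin

definition kernel :: "real \<Rightarrow> 'a \<Rightarrow> 'a \<Rightarrow> real" where
  "kernel t x \<xi> = semigroup t (indicator {\<xi>}) x"

definition dist_from :: "'a pmf \<Rightarrow> real \<Rightarrow> 'a \<Rightarrow> real" where
  "dist_from \<pi> t x = (1 / 2) * (\<Sum>\<xi>\<in>S. \<bar>kernel t x \<xi> - pmf \<pi> \<xi>\<bar>)"

definition stationary :: "'a pmf \<Rightarrow> bool" where
  "stationary \<pi> \<longleftrightarrow>
    set_pmf \<pi> \<subseteq> S \<and> (\<forall>t\<ge>0. \<forall>\<xi>\<in>S. (\<Sum>\<eta>\<in>S. pmf \<pi> \<eta> * kernel t \<eta> \<xi>) = pmf \<pi> \<xi>)"

lemma function_expansion: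
  fixes f :: "'a \<Rightarrow> real"
  assumes "finite S" "x \<in> S"
  shows "f x = (\<Sum>\<xi>\<in>S. f \<xi> * indicator {\<xi>} x)"
  using assms by (simp add: indicator_def if_distrib[of "(*) _"] cong: if_cong)

lemma steps_expansion:
  assumes "finite S" "x \<in> S"
  shows "(step ^^ n) f x = (\<Sum>\<xi>\<in>S. f \<xi> * (step ^^ n) (indicator {\<xi>}) x)"
proof -
  have "(step ^^ n) f x = (step ^^ n) (\<lambda>x. \<Sum>\<xi>\<in>S. f \<xi> * indicator {\<xi>} x) x"
    by (rule steps_cong) (use assms function_expansion in auto)
  then show ?thesis by (simp only: steps_sum)
qed

lemma semigroup_expansion:
  assumes "finite S" "x \<in> S" "t \<ge> 0"
  shows "semigroup t f x = (\<Sum>\<xi>\<in>S. f \<xi> * kernel t x \<xi>)"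
proof -
  have fin: "finite ((\<lambda>x. \<bar>f x\<bar>) ` S)" using assms by simp
  have "(\<lambda>n. poisson t n * (step ^^ n) f x) sums semigroup t f x"
    using assms Max_ge[OF fin] by (intro semigroup_sums_poisson[where B = "Max ((\<lambda>x. \<bar>f x\<bar>) ` S)"]) auto
  moreover have "(\<lambda>n. \<Sum>\<xi>\<in>S. f \<xi> * (poisson t n * (step ^^ n) (indicator {\<xi>}) x)) sums (\<Sum>\<xi>\<in>S. f \<xi> * kernel t x \<xi>)"
    unfolding kernel_def using assms
    by (intro sums_sum sums_mult semigroup_sums_poisson[where B = 1]) auto
  moreover have "(\<Sum>\<xi>\<in>S. f \<xi> * (poisson t n * (step ^^ n) (indicator {\<xi>}) x)) = poisson t n * (step ^^ n) f x" for n
    by (subst steps_expansion[OF assms(1,2), of n f]) (simp only: sum_distrib_left mult_ac)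
  ultimately show ?thesis by (simp add: sums_iff)
qed

lemma semigroup_const: "semigroup t (\<lambda>_. c) x = c"
proof -
  have 0: "(gen ^^ Suc n) (\<lambda>_. c) x = 0" for n x
  proof -
    have "gen (\<lambda>_. c) = (\<lambda>_. 0)" by (simp add: gen_def fun_eq_iff)
    moreover have "(gen ^^ n) (\<lambda>_. 0) = (\<lambda>_. 0)"
      by (induction n) (simp_all add: gen_def fun_eq_iff)
    ultimately show ?thesis unfolding funpow_Suc_right o_apply by simp
  qed
  have "semigroup t (\<lambda>_. c) x = (\<Sum>n\<in>{0}. t ^ n / fact n * (gen ^^ n) (\<lambda>_. c) x)"
    unfolding semigroup_def
  proof (rule suminf_finite)
    fix n :: nat assume "n \<notin> {0}"
    then obtain k where "n = Suc k" by (cases n) auto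
    then show "t ^ n / fact n * (gen ^^ n) (\<lambda>_. c) x = 0" using 0[of k x] by simp
  qed simp
  then show ?thesis by simp
qed

lemma kernel_sum:
  assumes "finite S" "x \<in> S" "t \<ge> 0"
  shows "(\<Sum>\<xi>\<in>S. kernel t x \<xi>) = 1"
  using semigroup_expansion[OF assms, of "\<lambda>_. 1"] by (simp add: semigroup_const)

lemma test_function_le_dist:
  assumes "finite S" "x \<in> S" "t \<ge> 0" "set_pmf \<pi> \<subseteq> S"
    and u: "\<And>x. x \<in> S \<Longrightarrow> 0 \<le> u x \<and> u x \<le> 1"
  shows "semigroup t u x - (\<Sum>\<xi>\<in>S. u \<xi> * pmf \<pi> \<xi>) \<le> dist_from \<pi> t x"
proof -
  have "semigroup t u x - (\<Sum>\<xi>\<in>S. u \<xi> * pmf \<pi> \<xi>) = (\<Sum>\<xi>\<in>S. u \<xi> * (kernel t x \<xi> - pmf \<pi> \<xi>))"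
    by (simp add: semigroup_expansion assms right_diff_distrib sum_subtractf)
  \<comment> \<open>Both laws have mass 1, so \<open>u\<close> may be centred; this yields the factor \<open>1 / 2\<close> of the distance.\<close>
  also have "\<dots> = (\<Sum>\<xi>\<in>S. (u \<xi> - 1 / 2) * (kernel t x \<xi> - pmf \<pi> \<xi>))"
    using kernel_sum[of x t] sum_pmf_eq_1[of S \<pi>] assms
    by (simp add: left_diff_distrib right_diff_distrib sum_subtractf flip: sum_divide_distrib)
  also have "\<dots> \<le> (\<Sum>\<xi>\<in>S. 1 / 2 * \<bar>kernel t x \<xi> - pmf \<pi> \<xi>\<bar>)"
  proof (rule sum_mono)
    fix \<xi> assume "\<xi> \<in> S"
    then have "\<bar>u \<xi> - 1 / 2\<bar> \<le> 1 / 2" using u[of \<xi>] unfolding abs_le_iff by linarith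
    then have "\<bar>u \<xi> - 1 / 2\<bar> * \<bar>kernel t x \<xi> - pmf \<pi> \<xi>\<bar> \<le> 1 / 2 * \<bar>kernel t x \<xi> - pmf \<pi> \<xi>\<bar>"
      by (rule mult_right_mono) simp
    then show "(u \<xi> - 1 / 2) * (kernel t x \<xi> - pmf \<pi> \<xi>) \<le> 1 / 2 * \<bar>kernel t x \<xi> - pmf \<pi> \<xi>\<bar>"
      unfolding abs_mult[symmetric] by (rule order_trans[OF abs_ge_self])
  qed
  also have "\<dots> = dist_from \<pi> t x"
    by (simp add: dist_from_def sum_distrib_left)
  finally show ?thesis .
qed

text \<open>Two slowly decaying functions with \<open>u1 + u2 \<le> 1\<close> that are close to 1 at \<open>x1\<close> and at \<open>x2\<close> keep
  the laws started there almost singular; so no law is much closer than \<open>1 / 2\<close> to both of them.\<close>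

lemma dist_lower_bound:
  assumes "finite S" "set_pmf \<pi> \<subseteq> S" "x1 \<in> S" "x2 \<in> S" "t \<ge> 0"
    and u: "\<And>x. x \<in> S \<Longrightarrow> 0 \<le> u1 x \<and> 0 \<le> u2 x \<and> u1 x + u2 x \<le> 1"
    and drift: "\<And>x. x \<in> S \<Longrightarrow> gen u1 x \<ge> - \<kappa>" "\<And>x. x \<in> S \<Longrightarrow> gen u2 x \<ge> - \<kappa>"
    and start: "u1 x1 \<ge> 1 - e" "u2 x2 \<ge> 1 - e"
  shows "\<exists>x\<in>S. dist_from \<pi> t x \<ge> 1 / 2 - e - \<kappa> * t"
proof -
  have u01: "0 \<le> u1 x \<and> u1 x \<le> 1" "0 \<le> u2 x \<and> u2 x \<le> 1" if "x \<in> S" for x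
    using u[OF that] by auto
  then have "\<bar>u1 x\<bar> \<le> 1" "\<bar>u2 x\<bar> \<le> 1" if "x \<in> S" for x
    using that by auto
  then have "semigroup t u1 x1 \<ge> u1 x1 - \<kappa> * t" "semigroup t u2 x2 \<ge> u2 x2 - \<kappa> * t"
    using assms by (auto intro!: semigroup_lower_drift[where B = 1])
  moreover have "semigroup t u1 x1 - (\<Sum>\<xi>\<in>S. u1 \<xi> * pmf \<pi> \<xi>) \<le> dist_from \<pi> t x1"
    using u01 assms(1-5) by (intro test_function_le_dist) auto
  moreover have "semigroup t u2 x2 - (\<Sum>\<xi>\<in>S. u2 \<xi> * pmf \<pi> \<xi>) \<le> dist_from \<pi> t x2"
    using u01 assms(1-5) by (intro test_function_le_dist) auto
  moreover have "(\<Sum>\<xi>\<in>S. u1 \<xi> * pmf \<pi> \<xi>) + (\<Sum>\<xi>\<in>S. u2 \<xi> * pmf \<pi> \<xi>) \<le> 1"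
  proof -
    have "(\<Sum>\<xi>\<in>S. (u1 \<xi> + u2 \<xi>) * pmf \<pi> \<xi>) \<le> (\<Sum>\<xi>\<in>S. 1 * pmf \<pi> \<xi>)"
      using u by (intro sum_mono mult_right_mono) auto
    then show ?thesis using sum_pmf_eq_1[of S \<pi>] assms by (simp add: distrib_right sum.distrib)
  qed
  ultimately have "dist_from \<pi> t x1 + dist_from \<pi> t x2 \<ge> 1 - 2 * e - 2 * (\<kappa> * t)"
    using start by linarith
  then have "dist_from \<pi> t x1 \<ge> 1 / 2 - e - \<kappa> * t \<or> dist_from \<pi> t x2 \<ge> 1 / 2 - e - \<kappa> * t"
    by argo
  then show ?thesis using assms(3,4) by blast
qed

end

section \<open>Coalescing pairs\<close>

locale coalescing = random_maps I r m S
  for I :: "'i set" and r :: "'i \<Rightarrow> real" and m :: "'i \<Rightarrow> 'a \<Rightarrow> 'a" and S :: "'a set" +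
  fixes D :: "('a \<times> 'a) set" and V :: "'a \<times> 'a \<Rightarrow> real" and \<kappa> v :: real and b :: 'a
  assumes finite_S: "finite S"
    and D_subset: "D \<subseteq> S \<times> S"
    and D_closed: "\<And>i x y. i \<in> I \<Longrightarrow> (x, y) \<in> D \<Longrightarrow> (m i x, m i y) \<in> D"
    and b_in_S: "b \<in> S"
    and pair_b: "\<And>x. x \<in> S \<Longrightarrow> (x, b) \<in> D"
    and V_nonneg: "\<And>z. z \<in> D \<Longrightarrow> V z \<ge> 0"
    and V_le: "\<And>x. x \<in> S \<Longrightarrow> V (x, b) \<le> v"
    and \<kappa>_pos: "\<kappa> > 0"
    and V_drift: "\<And>x y. (x, y) \<in> D \<Longrightarrow> x \<noteq> y \<Longrightarrow>
      (\<Sum>i\<in>I. r i * (V (m i x, m i y) - V (x, y))) \<le> - \<kappa>"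
begin

sublocale pair: random_maps I r "\<lambda>i z. (m i (fst z), m i (snd z))" D
  by unfold_locales (auto simp: finite_maps r_nonneg rate_pos' D_closed)

definition off :: "('a \<times> 'a) set" where "off = {z. fst z \<noteq> snd z}"

lemma v_nonneg: "v \<ge> 0"
  using V_nonneg[OF pair_b[OF b_in_S]] V_le[OF b_in_S] by simp

lemma pair_steps_fst: "(pair.step ^^ n) (\<lambda>z. f (fst z)) = (\<lambda>z. (step ^^ n) f (fst z))"
proof (induction n)
  case (Suc n)
  show ?case unfolding funpow.simps o_apply Suc.IH by (simp add: fun_eq_iff pair.step_def step_def)
qed simp

lemma pair_steps_snd: "(pair.step ^^ n) (\<lambda>z. f (snd z)) = (\<lambda>z. (step ^^ n) f (snd z))"
proof (induction n)
  case (Suc n)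
  show ?case unfolding funpow.simps o_apply Suc.IH by (simp add: fun_eq_iff pair.step_def step_def)
qed simp

text \<open>A function bounded by 1 separates the two copies by at most 2, and only while they differ.\<close>

lemma steps_difference:
  assumes f: "\<And>x. x \<in> S \<Longrightarrow> \<bar>f x\<bar> \<le> 1" and "x \<in> S"
  shows "\<bar>(step ^^ n) f x - (step ^^ n) f b\<bar> \<le> 2 * (pair.step ^^ n) (indicator off) (x, b)"
proof -
  have D: "(x, b) \<in> D" by (rule pair_b[OF assms(2)])
  have mem: "fst z \<in> S" "snd z \<in> S" if "z \<in> D" for z using that D_subset by auto
  have *: "\<sigma> * (step ^^ n) f x + - \<sigma> * (step ^^ n) f b \<le> 2 * (pair.step ^^ n) (indicator off) (x, b)"
    if \<sigma>: "\<bar>\<sigma>\<bar> = 1" for \<sigma> :: real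
  proof -
    have "(pair.step ^^ n) (\<lambda>z. \<sigma> * f (fst z) + - \<sigma> * f (snd z)) (x, b)
        \<le> (pair.step ^^ n) (\<lambda>z. 2 * indicator off z + 0 * indicator off z) (x, b)"
    proof (rule pair.steps_mono[OF _ D])
      fix z assume z: "z \<in> D"
      show "\<sigma> * f (fst z) + - \<sigma> * f (snd z) \<le> 2 * indicator off z + 0 * indicator off z"
      proof (cases "z \<in> off")
        case True
        have "\<sigma> * f (fst z) \<le> \<bar>f (fst z)\<bar>" "- \<sigma> * f (snd z) \<le> \<bar>f (snd z)\<bar>"
          using abs_ge_self[of "\<sigma> * f (fst z)"] abs_ge_self[of "- \<sigma> * f (snd z)"] \<sigma>
          by (simp_all add: abs_mult)
        then show ?thesis using True f[OF mem(1)[OF z]] f[OF mem(2)[OF z]] by simp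
      qed (simp add: off_def)
    qed
    then show ?thesis
      unfolding pair.steps_affine pair_steps_fst pair_steps_snd by simp
  qed
  from *[of 1] *[of "-1"] show ?thesis by simp
qed

text \<open>As \<open>V \<ge> 0\<close>, replacing it by 0 at coalescence can only make it decrease faster, and it makes the
diagonal stationary.\<close>

lemma stopped_V:
  defines "W \<equiv> \<lambda>z. if z \<in> off then V z else 0"
  shows "z \<in> D \<Longrightarrow> pair.gen W z \<le> - \<kappa> * indicator off z"
proof -
  assume z: "z \<in> D"
  obtain x y where xy: "z = (x, y)" by (cases z)
  show ?thesis
  proof (cases "x = y")
    case True
    then show ?thesis by (simp add: xy pair.gen_def W_def off_def)
  next
    case False
    have "pair.gen W z \<le> (\<Sum>i\<in>I. r i * (V (m i x, m i y) - V (x, y)))"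
      unfolding pair.gen_def
    proof (intro sum_mono mult_left_mono)
      fix i assume "i \<in> I"
      then have "V (m i x, m i y) \<ge> 0" using z xy by (auto intro: V_nonneg D_closed)
      then have "W (m i x, m i y) \<le> V (m i x, m i y)" unfolding W_def by simp
      then show "W (m i (fst z), m i (snd z)) - W z \<le> V (m i x, m i y) - V (x, y)"
        using False by (simp add: xy W_def off_def)
    qed (rule r_nonneg)
    also have "\<dots> \<le> - \<kappa>" using V_drift z xy False by blast
    finally show ?thesis using False by (simp add: xy off_def)
  qed
qed

lemma stopped_V_start:
  assumes "x \<in> S"
  shows "(if (x, b) \<in> off then V (x, b) else 0) \<le> v"
  using V_le[OF assms] v_nonneg by simp

lemma steps_coalescence:
  assumes f: "\<And>x. x \<in> S \<Longrightarrow> \<bar>f x\<bar> \<le> 1" and "x \<in> S"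
  shows "\<bar>(step ^^ n) f x - (step ^^ n) f b\<bar> \<le> 2 * v * rate / \<kappa> / real (Suc n)"
proof -
  define W where "W = (\<lambda>z. if z \<in> off then V z else 0)"
  have "real (Suc n) * (pair.step ^^ n) (indicator off) (x, b) \<le> W (x, b) * rate / \<kappa>"
    by (rule pair.steps_absorbing)
      (use stopped_V V_nonneg pair_b assms \<kappa>_pos in \<open>auto simp: W_def off_def\<close>)
  also have "\<dots> \<le> v * rate / \<kappa>"
    using stopped_V_start[OF assms(2)] \<kappa>_pos rate_pos
    by (intro divide_right_mono mult_right_mono) (auto simp: W_def)
  finally have "(pair.step ^^ n) (indicator off) (x, b) \<le> v * rate / \<kappa> / real (Suc n)"
    by (subst pos_le_divide_eq) (simp_all only: mult.commute of_nat_0_less_iff zero_less_Suc)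
  then have "2 * (pair.step ^^ n) (indicator off) (x, b) \<le> 2 * v * rate / \<kappa> / real (Suc n)"
    by simp
  then show ?thesis using steps_difference[where f = f and x = x and n = n, OF assms] by linarith
qed

lemma semigroup_coalescence:
  assumes f: "\<And>x. x \<in> S \<Longrightarrow> \<bar>f x\<bar> \<le> 1" and "x \<in> S" "t > 0"
  shows "\<bar>semigroup t f x - semigroup t f b\<bar> \<le> 2 * v / (\<kappa> * t)"
proof -
  define W where "W = (\<lambda>z. if z \<in> off then V z else 0)"
  have bound: "pair.semigroup t (indicator off) (x, b) \<le> W (x, b) / (\<kappa> * t)"
    by (rule pair.semigroup_absorbing)
      (use stopped_V V_nonneg pair_b assms \<kappa>_pos in \<open>auto simp: W_def off_def\<close>)
  have off: "(\<lambda>n. poisson t n * (pair.step ^^ n) (indicator off) (x, b)) sums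
      pair.semigroup t (indicator off) (x, b)"
    using pair.semigroup_sums_poisson[of "indicator off" 1 "(x, b)" t] assms pair_b by simp
  have fx: "(\<lambda>n. poisson t n * (step ^^ n) f x) sums semigroup t f x" if "x \<in> S" for x
    using semigroup_sums_poisson[of f 1 x t] f that assms by simp
  have "\<sigma> * semigroup t f x - \<sigma> * semigroup t f b \<le> 2 * pair.semigroup t (indicator off) (x, b)"
    if \<sigma>: "\<bar>\<sigma>\<bar> = 1" for \<sigma> :: real
  proof (rule sums_le)
    show "(\<lambda>n. \<sigma> * (poisson t n * (step ^^ n) f x) - \<sigma> * (poisson t n * (step ^^ n) f b)) sums
        (\<sigma> * semigroup t f x - \<sigma> * semigroup t f b)"
      by (intro sums_diff sums_mult fx assms b_in_S)
    show "(\<lambda>n. 2 * (poisson t n * (pair.step ^^ n) (indicator off) (x, b))) sums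
        (2 * pair.semigroup t (indicator off) (x, b))"
      by (intro sums_mult off)
    fix n
    have "\<sigma> * ((step ^^ n) f x - (step ^^ n) f b) \<le> \<bar>(step ^^ n) f x - (step ^^ n) f b\<bar>"
      using abs_ge_self[of "\<sigma> * ((step ^^ n) f x - (step ^^ n) f b)"] \<sigma> unfolding abs_mult by simp
    also have "\<dots> \<le> 2 * (pair.step ^^ n) (indicator off) (x, b)"
      by (rule steps_difference[OF assms(1,2)])
    finally have "poisson t n * (\<sigma> * ((step ^^ n) f x - (step ^^ n) f b))
        \<le> poisson t n * (2 * (pair.step ^^ n) (indicator off) (x, b))"
      using assms by (intro mult_left_mono poisson_nonneg) auto
    moreover have "poisson t n * (\<sigma> * ((step ^^ n) f x - (step ^^ n) f b))
        = \<sigma> * (poisson t n * (step ^^ n) f x) - \<sigma> * (poisson t n * (step ^^ n) f b)"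
      by (simp only: right_diff_distrib mult_ac)
    ultimately show "\<sigma> * (poisson t n * (step ^^ n) f x) - \<sigma> * (poisson t n * (step ^^ n) f b)
        \<le> 2 * (poisson t n * (pair.step ^^ n) (indicator off) (x, b))"
      by (simp only: mult.left_commute)
  qed
  from this[of 1] this[of "-1"]
  have "\<bar>semigroup t f x - semigroup t f b\<bar> \<le> 2 * pair.semigroup t (indicator off) (x, b)" by simp
  also have "\<dots> \<le> 2 * (W (x, b) / (\<kappa> * t))" using bound by simp
  also have "\<dots> \<le> 2 * (v / (\<kappa> * t))"
    using stopped_V_start[OF assms(2)] \<kappa>_pos assms(3)
    by (intro mult_left_mono divide_right_mono) (auto simp: W_def)
  finally show ?thesis by simp
qed

lemma dist_le:
  assumes \<pi>: "stationary \<pi>" and "x \<in> S" "t > 0"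
  shows "dist_from \<pi> t x \<le> 2 * v / (\<kappa> * t)"
proof -
  define f where "f \<xi> = sgn (kernel t x \<xi> - pmf \<pi> \<xi>)" for \<xi>
  have f: "\<bar>f \<xi>\<bar> \<le> 1" for \<xi> by (simp add: f_def abs_sgn_eq)
  have sum_\<pi>: "(\<Sum>\<eta>\<in>S. pmf \<pi> \<eta>) = 1"
    using \<pi> finite_S by (intro sum_pmf_eq_1) (auto simp: stationary_def)
  have close: "semigroup t f x - semigroup t f \<eta> \<le> 4 * v / (\<kappa> * t)" if "\<eta> \<in> S" for \<eta>
    using semigroup_coalescence[of f x t] semigroup_coalescence[of f \<eta> t] f that assms(2,3)
    by (simp add: abs_le_iff)
  have "(\<Sum>\<xi>\<in>S. \<bar>kernel t x \<xi> - pmf \<pi> \<xi>\<bar>) = (\<Sum>\<xi>\<in>S. f \<xi> * kernel t x \<xi>) - (\<Sum>\<xi>\<in>S. f \<xi> * pmf \<pi> \<xi>)"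
    by (simp add: f_def abs_sgn left_diff_distrib mult.commute[of "sgn _"] flip: sum_subtractf)
  also have "(\<Sum>\<xi>\<in>S. f \<xi> * pmf \<pi> \<xi>) = (\<Sum>\<xi>\<in>S. f \<xi> * (\<Sum>\<eta>\<in>S. pmf \<pi> \<eta> * kernel t \<eta> \<xi>))"
    using \<pi> assms by (intro sum.cong refl) (auto simp: stationary_def)
  also have "\<dots> = (\<Sum>\<eta>\<in>S. pmf \<pi> \<eta> * semigroup t f \<eta>)"
  proof -
    have "(\<Sum>\<xi>\<in>S. f \<xi> * (\<Sum>\<eta>\<in>S. pmf \<pi> \<eta> * kernel t \<eta> \<xi>))
        = (\<Sum>\<xi>\<in>S. \<Sum>\<eta>\<in>S. pmf \<pi> \<eta> * (f \<xi> * kernel t \<eta> \<xi>))"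
      by (simp only: sum_distrib_left mult.left_commute)
    also have "\<dots> = (\<Sum>\<eta>\<in>S. \<Sum>\<xi>\<in>S. pmf \<pi> \<eta> * (f \<xi> * kernel t \<eta> \<xi>))"
      by (rule sum.swap)
    also have "\<dots> = (\<Sum>\<eta>\<in>S. pmf \<pi> \<eta> * semigroup t f \<eta>)"
      using finite_S assms(3) by (simp add: semigroup_expansion flip: sum_distrib_left)
    finally show ?thesis .
  qed
  also have "(\<Sum>\<xi>\<in>S. f \<xi> * kernel t x \<xi>) = (\<Sum>\<eta>\<in>S. pmf \<pi> \<eta> * semigroup t f x)"
    using finite_S assms sum_\<pi> by (simp add: semigroup_expansion flip: sum_distrib_right)
  also have "\<dots> - (\<Sum>\<eta>\<in>S. pmf \<pi> \<eta> * semigroup t f \<eta>)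
      = (\<Sum>\<eta>\<in>S. pmf \<pi> \<eta> * (semigroup t f x - semigroup t f \<eta>))"
    by (simp add: right_diff_distrib sum_subtractf)
  also have "\<dots> \<le> (\<Sum>\<eta>\<in>S. pmf \<pi> \<eta> * (4 * v / (\<kappa> * t)))"
    by (intro sum_mono mult_left_mono close) auto
  also have "\<dots> = 4 * v / (\<kappa> * t)"
    by (simp only: sum_\<pi> mult_1_left flip: sum_distrib_right)
  finally show ?thesis by (simp add: dist_from_def)
qed

lemma stationary_unique:
  assumes "stationary \<pi>" "stationary \<rho>"
  shows "\<pi> = \<rho>"
proof (rule pmf_eqI)
  fix \<xi>
  show "pmf \<pi> \<xi> = pmf \<rho> \<xi>"
  proof (cases "\<xi> \<in> S")
    case False
    then have "\<xi> \<notin> set_pmf \<pi>" "\<xi> \<notin> set_pmf \<rho>" using assms by (auto simp: stationary_def)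
    then show ?thesis by (simp add: set_pmf_iff)
  next
    case True
    have lim: "((\<lambda>t. kernel t b \<xi>) \<longlongrightarrow> pmf \<pi> \<xi>) at_top" if \<pi>: "stationary \<pi>" for \<pi>
    proof (rule LIM_zero_cancel, rule Lim_null_comparison)
      show "\<forall>\<^sub>F t in at_top. norm (kernel t b \<xi> - pmf \<pi> \<xi>) \<le> 4 * v / \<kappa> * inverse t"
        using eventually_gt_at_top[of 0]
      proof eventually_elim
        case (elim t)
        have "\<bar>kernel t b \<xi> - pmf \<pi> \<xi>\<bar> \<le> (\<Sum>\<xi>\<in>S. \<bar>kernel t b \<xi> - pmf \<pi> \<xi>\<bar>)"
          using finite_S True by (intro member_le_sum) auto
        also have "\<dots> \<le> 4 * v / (\<kappa> * t)"
          using dist_le[OF \<pi> b_in_S elim] by (simp add: dist_from_def)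
        finally show ?case using elim v_nonneg \<kappa>_pos by (simp add: field_simps)
      qed
      show "((\<lambda>t. 4 * v / \<kappa> * inverse t) \<longlongrightarrow> 0) at_top"
        by (intro tendsto_mult_right_zero tendsto_inverse_0_at_top filterlim_ident)
    qed
    show ?thesis using tendsto_unique[OF _ lim[OF assms(1)] lim[OF assms(2)]] by simp
  qed
qed

text \<open>After \<open>n\<close> steps the expectation of a bounded function is almost independent of the starting point,
so the laws of the discrete-time chain started in \<open>b\<close> form a Cauchy sequence. Their limit is invariant
under one step, and therefore under the Poisson mixture of all numbers of steps.\<close>

lemma stationary_exists: "\<exists>\<pi>. stationary \<pi>"
proof -
  define k where "k n \<xi> = (step ^^ n) (indicator {\<xi>}) b" for n \<xi>
  have k_nonneg: "k n \<xi> \<ge> 0" for n \<xi>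
    using steps_mono[of "\<lambda>_. 0" "indicator {\<xi>}" b n] b_in_S by (simp add: k_def steps_const)
  have expand: "(step ^^ n) f b = (\<Sum>\<xi>\<in>S. f \<xi> * k n \<xi>)" for n f
    unfolding k_def by (rule steps_expansion[OF finite_S b_in_S])
  have close: "\<bar>k (n + j) \<xi> - k n \<xi>\<bar> \<le> 2 * v * rate / \<kappa> / real (Suc n)" for n j \<xi>
  proof -
    let ?e = "2 * v * rate / \<kappa> / real (Suc n)" and ?f = "(step ^^ n) (indicator {\<xi>}) :: 'a \<Rightarrow> real"
    have f: "\<bar>?f x - k n \<xi>\<bar> \<le> ?e" if "x \<in> S" for x
      unfolding k_def using that by (intro steps_coalescence) auto
    have eq: "k (n + j) \<xi> = (step ^^ j) ?f b"
      unfolding k_def by (subst add.commute) (simp add: funpow_add)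
    have "(step ^^ j) ?f b \<le> (step ^^ j) (\<lambda>_. k n \<xi> + ?e) b"
      using b_in_S f by (intro steps_mono) (auto simp: abs_le_iff algebra_simps)
    moreover have "(step ^^ j) ?f b \<ge> (step ^^ j) (\<lambda>_. k n \<xi> - ?e) b"
      using b_in_S f by (intro steps_mono) (auto simp: abs_le_iff algebra_simps)
    ultimately show ?thesis unfolding eq by (simp add: steps_const abs_le_iff)
  qed
  have "Cauchy (\<lambda>n. k n \<xi>)" for \<xi>
  proof (rule metric_CauchyI)
    fix e :: real assume "e > 0"
    have "(\<lambda>n. 4 * v * rate / \<kappa> * inverse (real (Suc n))) \<longlonglongrightarrow> 0"
      by (intro tendsto_mult_right_zero LIMSEQ_inverse_real_of_nat)
    then have "\<forall>\<^sub>F n in sequentially. 4 * v * rate / \<kappa> * inverse (real (Suc n)) < e"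
      using \<open>e > 0\<close> by (rule order_tendstoD)
    then obtain M where M: "4 * v * rate / \<kappa> / real (Suc M) < e"
      by (auto simp: eventually_sequentially divide_inverse)
    have "dist (k n \<xi>) (k n' \<xi>) < e" if "n \<ge> M" "n' \<ge> M" for n n'
    proof -
      have "\<bar>k n \<xi> - k M \<xi>\<bar> \<le> 2 * v * rate / \<kappa> / real (Suc M)"
        "\<bar>k n' \<xi> - k M \<xi>\<bar> \<le> 2 * v * rate / \<kappa> / real (Suc M)"
        using close[of M "n - M" \<xi>] close[of M "n' - M" \<xi>] that by auto
      then have "\<bar>k n \<xi> - k n' \<xi>\<bar> \<le> 2 * (2 * v * rate / \<kappa> / real (Suc M))" by linarith
      also have "\<dots> = 4 * v * rate / \<kappa> / real (Suc M)" by (simp del: of_nat_Suc)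
      finally show ?thesis using M by (simp only: dist_real_def)
    qed
    then show "\<exists>M. \<forall>n\<ge>M. \<forall>n'\<ge>M. dist (k n \<xi>) (k n' \<xi>) < e" by blast
  qed
  then have "\<exists>l. (\<lambda>n. k n \<xi>) \<longlonglongrightarrow> l" for \<xi>
    using real_Cauchy_convergent convergent_def by blast
  then obtain \<mu> where \<mu>: "\<And>\<xi>. (\<lambda>n. k n \<xi>) \<longlonglongrightarrow> \<mu> \<xi>" by metis
  have \<mu>_nonneg: "\<mu> \<xi> \<ge> 0" for \<xi>
    using \<mu>[of \<xi>] k_nonneg by (intro LIMSEQ_le_const) auto
  have lim: "(\<lambda>n. (step ^^ n) f b) \<longlonglongrightarrow> (\<Sum>\<xi>\<in>S. f \<xi> * \<mu> \<xi>)" for f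
    unfolding expand by (intro tendsto_sum tendsto_mult tendsto_const \<mu>)
  have inv1: "(\<Sum>\<xi>\<in>S. step f \<xi> * \<mu> \<xi>) = (\<Sum>\<xi>\<in>S. f \<xi> * \<mu> \<xi>)" for f
  proof (rule LIMSEQ_unique)
    show "(\<lambda>n. (step ^^ n) (step f) b) \<longlonglongrightarrow> (\<Sum>\<xi>\<in>S. step f \<xi> * \<mu> \<xi>)" by (rule lim)
    show "(\<lambda>n. (step ^^ n) (step f) b) \<longlonglongrightarrow> (\<Sum>\<xi>\<in>S. f \<xi> * \<mu> \<xi>)"
      using LIMSEQ_Suc[OF lim[of f]] by (simp add: funpow_Suc_right del: funpow.simps)
  qed
  have inv: "(\<Sum>\<xi>\<in>S. (step ^^ n) f \<xi> * \<mu> \<xi>) = (\<Sum>\<xi>\<in>S. f \<xi> * \<mu> \<xi>)" for n f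
    by (induction n) (simp_all add: inv1)
  have sum_\<mu>: "(\<Sum>\<xi>\<in>S. \<mu> \<xi>) = 1"
    using LIMSEQ_unique[OF lim[of "\<lambda>_. 1"]] by (simp add: steps_const)
  define g where "g \<xi> = (if \<xi> \<in> S then \<mu> \<xi> else 0)" for \<xi>
  have "(\<integral>\<^sup>+ x. ennreal (g x) \<partial>count_space UNIV) = 1"
  proof -
    have "(\<integral>\<^sup>+ x. ennreal (g x) \<partial>count_space UNIV) = (\<Sum>x\<in>S. ennreal (g x))"
      using finite_S by (intro nn_integral_count_space'[where A = S]) (auto simp: g_def)
    also have "\<dots> = ennreal (\<Sum>x\<in>S. g x)"
      using \<mu>_nonneg by (intro sum_ennreal) (auto simp: g_def)
    also have "(\<Sum>x\<in>S. g x) = 1" using sum_\<mu> by (simp add: g_def)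
    finally show ?thesis by simp
  qed
  then have pmf: "pmf (embed_pmf g) \<xi> = g \<xi>" for \<xi>
    using \<mu>_nonneg by (intro pmf_embed_pmf) (auto simp: g_def)
  have "stationary (embed_pmf g)"
    unfolding stationary_def
  proof (intro conjI allI impI ballI)
    show "set_pmf (embed_pmf g) \<subseteq> S"
      by (auto simp: set_pmf_iff pmf g_def split: if_splits)
    fix t :: real and \<xi> assume t: "t \<ge> 0" and \<xi>: "\<xi> \<in> S"
    have "(\<lambda>n. \<Sum>\<eta>\<in>S. \<mu> \<eta> * (poisson t n * (step ^^ n) (indicator {\<xi>}) \<eta>)) sums (\<Sum>\<eta>\<in>S. \<mu> \<eta> * kernel t \<eta> \<xi>)"
      unfolding kernel_def using t by (intro sums_sum sums_mult semigroup_sums_poisson[where B = 1]) auto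
    moreover have "(\<Sum>\<eta>\<in>S. \<mu> \<eta> * (poisson t n * (step ^^ n) (indicator {\<xi>}) \<eta>)) = poisson t n * \<mu> \<xi>" for n
    proof -
      have "(\<Sum>\<eta>\<in>S. \<mu> \<eta> * (poisson t n * (step ^^ n) (indicator {\<xi>}) \<eta>))
          = poisson t n * (\<Sum>\<eta>\<in>S. (step ^^ n) (indicator {\<xi>}) \<eta> * \<mu> \<eta>)"
        by (simp only: sum_distrib_left mult_ac)
      also have "\<dots> = poisson t n * (\<Sum>\<eta>\<in>S. indicator {\<xi>} \<eta> * \<mu> \<eta>)"
        by (simp only: inv)
      also have "(\<Sum>\<eta>\<in>S. indicator {\<xi>} \<eta> * \<mu> \<eta>) = \<mu> \<xi>"
        using finite_S \<xi> by (simp add: indicator_def if_distrib[of "\<lambda>x. x * _"] cong: if_cong)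
      finally show ?thesis .
    qed
    ultimately have "(\<lambda>n. poisson t n * \<mu> \<xi>) sums (\<Sum>\<eta>\<in>S. \<mu> \<eta> * kernel t \<eta> \<xi>)" by simp
    moreover have "(\<lambda>n. poisson t n * \<mu> \<xi>) sums (1 * \<mu> \<xi>)"
      by (intro sums_mult2 poisson_sums)
    ultimately have "(\<Sum>\<eta>\<in>S. \<mu> \<eta> * kernel t \<eta> \<xi>) = \<mu> \<xi>"
      using sums_unique2 by fastforce
    then show "(\<Sum>\<eta>\<in>S. pmf (embed_pmf g) \<eta> * kernel t \<eta> \<xi>) = pmf (embed_pmf g) \<xi>"
      using \<xi> by (simp add: pmf g_def)
  qed
  then show ?thesis by blast
qed

end

section \<open>The exclusion process as a chain of monotone random maps\<close>

text \<open>With \<open>min\<close> and \<open>max\<close> a jump map is the identity unless the jump is possible, and is visibly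
monotone.\<close>

definition jump_right :: "nat \<Rightarrow> config \<Rightarrow> config" where
  "jump_right x \<eta> = \<eta>(x := min (\<eta> x) (\<eta> (x + 1)), x + 1 := max (\<eta> x) (\<eta> (x + 1)))"

definition jump_left :: "nat \<Rightarrow> config \<Rightarrow> config" where
  "jump_left x \<eta> = \<eta>(x := max (\<eta> x) (\<eta> (x + 1)), x + 1 := min (\<eta> x) (\<eta> (x + 1)))"

definition exit_left :: "config \<Rightarrow> config" where
  "exit_left \<eta> = \<eta>(1 := 0)"

definition enter_right :: "nat \<Rightarrow> config \<Rightarrow> config" where
  "enter_right N \<eta> = \<eta>(N := 1)"

datatype exclusion_move = Jump_right nat | Jump_left nat | Exit_left | Enter_right

definition moves :: "nat \<Rightarrow> exclusion_move set" where
  "moves N = Jump_right ` {1..<N} \<union> Jump_left ` {1..<N} \<union> {Exit_left, Enter_right}"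

fun move_rate :: "real \<Rightarrow> real \<Rightarrow> real \<Rightarrow> exclusion_move \<Rightarrow> real" where
  "move_rate p \<gamma> \<delta> (Jump_right x) = p"
| "move_rate p \<gamma> \<delta> (Jump_left x) = 1 - p"
| "move_rate p \<gamma> \<delta> Exit_left = \<gamma>"
| "move_rate p \<gamma> \<delta> Enter_right = \<delta>"

fun apply_move :: "nat \<Rightarrow> exclusion_move \<Rightarrow> config \<Rightarrow> config" where
  "apply_move N (Jump_right x) = jump_right x"
| "apply_move N (Jump_left x) = jump_left x"
| "apply_move N Exit_left = exit_left"
| "apply_move N Enter_right = enter_right N"

definition bond_drift :: "real \<Rightarrow> nat \<Rightarrow> (config \<Rightarrow> real) \<Rightarrow> config \<Rightarrow> real" where
  "bond_drift p x f \<eta> = p * (f (jump_right x \<eta>) - f \<eta>) + (1 - p) * (f (jump_left x \<eta>) - f \<eta>)"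

definition bulk_drift :: "nat \<Rightarrow> real \<Rightarrow> (config \<Rightarrow> real) \<Rightarrow> config \<Rightarrow> real" where
  "bulk_drift N p f \<eta> = (\<Sum>x = 1..<N. bond_drift p x f \<eta>)"

definition drift :: "nat \<Rightarrow> real \<Rightarrow> real \<Rightarrow> real \<Rightarrow> (config \<Rightarrow> real) \<Rightarrow> config \<Rightarrow> real" where
  "drift N p \<gamma> \<delta> f \<eta> =
    bulk_drift N p f \<eta> + \<gamma> * (f (exit_left \<eta>) - f \<eta>) + \<delta> * (f (enter_right N \<eta>) - f \<eta>)"

lemma finite_configs: "finite (configs N)"
  by (simp add: configs_def finite_PiE)

lemma config_values: "\<eta> \<in> configs N \<Longrightarrow> x \<in> {1..N} \<Longrightarrow> \<eta> x = 0 \<or> \<eta> x = 1"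
  by (auto simp: configs_def PiE_iff)

lemma config_outside: "\<eta> \<in> configs N \<Longrightarrow> x \<notin> {1..N} \<Longrightarrow> \<eta> x = undefined"
  by (auto simp: configs_def PiE_iff extensional_def)

lemma configs_eqI:
  assumes "\<eta> \<in> configs N" "\<zeta> \<in> configs N" "\<And>x. x \<in> {1..N} \<Longrightarrow> \<eta> x = \<zeta> x"
  shows "\<eta> = \<zeta>"
  using assms unfolding configs_def by (rule PiE_ext)

lemma configsI:
  assumes "\<And>x. x \<in> {1..N} \<Longrightarrow> \<eta> x = 0 \<or> \<eta> x = 1" "\<And>x. x \<notin> {1..N} \<Longrightarrow> \<eta> x = undefined"
  shows "\<eta> \<in> configs N"
  using assms by (auto simp: configs_def PiE_iff extensional_def)

lemma bond_values:
  assumes "\<eta> \<in> configs N" "x \<in> {1..<N}"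
  shows "\<eta> x = 0 \<or> \<eta> x = 1" "\<eta> (Suc x) = 0 \<or> \<eta> (Suc x) = 1"
  using config_values[OF assms(1), of x] config_values[OF assms(1), of "Suc x"] assms(2) by auto

lemma jump_right_configs: "\<eta> \<in> configs N \<Longrightarrow> x \<in> {1..<N} \<Longrightarrow> jump_right x \<eta> \<in> configs N"
proof (rule configsI)
  assume \<eta>: "\<eta> \<in> configs N" and x: "x \<in> {1..<N}"
  show "jump_right x \<eta> y = 0 \<or> jump_right x \<eta> y = 1" if "y \<in> {1..N}" for y
    using config_values[OF \<eta> that] bond_values[OF \<eta> x] by (auto simp: jump_right_def)
  show "jump_right x \<eta> y = undefined" if "y \<notin> {1..N}" for y
    using config_outside[OF \<eta> that] x that by (auto simp: jump_right_def)
qed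

lemma jump_left_configs: "\<eta> \<in> configs N \<Longrightarrow> x \<in> {1..<N} \<Longrightarrow> jump_left x \<eta> \<in> configs N"
proof (rule configsI)
  assume \<eta>: "\<eta> \<in> configs N" and x: "x \<in> {1..<N}"
  show "jump_left x \<eta> y = 0 \<or> jump_left x \<eta> y = 1" if "y \<in> {1..N}" for y
    using config_values[OF \<eta> that] bond_values[OF \<eta> x] by (auto simp: jump_left_def)
  show "jump_left x \<eta> y = undefined" if "y \<notin> {1..N}" for y
    using config_outside[OF \<eta> that] x that by (auto simp: jump_left_def)
qed

lemma exit_left_configs: "\<eta> \<in> configs N \<Longrightarrow> 1 \<le> N \<Longrightarrow> exit_left \<eta> \<in> configs N"
  using config_values[of \<eta> N] config_outside[of \<eta> N]
  by (intro configsI) (auto simp: exit_left_def)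

lemma enter_right_configs: "\<eta> \<in> configs N \<Longrightarrow> 1 \<le> N \<Longrightarrow> enter_right N \<eta> \<in> configs N"
  using config_values[of \<eta> N] config_outside[of \<eta> N]
  by (intro configsI) (auto simp: enter_right_def)

lemma apply_move_configs:
  "i \<in> moves N \<Longrightarrow> \<eta> \<in> configs N \<Longrightarrow> 1 \<le> N \<Longrightarrow> apply_move N i \<eta> \<in> configs N"
  by (auto simp: moves_def jump_right_configs jump_left_configs exit_left_configs enter_right_configs)

lemma sum_moves:
  "(\<Sum>i\<in>moves N. g i) = (\<Sum>x = 1..<N. g (Jump_right x) + g (Jump_left x)) + g Exit_left + g Enter_right"
proof -
  have "(\<Sum>i\<in>moves N. g i)
      = (\<Sum>i\<in>Jump_right ` {1..<N} \<union> Jump_left ` {1..<N}. g i) + (\<Sum>i\<in>{Exit_left, Enter_right}. g i)"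
    unfolding moves_def by (intro sum.union_disjoint) auto
  also have "(\<Sum>i\<in>Jump_right ` {1..<N} \<union> Jump_left ` {1..<N}. g i)
      = (\<Sum>i\<in>Jump_right ` {1..<N}. g i) + (\<Sum>i\<in>Jump_left ` {1..<N}. g i)"
    by (intro sum.union_disjoint) auto
  finally show ?thesis by (simp add: sum.reindex inj_on_def sum.distrib add.assoc)
qed

lemma sum_moves_drift:
  "(\<Sum>i\<in>moves N. move_rate p \<gamma> \<delta> i * (f (apply_move N i \<eta>) - f \<eta>)) = drift N p \<gamma> \<delta> f \<eta>"
  by (simp add: sum_moves drift_def bulk_drift_def bond_drift_def)

text \<open>An ineffective map (blocked jump, exit from an empty site, entry into an occupied one) is the
  identity, which contributes nothing; an effective one is the exchange or flip of the generator.\<close>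

lemma generator_eq_drift:
  assumes "\<eta> \<in> configs N" "1 \<le> N"
  shows "generator N p 0 0 \<gamma> \<delta> f \<eta> = drift N p \<gamma> \<delta> f \<eta>"
proof -
  have right: "p * real (\<eta> x) * (1 - real (\<eta> (x + 1))) * (f (exchange \<eta> x (x + 1)) - f \<eta>)
      = p * (f (jump_right x \<eta>) - f \<eta>)" if "x \<in> {1..<N}" for x
  proof -
    have "\<eta> x = 0 \<or> \<eta> x = 1" "\<eta> (x + 1) = 0 \<or> \<eta> (x + 1) = 1"
      using bond_values[OF assms(1) that] by auto
    moreover have "\<eta>(x := a, x + 1 := b) = \<eta>" if "\<eta> x = a" "\<eta> (x + 1) = b" for a b
      using that by auto
    ultimately show ?thesis
      by (auto simp: exchange_def jump_right_def simp del: fun_upd_apply)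
  qed
  have left: "(1 - p) * real (\<eta> (x + 1)) * (1 - real (\<eta> x)) * (f (exchange \<eta> (x + 1) x) - f \<eta>)
      = (1 - p) * (f (jump_left x \<eta>) - f \<eta>)" if "x \<in> {1..<N}" for x
  proof -
    have "\<eta> x = 0 \<or> \<eta> x = 1" "\<eta> (x + 1) = 0 \<or> \<eta> (x + 1) = 1"
      using bond_values[OF assms(1) that] by auto
    moreover have "\<eta>(x := a, x + 1 := b) = \<eta>" if "\<eta> x = a" "\<eta> (x + 1) = b" for a b
      using that by auto
    moreover have "\<eta>(x + 1 := a, x := b) = \<eta>(x := b, x + 1 := a)" for a b
      by (rule fun_upd_twist) simp
    ultimately show ?thesis
      by (auto simp: exchange_def jump_left_def simp del: fun_upd_apply)
  qed
  have "(\<Sum>x = 2..N. (1 - p) * real (\<eta> x) * (1 - real (\<eta> (x - 1))) * (f (exchange \<eta> x (x - 1)) - f \<eta>))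
      = (\<Sum>x = 1..<N. (1 - p) * real (\<eta> (x + 1)) * (1 - real (\<eta> x)) * (f (exchange \<eta> (x + 1) x) - f \<eta>))"
    by (rule sum.reindex_bij_witness[of _ "\<lambda>x. x + 1" "\<lambda>x. x - 1"]) auto
  also have "\<dots> = (\<Sum>x = 1..<N. (1 - p) * (f (jump_left x \<eta>) - f \<eta>))"
    by (intro sum.cong refl left)
  finally have lefts: "(\<Sum>x = 2..N. (1 - p) * real (\<eta> x) * (1 - real (\<eta> (x - 1))) * (f (exchange \<eta> x (x - 1)) - f \<eta>))
      = (\<Sum>x = 1..<N. (1 - p) * (f (jump_left x \<eta>) - f \<eta>))" .
  have rights: "(\<Sum>x = 1..<N. p * real (\<eta> x) * (1 - real (\<eta> (x + 1))) * (f (exchange \<eta> x (x + 1)) - f \<eta>))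
      = (\<Sum>x = 1..<N. p * (f (jump_right x \<eta>) - f \<eta>))"
    by (intro sum.cong refl right)
  have "\<eta> 1 = 0 \<or> \<eta> 1 = 1" "\<eta> N = 0 \<or> \<eta> N = 1"
    using config_values[OF assms(1), of 1] config_values[OF assms(1), of N] assms(2) by auto
  then have ends: "(0 * (1 - real (\<eta> 1)) + \<gamma> * real (\<eta> 1)) * (f (flip \<eta> 1) - f \<eta>) = \<gamma> * (f (exit_left \<eta>) - f \<eta>)"
    "(\<delta> * (1 - real (\<eta> N)) + 0 * real (\<eta> N)) * (f (flip \<eta> N) - f \<eta>) = \<delta> * (f (enter_right N \<eta>) - f \<eta>)"
    by (auto simp: flip_def exit_left_def enter_right_def fun_upd_idem)
  show ?thesis
    unfolding generator_def lefts rights ends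
    by (simp add: drift_def bulk_drift_def bond_drift_def sum.distrib)
qed

subsection \<open>Order\<close>

definition below :: "nat \<Rightarrow> (config \<times> config) set" where
  "below N = {(\<eta>, \<zeta>). \<eta> \<in> configs N \<and> \<zeta> \<in> configs N \<and> (\<forall>x\<in>{1..N}. \<eta> x \<le> \<zeta> x)}"

definition full :: "nat \<Rightarrow> config" where
  "full N = (\<lambda>x. if x \<in> {1..N} then 1 else undefined)"

lemma full_configs: "full N \<in> configs N"
  by (intro configsI) (auto simp: full_def)

lemma below_full: "\<eta> \<in> configs N \<Longrightarrow> (\<eta>, full N) \<in> below N"
  using config_values[of \<eta> N] full_configs[of N] by (fastforce simp: below_def full_def)

lemma apply_move_below:
  assumes "i \<in> moves N" "(\<eta>, \<zeta>) \<in> below N" "1 \<le> N"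
  shows "(apply_move N i \<eta>, apply_move N i \<zeta>) \<in> below N"
proof -
  have le: "\<And>x. x \<in> {1..N} \<Longrightarrow> \<eta> x \<le> \<zeta> x" using assms by (auto simp: below_def)
  have "apply_move N i \<eta> x \<le> apply_move N i \<zeta> x" if x: "x \<in> {1..N}" for x
  proof (cases i)
    case (Jump_right y)
    then have "y \<in> {1..<N}" using assms by (auto simp: moves_def)
    then have "\<eta> y \<le> \<zeta> y" "\<eta> (y + 1) \<le> \<zeta> (y + 1)" by (auto intro!: le)
    then show ?thesis using le[OF x] Jump_right by (auto simp: jump_right_def intro: min.mono max.mono)
  next
    case (Jump_left y)
    then have "y \<in> {1..<N}" using assms by (auto simp: moves_def)
    then have "\<eta> y \<le> \<zeta> y" "\<eta> (y + 1) \<le> \<zeta> (y + 1)" by (auto intro!: le)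
    then show ?thesis using le[OF x] Jump_left by (auto simp: jump_left_def intro: min.mono max.mono)
  qed (use le[OF x] in \<open>auto simp: exit_left_def enter_right_def\<close>)
  then show ?thesis using assms apply_move_configs[OF assms(1)] by (auto simp: below_def)
qed

subsection \<open>Particle-hole symmetry\<close>

definition mirror :: "nat \<Rightarrow> config \<Rightarrow> config" where
  "mirror N \<eta> = (\<lambda>y. if y \<in> {1..N} then 1 - \<eta> (N + 1 - y) else undefined)"

lemma mirror_configs: "mirror N \<eta> \<in> configs N" if "\<eta> \<in> configs N"
proof (rule configsI)
  fix x assume "x \<in> {1..N}"
  then have "N + 1 - x \<in> {1..N}" by auto
  from config_values[OF that this] \<open>x \<in> {1..N}\<close> show "mirror N \<eta> x = 0 \<or> mirror N \<eta> x = 1"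
    unfolding mirror_def by auto
qed (auto simp: mirror_def)

lemma mirror_mirror:
  assumes "\<eta> \<in> configs N"
  shows "mirror N (mirror N \<eta>) = \<eta>"
proof (rule configs_eqI[of _ N])
  fix x assume x: "x \<in> {1..N}"
  then have "N + 1 - x \<in> {1..N}" "N + 1 - (N + 1 - x) = x" by auto
  then show "mirror N (mirror N \<eta>) x = \<eta> x"
    using config_values[OF assms x] x by (auto simp: mirror_def)
qed (use assms mirror_configs in auto)

lemma mirror_jump:
  assumes "\<eta> \<in> configs N" "x \<in> {1..<N}"
  shows "mirror N (jump_right x \<eta>) = jump_right (N - x) (mirror N \<eta>)"
    and "mirror N (jump_left x \<eta>) = jump_left (N - x) (mirror N \<eta>)"
proof -
  have v: "\<eta> x = 0 \<or> \<eta> x = 1" "\<eta> (Suc x) = 0 \<or> \<eta> (Suc x) = 1"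
    using config_values[OF assms(1), of x] config_values[OF assms(1), of "Suc x"] assms(2) by auto
  have bond: "N - x \<in> {1..<N}" using assms(2) by auto
  have sites: "N + 1 - y = x \<longleftrightarrow> y = N - x + 1" "N + 1 - y = x + 1 \<longleftrightarrow> y = N - x" if "y \<in> {1..N}" for y
    using that assms(2) by auto
  have m: "mirror N \<eta> (N - x) = 1 - \<eta> (Suc x)" "mirror N \<eta> (N - x + 1) = 1 - \<eta> x"
    using assms(2) by (auto simp: mirror_def Suc_diff_le)
  show "mirror N (jump_right x \<eta>) = jump_right (N - x) (mirror N \<eta>)"
  proof (rule configs_eqI[of _ N])
    fix y assume y: "y \<in> {1..N}"
    have "mirror N (jump_right x \<eta>) y = 1 - jump_right x \<eta> (N + 1 - y)"
      using y by (simp add: mirror_def)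
    then show "mirror N (jump_right x \<eta>) y = jump_right (N - x) (mirror N \<eta>) y"
      unfolding jump_right_def[of "N - x"] m
      using v sites[OF y] y by (auto simp: jump_right_def mirror_def)
  qed (use assms bond in \<open>auto intro!: mirror_configs jump_right_configs\<close>)
  show "mirror N (jump_left x \<eta>) = jump_left (N - x) (mirror N \<eta>)"
  proof (rule configs_eqI[of _ N])
    fix y assume y: "y \<in> {1..N}"
    have "mirror N (jump_left x \<eta>) y = 1 - jump_left x \<eta> (N + 1 - y)"
      using y by (simp add: mirror_def)
    then show "mirror N (jump_left x \<eta>) y = jump_left (N - x) (mirror N \<eta>) y"
      unfolding jump_left_def[of "N - x"] m
      using v sites[OF y] y by (auto simp: jump_left_def mirror_def)
  qed (use assms bond in \<open>auto intro!: mirror_configs jump_left_configs\<close>)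
qed

lemma mirror_ends:
  assumes "1 \<le> N"
  shows "mirror N (exit_left \<eta>) = enter_right N (mirror N \<eta>)"
    and "mirror N (enter_right N \<eta>) = exit_left (mirror N \<eta>)"
proof -
  have "N + 1 - y = 1 \<longleftrightarrow> y = N" "N + 1 - y = N \<longleftrightarrow> y = 1" if "y \<in> {1..N}" for y
    using that by auto
  then show "mirror N (exit_left \<eta>) = enter_right N (mirror N \<eta>)"
    "mirror N (enter_right N \<eta>) = exit_left (mirror N \<eta>)"
    using assms by (auto simp: mirror_def exit_left_def enter_right_def fun_eq_iff)
qed

text \<open>Exchanging particles with holes and left with right preserves the direction of the drift and
exchanges the two reservoirs.\<close>

lemma drift_mirror:
  assumes "\<eta> \<in> configs N" "1 \<le> N"
  shows "drift N p \<gamma> \<delta> (\<lambda>\<eta>. f (mirror N \<eta>)) \<eta> = drift N p \<delta> \<gamma> f (mirror N \<eta>)"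
proof -
  have "bulk_drift N p (\<lambda>\<eta>. f (mirror N \<eta>)) \<eta> = (\<Sum>x = 1..<N. bond_drift p (N - x) f (mirror N \<eta>))"
    unfolding bulk_drift_def
    by (intro sum.cong refl) (simp only: bond_drift_def mirror_jump[OF assms(1)])
  also have "\<dots> = bulk_drift N p f (mirror N \<eta>)"
    unfolding bulk_drift_def by (rule sum.reindex_bij_witness[of _ "\<lambda>x. N - x" "\<lambda>x. N - x"]) auto
  finally show ?thesis using assms by (simp add: drift_def mirror_ends)
qed

lemma mirror_below: "(\<eta>, \<zeta>) \<in> below N \<Longrightarrow> (mirror N \<zeta>, mirror N \<eta>) \<in> below N"
proof -
  assume *: "(\<eta>, \<zeta>) \<in> below N"
  have "mirror N \<zeta> x \<le> mirror N \<eta> x" if x: "x \<in> {1..N}" for x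
  proof -
    have "N + 1 - x \<in> {1..N}" using x by auto
    then have "\<eta> (N + 1 - x) \<le> \<zeta> (N + 1 - x)" using * by (simp add: below_def)
    then show ?thesis using x by (simp add: mirror_def diff_le_mono2)
  qed
  then show ?thesis using * by (simp add: below_def mirror_configs)
qed

subsection \<open>Mixing times\<close>

text \<open>The analytic task that is left for the exclusion process: a pair function \<open>F \<eta> + G \<zeta>\<close> that
decreases off the diagonal, and two test functions that hardly decrease. Since the pair function is a
sum, only drifts of functions of a single copy occur.\<close>

lemma mixing_time_bounds:
  fixes F G u1 u2 :: "config \<Rightarrow> real"
  assumes N: "2 \<le> N" and p: "0 \<le> p" "p \<le> 1" and rates: "\<gamma> \<ge> 0" "\<delta> \<ge> 0"
    and D: "D \<subseteq> configs N \<times> configs N"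
      "\<And>i \<eta> \<zeta>. i \<in> moves N \<Longrightarrow> move_rate p \<gamma> \<delta> i \<noteq> 0 \<Longrightarrow> (\<eta>, \<zeta>) \<in> D \<Longrightarrow>
        (apply_move N i \<eta>, apply_move N i \<zeta>) \<in> D"
    and b: "b \<in> configs N" "\<And>\<eta>. \<eta> \<in> configs N \<Longrightarrow> (\<eta>, b) \<in> D"
    and V: "\<And>\<eta> \<zeta>. (\<eta>, \<zeta>) \<in> D \<Longrightarrow> F \<eta> + G \<zeta> \<ge> 0" "\<And>\<eta>. \<eta> \<in> configs N \<Longrightarrow> F \<eta> + G b \<le> v"
    and \<kappa>: "\<kappa> > 0" "\<And>\<eta> \<zeta>. (\<eta>, \<zeta>) \<in> D \<Longrightarrow> \<eta> \<noteq> \<zeta> \<Longrightarrow> drift N p \<gamma> \<delta> F \<eta> + drift N p \<gamma> \<delta> G \<zeta> \<le> - \<kappa>"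
    and starts: "\<eta>1 \<in> configs N" "\<eta>2 \<in> configs N" "u1 \<eta>1 \<ge> 1 - e" "u2 \<eta>2 \<ge> 1 - e"
    and u: "\<And>\<eta>. \<eta> \<in> configs N \<Longrightarrow> 0 \<le> u1 \<eta> \<and> 0 \<le> u2 \<eta> \<and> u1 \<eta> + u2 \<eta> \<le> 1"
    and \<kappa>': "\<kappa>' > 0" "\<And>\<eta>. \<eta> \<in> configs N \<Longrightarrow> drift N p \<gamma> \<delta> u1 \<eta> \<ge> - \<kappa>'"
      "\<And>\<eta>. \<eta> \<in> configs N \<Longrightarrow> drift N p \<gamma> \<delta> u2 \<eta> \<ge> - \<kappa>'"
    and \<epsilon>: "0 < \<epsilon>"
  shows "(1 / 2 - e - \<epsilon>) / \<kappa>' \<le> mixing_time N p 0 0 \<gamma> \<delta> \<epsilon>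
    \<and> mixing_time N p 0 0 \<gamma> \<delta> \<epsilon> \<le> (2 * v + 1) / (\<kappa> * \<epsilon>)"
proof -
  have N1: "1 \<le> N" using N by simp
  \<comment> \<open>Moves with rate 0 are dropped, because \<open>D\<close> is closed only under moves that occur.\<close>
  define I where "I = {i \<in> moves N. move_rate p \<gamma> \<delta> i \<noteq> 0}"
  have finite_moves: "finite (moves N)" by (simp add: moves_def)
  have sum_I: "(\<Sum>i\<in>I. move_rate p \<gamma> \<delta> i * g i) = (\<Sum>i\<in>moves N. move_rate p \<gamma> \<delta> i * g i)" for g
    unfolding I_def using finite_moves by (intro sum.mono_neutral_left) auto
  have sum_I_drift: "(\<Sum>i\<in>I. move_rate p \<gamma> \<delta> i * (f (apply_move N i \<eta>) - f \<eta>)) = drift N p \<gamma> \<delta> f \<eta>" for f \<eta>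
    unfolding sum_I by (rule sum_moves_drift)
  interpret coalescing I "move_rate p \<gamma> \<delta>" "apply_move N" "configs N" D "\<lambda>z. F (fst z) + G (snd z)" \<kappa> v b
  proof
    show "finite I" using finite_moves by (simp add: I_def)
    show "move_rate p \<gamma> \<delta> i \<ge> 0" for i using p rates by (cases i) auto
    show "sum (move_rate p \<gamma> \<delta>) I > 0"
      using N rates sum_I[of "\<lambda>_. 1"] by (simp add: sum_moves)
    show "(\<Sum>i\<in>I. move_rate p \<gamma> \<delta> i *
        (F (fst (apply_move N i \<eta>, apply_move N i \<zeta>)) + G (snd (apply_move N i \<eta>, apply_move N i \<zeta>))
          - (F (fst (\<eta>, \<zeta>)) + G (snd (\<eta>, \<zeta>))))) \<le> - \<kappa>" if "(\<eta>, \<zeta>) \<in> D" "\<eta> \<noteq> \<zeta>" for \<eta> \<zeta>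
    proof -
      have "(\<Sum>i\<in>I. move_rate p \<gamma> \<delta> i * (F (apply_move N i \<eta>) + G (apply_move N i \<zeta>) - (F \<eta> + G \<zeta>)))
        = (\<Sum>i\<in>I. move_rate p \<gamma> \<delta> i * (F (apply_move N i \<eta>) - F \<eta>)
          + move_rate p \<gamma> \<delta> i * (G (apply_move N i \<zeta>) - G \<zeta>))"
        by (intro sum.cong refl) (simp add: algebra_simps)
      also have "\<dots> = drift N p \<gamma> \<delta> F \<eta> + drift N p \<gamma> \<delta> G \<zeta>"
        by (simp only: sum.distrib sum_I_drift)
      finally show ?thesis using \<kappa>(2)[OF that] by simp
    qed
  qed (use D b V \<kappa>(1) finite_configs N1 apply_move_configs in \<open>auto simp: I_def\<close>)
  have gen_drift: "gen f \<eta> = drift N p \<gamma> \<delta> f \<eta>" for f \<eta>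
    unfolding gen_def by (rule sum_I_drift)
  have "(generator N p 0 0 \<gamma> \<delta> ^^ n) f \<eta> = (gen ^^ n) f \<eta>" if "\<eta> \<in> configs N" for n f \<eta>
    using that
  proof (induction n arbitrary: \<eta>)
    case (Suc n)
    have "(generator N p 0 0 \<gamma> \<delta> ^^ Suc n) f \<eta> = gen ((generator N p 0 0 \<gamma> \<delta> ^^ n) f) \<eta>"
      using Suc.prems N1 by (simp add: generator_eq_drift gen_drift)
    also have "\<dots> = gen ((gen ^^ n) f) \<eta>"
      using Suc N1 by (subst (1 2) gen_def, intro sum.cong refl) (simp add: apply_move_configs I_def)
    finally show ?case by simp
  qed simp
  then have kernel_eq: "trans_prob N p 0 0 \<gamma> \<delta> t \<eta> \<xi> = kernel t \<eta> \<xi>" if "\<eta> \<in> configs N" for t \<eta> \<xi>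
    using that by (simp add: trans_prob_def markov_semigroup_def kernel_def semigroup_def)
  have stationary_eq: "is_stationary N p 0 0 \<gamma> \<delta> = stationary"
    by (simp add: is_stationary_def stationary_def kernel_eq fun_eq_iff)
  define \<pi> where "\<pi> = stationary_dist N p 0 0 \<gamma> \<delta>"
  have \<pi>: "stationary \<pi>"
    unfolding \<pi>_def stationary_dist_def stationary_eq
    using stationary_exists stationary_unique by (metis the_equality)
  define d where "d t = Max (dist_from \<pi> t ` configs N)" for t
  have d_eq: "Max ((\<lambda>\<eta>. tv_dist N (trans_prob N p 0 0 \<gamma> \<delta> t \<eta>) (pmf (stationary_dist N p 0 0 \<gamma> \<delta>))) ` configs N) = d t" for t
    unfolding d_def by (intro arg_cong[of _ _ Max] image_cong refl)
      (simp add: tv_dist_def dist_from_def kernel_eq \<pi>_def)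
  have d_less: "d t < c \<longleftrightarrow> (\<forall>\<eta>\<in>configs N. dist_from \<pi> t \<eta> < c)" for t c
    unfolding d_def using finite_configs full_configs by (subst Max_less_iff) auto
  have mix: "mixing_time N p 0 0 \<gamma> \<delta> \<epsilon> = Inf {t. t \<ge> 0 \<and> d t < \<epsilon>}"
    by (simp add: mixing_time_def d_eq)
  define T where "T = (2 * v + 1) / (\<kappa> * \<epsilon>)"
  have T: "T > 0" unfolding T_def using \<epsilon> \<kappa>(1) v_nonneg by (intro divide_pos_pos mult_pos_pos) auto
  have "d T < \<epsilon>"
    unfolding d_less
  proof
    fix \<eta> assume "\<eta> \<in> configs N"
    then have "dist_from \<pi> T \<eta> \<le> 2 * v / (\<kappa> * T)" by (rule dist_le[OF \<pi> _ T])
    also have "\<kappa> * T = (2 * v + 1) / \<epsilon>" using \<kappa>(1) by (simp add: T_def)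
    also have "2 * v / ((2 * v + 1) / \<epsilon>) < \<epsilon>"
      using \<epsilon> v_nonneg by (simp add: field_simps)
    finally show "dist_from \<pi> T \<eta> < \<epsilon>" .
  qed
  then have mem: "T \<in> {t. t \<ge> 0 \<and> d t < \<epsilon>}" using T by simp
  have "mixing_time N p 0 0 \<gamma> \<delta> \<epsilon> \<le> (2 * v + 1) / (\<kappa> * \<epsilon>)"
    unfolding mix T_def[symmetric] by (rule cInf_lower[OF mem]) (auto intro!: bdd_belowI[of _ 0])
  moreover have "(1 / 2 - e - \<epsilon>) / \<kappa>' \<le> mixing_time N p 0 0 \<gamma> \<delta> \<epsilon>"
    unfolding mix
  proof (rule cInf_greatest)
    show "{t. t \<ge> 0 \<and> d t < \<epsilon>} \<noteq> {}" using mem by blast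
    fix t assume t: "t \<in> {t. t \<ge> 0 \<and> d t < \<epsilon>}"
    have "\<exists>\<eta>\<in>configs N. dist_from \<pi> t \<eta> \<ge> 1 / 2 - e - \<kappa>' * t"
      by (rule dist_lower_bound[where ?u1.0 = u1 and ?u2.0 = u2 and ?x1.0 = \<eta>1 and ?x2.0 = \<eta>2])
        (use starts u \<kappa>' t \<pi> finite_configs in \<open>auto simp: gen_drift stationary_def\<close>)
    moreover have "\<forall>\<eta>\<in>configs N. dist_from \<pi> t \<eta> < \<epsilon>" using t by (simp add: d_less)
    ultimately have "1 / 2 - e - \<kappa>' * t < \<epsilon>" by (meson order_le_less_trans)
    then show "(1 / 2 - e - \<epsilon>) / \<kappa>' \<le> t" using \<kappa>'(1) by (simp add: field_simps)
  qed
  ultimately show ?thesis by blast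
qed

section \<open>The exponential height function\<close>

definition particles :: "config \<Rightarrow> nat \<Rightarrow> nat" where
  "particles \<eta> x = (\<Sum>y = 1..x. \<eta> y)"

lemma particles_0 [simp]: "particles \<eta> 0 = 0"
  by (simp add: particles_def)

lemma particles_Suc: "particles \<eta> (Suc x) = particles \<eta> x + \<eta> (Suc x)"
  by (simp add: particles_def)

lemma particles_jump_right:
  assumes "1 \<le> x"
  shows "particles (jump_right x \<eta>) y = (if y = x then particles \<eta> (x - 1) + min (\<eta> x) (\<eta> (Suc x)) else particles \<eta> y)"
proof (induction y)
  case (Suc y)
  have "particles \<eta> x = particles \<eta> (x - 1) + \<eta> x" using particles_Suc[of \<eta> "x - 1"] assms by simp
  then show ?case using Suc assms by (auto simp: particles_Suc jump_right_def)
qed (use assms in auto)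

lemma particles_jump_left:
  assumes "1 \<le> x"
  shows "particles (jump_left x \<eta>) y = (if y = x then particles \<eta> (x - 1) + max (\<eta> x) (\<eta> (Suc x)) else particles \<eta> y)"
proof (induction y)
  case (Suc y)
  have "particles \<eta> x = particles \<eta> (x - 1) + \<eta> x" using particles_Suc[of \<eta> "x - 1"] assms by simp
  then show ?case using Suc assms by (auto simp: particles_Suc jump_left_def)
qed (use assms in auto)

lemma particles_enter_right: "x < N \<Longrightarrow> particles (enter_right N \<eta>) x = particles \<eta> x"
  unfolding particles_def enter_right_def by (intro sum.cong) auto

lemma particles_enter_right_N: "1 \<le> N \<Longrightarrow> particles (enter_right N \<eta>) N + \<eta> N = particles \<eta> N + 1"
  using particles_Suc[of \<eta> "N - 1"] particles_Suc[of "enter_right N \<eta>" "N - 1"] particles_enter_right[of "N - 1" N \<eta>]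
  by (simp add: enter_right_def)

lemma particles_exit_left: "1 \<le> x \<Longrightarrow> particles (exit_left \<eta>) x + \<eta> 1 = particles \<eta> x"
  by (induction x rule: dec_induct) (auto simp: particles_Suc exit_left_def particles_def)

lemma particles_le: "\<eta> \<in> configs N \<Longrightarrow> x \<le> N \<Longrightarrow> particles \<eta> x \<le> x"
proof (induction x)
  case (Suc x)
  then have "\<eta> (Suc x) = 0 \<or> \<eta> (Suc x) = 1" by (intro config_values) auto
  then show ?case using Suc by (auto simp: particles_Suc)
qed simp

lemma particles_mono: "x \<le> y \<Longrightarrow> particles \<eta> x \<le> particles \<eta> y"
  unfolding particles_def by (intro sum_mono2) auto

lemma particles_mirror:
  assumes "\<eta> \<in> configs N"
  shows "particles (mirror N \<eta>) N = N - particles \<eta> N"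
proof -
  have "particles (mirror N \<eta>) N = (\<Sum>y = 1..N. 1 - \<eta> (N + 1 - y))"
    by (simp add: particles_def mirror_def)
  also have "\<dots> = (\<Sum>y = 1..N. 1 - \<eta> y)"
    by (rule sum.reindex_bij_witness[of _ "\<lambda>y. N + 1 - y" "\<lambda>y. N + 1 - y"]) auto
  also have "\<dots> = (\<Sum>y = 1..N. 1) - (\<Sum>y = 1..N. \<eta> y)"
    using config_values[OF assms] by (intro sum_subtractf_nat) force
  finally show ?thesis by (simp add: particles_def)
qed

lemma particles_below_less:
  assumes "(\<eta>, \<zeta>) \<in> below N" "\<eta> \<noteq> \<zeta>"
  shows "particles \<eta> N < particles \<zeta> N"
proof -
  have "\<exists>x\<in>{1..N}. \<eta> x \<noteq> \<zeta> x"
    using assms configs_eqI[of \<eta> N \<zeta>] by (auto simp: below_def)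
  then have "\<exists>x\<in>{1..N}. \<eta> x < \<zeta> x" using assms by (force simp: below_def)
  then show ?thesis unfolding particles_def
    using assms by (intro sum_strict_mono_ex1) (auto simp: below_def)
qed

lemma bulk_drift_sum:
  "bulk_drift N p (\<lambda>\<eta>. \<Sum>j\<in>J. a j * f j \<eta>) \<eta> = (\<Sum>j\<in>J. a j * bulk_drift N p (f j) \<eta>)"
proof -
  have "bond_drift p x (\<lambda>\<eta>. \<Sum>j\<in>J. a j * f j \<eta>) \<eta> = (\<Sum>j\<in>J. a j * bond_drift p x (f j) \<eta>)" for x
    by (simp add: bond_drift_def sum_distrib_left sum_subtractf sum.distrib algebra_simps)
  then show ?thesis
    by (simp add: bulk_drift_def sum_distrib_left sum.swap[of _ J])
qed

lemma bulk_drift_sum1: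
  "bulk_drift N p (\<lambda>\<eta>. \<Sum>j\<in>J. f j \<eta>) \<eta> = (\<Sum>j\<in>J. bulk_drift N p (f j) \<eta>)"
  using bulk_drift_sum[of N p "\<lambda>_. 1" f J \<eta>] by simp

lemma bulk_drift_cmult: "bulk_drift N p (\<lambda>\<eta>. a * f \<eta>) \<eta> = a * bulk_drift N p f \<eta>"
  by (simp add: bulk_drift_def bond_drift_def sum_distrib_left algebra_simps)

lemma drift_add: "drift N p \<gamma> \<delta> (\<lambda>\<eta>. f \<eta> + g \<eta>) \<eta> = drift N p \<gamma> \<delta> f \<eta> + drift N p \<gamma> \<delta> g \<eta>"
  by (simp add: drift_def bulk_drift_def bond_drift_def sum.distrib sum_subtractf algebra_simps)

lemma drift_diff: "drift N p \<gamma> \<delta> (\<lambda>\<eta>. f \<eta> - g \<eta>) \<eta> = drift N p \<gamma> \<delta> f \<eta> - drift N p \<gamma> \<delta> g \<eta>"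
  by (simp add: drift_def bulk_drift_def bond_drift_def sum.distrib sum_subtractf algebra_simps)

lemma drift_cmult: "drift N p \<gamma> \<delta> (\<lambda>\<eta>. a * f \<eta>) \<eta> = a * drift N p \<gamma> \<delta> f \<eta>"
  by (simp add: drift_def bulk_drift_def bond_drift_def sum_distrib_left algebra_simps)

lemma drift_const: "drift N p \<gamma> \<delta> (\<lambda>\<eta>. a) \<eta> = 0"
  by (simp add: drift_def bulk_drift_def bond_drift_def)

lemma bulk_drift_count:
  "bulk_drift N p (\<lambda>\<eta>. f (particles \<eta> N) \<eta>) \<eta> = bulk_drift N p (f (particles \<eta> N)) \<eta>"
  unfolding bulk_drift_def bond_drift_def
  by (intro sum.cong refl) (auto simp: particles_jump_right particles_jump_left)

text \<open>The generator of a walker that jumps left with rate \<open>p\<close> and right with rate \<open>1 - p\<close>, against the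
drift of the particles. It describes the evolution of \<open>x \<mapsto> Z \<eta> x\<close> in the bulk.\<close>

definition walk :: "real \<Rightarrow> (nat \<Rightarrow> real) \<Rightarrow> nat \<Rightarrow> real" where
  "walk p h x = (1 - p) * h (x + 1) + p * h (x - 1) - h x"

lemma walk_diff_const: "walk p (\<lambda>x. h x - a) x = walk p h x"
  by (simp add: walk_def algebra_simps)

lemma walk_green:
  assumes "1 \<le> s" "s \<le> n"
  shows "(\<Sum>x = s..<n. a x * walk p h x)
    = (\<Sum>x = s..<n. h x * ((1 - p) * a (x - 1) + p * a (x + 1) - a x))
      + (1 - p) * a (n - 1) * h n - p * a n * h (n - 1) - (1 - p) * a (s - 1) * h s + p * a s * h (s - 1)"
  using assms(2)
proof (induction n rule: dec_induct)
  case (step n)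
  then show ?case using assms(1) by (simp add: walk_def algebra_simps)
qed simp

locale asymmetric =
  fixes N :: nat and p :: real
  assumes N_ge: "2 \<le> N" and p_gt: "1 / 2 < p" and p_less: "p < 1"
begin

definition lam :: real where "lam = p / (1 - p)"

definition c :: real where "c = 2 * p - 1"

definition Z :: "config \<Rightarrow> nat \<Rightarrow> real" where "Z \<eta> x = lam ^ particles \<eta> x"

definition w :: "nat \<Rightarrow> real" where "w x = (1 / lam) ^ x"

lemma q_lam: "(1 - p) * lam = p"
  using p_less by (simp add: lam_def)

lemma lam_gt_1: "lam > 1"
  using p_gt p_less by (simp add: lam_def)

lemma c_pos: "c > 0"
  using p_gt by (simp add: c_def)

lemma c_eq: "(1 - p) * (lam - 1) = c"
  using q_lam by (simp add: c_def algebra_simps)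

lemma w_pos: "w x > 0"
  using lam_gt_1 by (simp add: w_def)

lemma w_0 [simp]: "w 0 = 1"
  by (simp add: w_def)

lemma w_Suc: "w (Suc x) * lam = w x"
  using lam_gt_1 by (simp add: w_def)

lemma w_lam_power: "w x * lam ^ x = 1"
  using lam_gt_1 by (simp add: w_def power_divide)

lemma w_antimono: "x \<le> y \<Longrightarrow> w y \<le> w x"
  using lam_gt_1 unfolding w_def by (intro power_decreasing) auto

lemma p_w_Suc: "p * w (Suc x) = (1 - p) * w x"
  using q_lam w_Suc[of x] by (metis mult.assoc mult.commute)

lemma w_harmonic: "1 \<le> x \<Longrightarrow> (1 - p) * w (x - 1) + p * w (x + 1) - w x = 0"
  using p_w_Suc[of "x - 1"] p_w_Suc[of x] by (simp add: algebra_simps)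

lemma w_green:
  assumes "1 \<le> s" "s \<le> n"
  shows "(\<Sum>x = s..<n. w x * walk p h x) = p * w n * (h n - h (n - 1)) - p * w s * (h s - h (s - 1))"
proof -
  have e: "(1 - p) * w (n - 1) = p * w n" "(1 - p) * w (s - 1) = p * w s"
    using p_w_Suc[of "n - 1"] p_w_Suc[of "s - 1"] assms by simp_all
  have 0: "(\<Sum>x = s..<n. h x * ((1 - p) * w (x - 1) + p * w (x + 1) - w x)) = 0"
    using assms by (intro sum.neutral ballI) (simp only: mult_eq_0_iff, simp add: w_harmonic[simplified])
  show ?thesis unfolding walk_green[OF assms] 0 e by (simp add: algebra_simps)
qed

lemma Z_0 [simp]: "Z \<eta> 0 = 1"
  by (simp add: Z_def)

lemma Z_ge_1: "Z \<eta> x \<ge> 1"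
  using lam_gt_1 by (simp add: Z_def)

lemma Z_mono: "x \<le> y \<Longrightarrow> Z \<eta> x \<le> Z \<eta> y"
  using lam_gt_1 particles_mono unfolding Z_def by (intro power_increasing) auto

lemma Z_le: "\<eta> \<in> configs N \<Longrightarrow> x \<le> N \<Longrightarrow> Z \<eta> x \<le> lam ^ x"
  using lam_gt_1 particles_le unfolding Z_def by (intro power_increasing) auto

lemma Z_cases: "Z \<eta> x = 1 \<or> Z \<eta> x \<ge> lam"
proof (cases "particles \<eta> x")
  case (Suc n)
  then show ?thesis using lam_gt_1 by (auto simp: Z_def intro: mult_ge1_I)
qed (simp add: Z_def)

lemma Z_1: "\<eta> \<in> configs N \<Longrightarrow> Z \<eta> 1 = 1 + (lam - 1) * real (\<eta> 1)"
  using config_values[of \<eta> N 1] N_ge by (auto simp: Z_def particles_def)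

lemma Z_Suc: "Z \<eta> (Suc x) = Z \<eta> x * lam ^ \<eta> (Suc x)"
  by (simp add: Z_def particles_Suc power_add)

text \<open>The quadratic relation \<open>(Z (x + 1) - Z x) * (Z (x + 1) - lam * Z x) = 0\<close>: each site holds no
particle or one.\<close>

lemma Z_consecutive:
  assumes "\<eta> \<in> configs N" "x < N"
  shows "(1 - p) * Z \<eta> (Suc x) ^ 2 + p * Z \<eta> x ^ 2 = Z \<eta> x * Z \<eta> (Suc x)"
proof -
  have "\<eta> (Suc x) = 0 \<or> \<eta> (Suc x) = 1" using assms by (intro config_values[of _ N]) auto
  then show ?thesis
  proof
    assume "\<eta> (Suc x) = 1"
    then have Z: "Z \<eta> (Suc x) = Z \<eta> x * lam" by (simp add: Z_Suc)
    have "(1 - p) * (Z \<eta> x * lam) ^ 2 + p * Z \<eta> x ^ 2 = Z \<eta> x ^ 2 * (((1 - p) * lam) * lam + p)"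
      by (simp add: power2_eq_square algebra_simps)
    also have "\<dots> = Z \<eta> x ^ 2 * (((1 - p) * lam) * lam + (1 - p) * lam)"
      by (simp add: q_lam)
    also have "\<dots> = Z \<eta> x ^ 2 * lam * ((1 - p) * lam + (1 - p))"
      by (simp add: algebra_simps)
    finally show ?thesis unfolding Z q_lam by (simp add: power2_eq_square algebra_simps)
  qed (simp add: Z_Suc power2_eq_square algebra_simps)
qed

subsection \<open>Linear and bilinear evolution\<close>

lemma bond_drift_Z:
  assumes "\<eta> \<in> configs N" "x \<in> {1..<N}"
  shows "bond_drift p x (\<lambda>\<eta>. Z \<eta> x) \<eta> = walk p (Z \<eta>) x"
proof -
  obtain y where x: "x = Suc y" using assms(2) by (cases x) auto
  have v: "\<eta> x = 0 \<or> \<eta> x = 1" "\<eta> (Suc x) = 0 \<or> \<eta> (Suc x) = 1"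
    using bond_values[OF assms] by auto
  have 1: "Z (jump_right x \<eta>) x = Z \<eta> y * lam ^ min (\<eta> x) (\<eta> (Suc x))"
    "Z (jump_left x \<eta>) x = Z \<eta> y * lam ^ max (\<eta> x) (\<eta> (Suc x))"
    using x by (simp_all add: Z_def particles_jump_right particles_jump_left power_add)
  have 2: "Z \<eta> x = Z \<eta> y * lam ^ \<eta> x" "Z \<eta> (x + 1) = Z \<eta> y * lam ^ \<eta> x * lam ^ \<eta> (Suc x)"
    by (simp_all add: x Z_Suc)
  have 3: "(1 - p) * lam * lam = p * lam" using q_lam by simp
  have 4: "x - 1 = y" using x by simp
  have "p * (lam ^ min a b - lam ^ a) + (1 - p) * (lam ^ max a b - lam ^ a)
      = (1 - p) * (lam ^ a * lam ^ b) + p - lam ^ a"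
    if "a = 0 \<or> a = 1" "b = 0 \<or> b = 1" for a b :: nat
    using that q_lam 3 by (auto simp: algebra_simps)
  \<comment> \<open>The four possible occupations of the bond have been checked; the factor \<open>Z \<eta> y\<close> is common.\<close>
  from arg_cong[OF this[OF v], of "\<lambda>r. Z \<eta> y * r"]
  show ?thesis unfolding bond_drift_def walk_def 1 2 4 by (simp add: algebra_simps)
qed

text \<open>A jump across the bond at \<open>y\<close> changes the number of particles in \<open>{1..x}\<close> only for \<open>x = y\<close>. This is
why \<open>Z \<eta> x\<close> evolves linearly, and why products at two different sites evolve bilinearly.\<close>

lemma Z_other_bond:
  assumes "1 \<le> y" "y \<noteq> x"
  shows "Z (jump_right y \<eta>) x = Z \<eta> x" "Z (jump_left y \<eta>) x = Z \<eta> x"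
  using assms by (simp_all add: Z_def particles_jump_right particles_jump_left)

lemma bulk_drift_Z:
  assumes "\<eta> \<in> configs N" "x \<in> {1..<N}"
  shows "bulk_drift N p (\<lambda>\<eta>. Z \<eta> x - 1) \<eta> = walk p (\<lambda>x. Z \<eta> x - 1) x"
proof -
  have "bulk_drift N p (\<lambda>\<eta>. Z \<eta> x - 1) \<eta> = (\<Sum>y = 1..<N. if y = x then walk p (Z \<eta>) x else 0)"
    unfolding bulk_drift_def
  proof (intro sum.cong refl)
    fix y assume "y \<in> {1..<N}"
    then show "bond_drift p y (\<lambda>\<eta>. Z \<eta> x - 1) \<eta> = (if y = x then walk p (Z \<eta>) x else 0)"
      using bond_drift_Z[OF assms] by (auto simp: bond_drift_def Z_other_bond)
  qed
  then show ?thesis using assms by (simp add: walk_diff_const)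
qed

text \<open>The two-point function that vanishes on configurations with at most one particle: with a single
particle, \<open>Z \<eta> x \<noteq> 1\<close> implies \<open>Z \<eta> y = lam\<close> for all \<open>y \<ge> x\<close>.\<close>

definition G :: "config \<Rightarrow> nat \<Rightarrow> nat \<Rightarrow> real" where
  "G \<eta> x y = (Z \<eta> x - 1) * (Z \<eta> y - lam)"

lemma bulk_drift_G:
  assumes "\<eta> \<in> configs N" "x \<in> {1..<N}" "y \<in> {1..<N}" "x < y"
  shows "bulk_drift N p (\<lambda>\<eta>. G \<eta> x y) \<eta> = walk p (\<lambda>x. G \<eta> x y) x + walk p (G \<eta> x) y"
proof -
  have "bulk_drift N p (\<lambda>\<eta>. G \<eta> x y) \<eta>
      = (\<Sum>z = 1..<N. (if z = x then (Z \<eta> y - lam) * walk p (Z \<eta>) x else 0)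
          + (if z = y then (Z \<eta> x - 1) * walk p (Z \<eta>) y else 0))"
    unfolding bulk_drift_def
  proof (intro sum.cong refl)
    fix z assume z: "z \<in> {1..<N}"
    have "bond_drift p x (\<lambda>\<eta>. G \<eta> x y) \<eta> = (Z \<eta> y - lam) * bond_drift p x (\<lambda>\<eta>. Z \<eta> x) \<eta>"
      using assms by (simp add: bond_drift_def G_def Z_other_bond algebra_simps)
    moreover have "bond_drift p y (\<lambda>\<eta>. G \<eta> x y) \<eta> = (Z \<eta> x - 1) * bond_drift p y (\<lambda>\<eta>. Z \<eta> y) \<eta>"
      using assms by (simp add: bond_drift_def G_def Z_other_bond algebra_simps)
    moreover have "bond_drift p z (\<lambda>\<eta>. G \<eta> x y) \<eta> = 0" if "z \<noteq> x" "z \<noteq> y"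
      using that z by (simp add: bond_drift_def G_def Z_other_bond)
    ultimately show "bond_drift p z (\<lambda>\<eta>. G \<eta> x y) \<eta>
      = (if z = x then (Z \<eta> y - lam) * walk p (Z \<eta>) x else 0)
          + (if z = y then (Z \<eta> x - 1) * walk p (Z \<eta>) y else 0)"
      using bond_drift_Z[OF assms(1,2)] bond_drift_Z[OF assms(1,3)] assms(4) by auto
  qed
  also have "\<dots> = (Z \<eta> y - lam) * walk p (Z \<eta>) x + (Z \<eta> x - 1) * walk p (Z \<eta>) y"
    using assms by (simp add: sum.distrib)
  also have "(Z \<eta> y - lam) * walk p (Z \<eta>) x = walk p (\<lambda>x. G \<eta> x y) x"
    unfolding G_def by (simp add: walk_def algebra_simps)
  also have "(Z \<eta> x - 1) * walk p (Z \<eta>) y = walk p (G \<eta> x) y"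
    unfolding G_def by (simp add: walk_def algebra_simps)
  finally show ?thesis .
qed

lemma G_nonneg: "x \<le> y \<Longrightarrow> G \<eta> x y \<ge> 0"
  using Z_cases[of \<eta> x] Z_mono[of x y \<eta>] lam_gt_1 by (auto simp: G_def)

subsection \<open>Potentials and their bulk drifts\<close>

text \<open>The weights \<open>w x = lam ^ (- x)\<close> are harmonic for the adjoint of \<open>walk\<close>, so the bulk drift of the
potentials comes from the two ends only. The weight of \<open>A\<close> also vanishes at \<open>N\<close>: then only the total
particle number enters at the right end, and \<open>A\<close> does not react to entries.\<close>

definition A :: "config \<Rightarrow> real" where
  "A \<eta> = (\<Sum>x = 1..<N. (w x - w N) * (Z \<eta> x - 1))"

definition A0 :: "config \<Rightarrow> real" where
  "A0 \<eta> = (\<Sum>x = 1..<N. w x * (Z \<eta> x - 1))"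

definition A1 :: "config \<Rightarrow> real" where
  "A1 \<eta> = (\<Sum>x = 1..<N. (real x * w x) * (Z \<eta> x - 1))"

definition A2 :: "config \<Rightarrow> real" where
  "A2 \<eta> = (\<Sum>y = 1..<N. \<Sum>x = 1..<y. (w x * w y) * G \<eta> x y)"

definition S :: real where "S = (\<Sum>x = 1..<N. w x - w N)"

lemma bulk_drift_A:
  assumes "\<eta> \<in> configs N"
  shows "bulk_drift N p A \<eta> = c * (w N * lam ^ particles \<eta> N - w N) - c * (1 - w N) * real (\<eta> 1)"
proof -
  let ?h = "\<lambda>x. Z \<eta> x - 1" and ?a = "\<lambda>x. w x - w N"
  have "bulk_drift N p A \<eta> = (\<Sum>x = 1..<N. ?a x * walk p ?h x)"
    unfolding A_def[abs_def] bulk_drift_sum using assms by (intro sum.cong refl) (simp add: bulk_drift_Z)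
  also have "\<dots> = (\<Sum>x = 1..<N. ?h x * ((1 - p) * ?a (x - 1) + p * ?a (x + 1) - ?a x))
      + (1 - p) * ?a (N - 1) * ?h N - p * ?a N * ?h (N - 1) - (1 - p) * ?a (1 - 1) * ?h 1 + p * ?a 1 * ?h (1 - 1)"
    using N_ge by (intro walk_green) auto
  also have "(\<Sum>x = 1..<N. ?h x * ((1 - p) * ?a (x - 1) + p * ?a (x + 1) - ?a x)) = 0"
  proof (intro sum.neutral ballI)
    fix x assume "x \<in> {1..<N}"
    then have "1 \<le> x" by simp
    then have "(1 - p) * ?a (x - 1) + p * ?a (x + 1) - ?a x = 0"
      using w_harmonic[of x] by (simp add: algebra_simps)
    then show "?h x * ((1 - p) * ?a (x - 1) + p * ?a (x + 1) - ?a x) = 0" by (simp only: mult_zero_right)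
  qed
  also have "(1 - p) * ?a (N - 1) = c * w N"
  proof -
    have "w (N - 1) = w N * lam" using w_Suc[of "N - 1"] N_ge by simp
    then show ?thesis unfolding c_eq[symmetric] by (simp add: algebra_simps)
  qed
  also have "(1 - p) * ?a (1 - 1) * ?h 1 = c * (1 - w N) * real (\<eta> 1)"
    unfolding c_eq[symmetric] Z_1[OF assms] by simp
  finally show ?thesis by (simp add: Z_def algebra_simps)
qed

text \<open>The weight \<open>x * w x\<close> is not harmonic but has adjoint drift \<open>- c * w x\<close>, so \<open>A1\<close> dissipates \<open>A0\<close>.\<close>

lemma bulk_drift_A1:
  assumes "\<eta> \<in> configs N"
  shows "bulk_drift N p A1 \<eta> \<le> p * real N * (w N * lam ^ particles \<eta> N) - c * A0 \<eta>"
proof -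
  let ?h = "\<lambda>x. Z \<eta> x - 1" and ?a = "\<lambda>x. real x * w x"
  have "bulk_drift N p A1 \<eta> = (\<Sum>x = 1..<N. ?a x * walk p ?h x)"
    unfolding A1_def[abs_def] bulk_drift_sum using assms by (intro sum.cong refl) (simp add: bulk_drift_Z)
  also have "\<dots> = (\<Sum>x = 1..<N. ?h x * ((1 - p) * ?a (x - 1) + p * ?a (x + 1) - ?a x))
      + (1 - p) * ?a (N - 1) * ?h N - p * ?a N * ?h (N - 1) - (1 - p) * ?a (1 - 1) * ?h 1 + p * ?a 1 * ?h (1 - 1)"
    using N_ge by (intro walk_green) auto
  also have "(\<Sum>x = 1..<N. ?h x * ((1 - p) * ?a (x - 1) + p * ?a (x + 1) - ?a x)) = - c * A0 \<eta>"
    unfolding A0_def sum_distrib_left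
  proof (intro sum.cong refl)
    fix x assume "x \<in> {1..<N}"
    then obtain y where x: "x = Suc y" by (cases x) auto
    have e: "w y = w x * lam" "p * w (Suc x) = (1 - p) * w x"
      using w_Suc[of y] p_w_Suc[of x] by (simp_all add: x)
    have "(1 - p) * (real y * w y) + (real x + 1) * (p * w (Suc x)) - real x * w x
        = ((1 - p) * lam) * (real y * w x) + (real x + 1) * ((1 - p) * w x) - real x * w x"
      unfolding e by (simp add: mult_ac)
    also have "\<dots> = - c * w x"
      unfolding q_lam by (simp add: x c_def algebra_simps)
    finally have "(1 - p) * ?a (x - 1) + p * ?a (x + 1) - ?a x = - c * w x"
      by (simp add: x mult_ac)
    then show "?h x * ((1 - p) * ?a (x - 1) + p * ?a (x + 1) - ?a x) = - c * (w x * (Z \<eta> x - 1))"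
      by (simp only: mult_ac)
  qed
  also have "- c * A0 \<eta> + (1 - p) * ?a (N - 1) * ?h N - p * ?a N * ?h (N - 1) - (1 - p) * ?a (1 - 1) * ?h 1 + p * ?a 1 * ?h (1 - 1)
      \<le> - c * A0 \<eta> + p * real N * (w N * lam ^ particles \<eta> N)"
  proof -
    have "(1 - p) * w (N - 1) = p * w N" using p_w_Suc[of "N - 1"] N_ge by simp
    then have "(1 - p) * ?a (N - 1) * ?h N = p * w N * real (N - 1) * ?h N"
      by (metis mult.assoc mult.commute)
    also have "\<dots> \<le> p * w N * real N * Z \<eta> N"
      using w_pos[of N] p_gt Z_ge_1[of \<eta> N] by (intro mult_mono mult_nonneg_nonneg) auto
    finally have 1: "(1 - p) * ?a (N - 1) * ?h N \<le> p * real N * (w N * lam ^ particles \<eta> N)"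
      by (simp add: Z_def mult_ac)
    have 2: "p * ?a N * ?h (N - 1) \<ge> 0"
      using w_pos[of N] p_gt Z_ge_1[of \<eta> "N - 1"] by (intro mult_nonneg_nonneg) auto
    show ?thesis using 1 2 by simp
  qed
  finally show ?thesis by simp
qed

lemma Z_exit:
  assumes "\<eta> 1 = 1" "1 \<le> x"
  shows "Z \<eta> x = lam * Z (exit_left \<eta>) x"
proof -
  have "particles \<eta> x = Suc (particles (exit_left \<eta>) x)" using particles_exit_left[OF assms(2), of \<eta>] assms(1) by simp
  then show ?thesis by (simp add: Z_def)
qed

lemma exit_left_idle: "\<eta> 1 = 0 \<Longrightarrow> exit_left \<eta> = \<eta>"
  unfolding exit_left_def by (rule fun_upd_idem)

lemma enter_right_idle: "\<eta> N = 1 \<Longrightarrow> enter_right N \<eta> = \<eta>"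
  unfolding enter_right_def by (rule fun_upd_idem)

text \<open>Pairs of adjacent arguments are where the two walkers would collide. There the bilinear
  evolution involves the diagonal values \<open>G \<eta> x x\<close>; they satisfy the closure relation below, by
  which their contributions telescope.\<close>

lemma G_closure:
  assumes "\<eta> \<in> configs N" "x < N"
  shows "(1 - p) * G \<eta> (Suc x) (Suc x) + p * G \<eta> x x = G \<eta> x (Suc x)"
proof -
  have "(1 - p) * G \<eta> (Suc x) (Suc x) + p * G \<eta> x x
      = ((1 - p) * Z \<eta> (Suc x) ^ 2 + p * Z \<eta> x ^ 2) - ((1 - p) + (1 - p) * lam) * Z \<eta> (Suc x)
        - (p + p * lam) * Z \<eta> x + lam"
    by (simp add: G_def power2_eq_square algebra_simps)
  also have "p + p * lam = lam" using q_lam by (simp add: algebra_simps)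
  finally show ?thesis
    unfolding Z_consecutive[OF assms] q_lam by (simp add: G_def algebra_simps)
qed

text \<open>Green's formula in each variable separately leaves inflow at \<open>y = N\<close>, outflow at \<open>x = 1\<close> and
diagonal terms. By the closure relation the latter form a telescoping sum with a favourable sign. The
outflow occurs when site 1 is occupied, and then dominates, up to a factor, the potential \<open>A\<close> that is
left after removing the particle there.\<close>

lemma bulk_drift_A2:
  assumes "\<eta> \<in> configs N"
  shows "bulk_drift N p A2 \<eta>
    \<le> p * (w N * lam ^ particles \<eta> N) * A0 \<eta> - p * (lam - 1) * real (\<eta> 1) * A (exit_left \<eta>)"
proof -
  have swap: "(\<Sum>y = 1..<N. \<Sum>x = 1..<y. f x y) = (\<Sum>x = 1..<N. \<Sum>y = Suc x..<N. f x y)"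
    for f :: "nat \<Rightarrow> nat \<Rightarrow> real"
    by (subst (1 2) sum.Sigma; (rule sum.reindex_bij_witness[of _ prod.swap prod.swap])?) auto
  let ?g = "\<lambda>x. G \<eta> x x"
  have first: "(\<Sum>x = 1..<y. w x * walk p (\<lambda>x. G \<eta> x y) x)
      = p * w y * (p * (?g y - ?g (y - 1))) - (1 - p) * G \<eta> 1 y" if y: "y \<in> {1..<N}" for y
  proof -
    obtain z where z: "y = Suc z" using y by (cases y) auto
    have closure: "G \<eta> (y - 1) y = (1 - p) * ?g y + p * ?g (y - 1)"
      using G_closure[OF assms, of z] y z by simp
    have w1: "p * w 1 = 1 - p" using p_w_Suc[of 0] by simp
    have green: "(\<Sum>x = 1..<y. w x * walk p (\<lambda>x. G \<eta> x y) x)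
        = p * w y * (G \<eta> y y - G \<eta> (y - 1) y) - p * w 1 * (G \<eta> 1 y - G \<eta> (1 - 1) y)"
      using y by (intro w_green) auto
    have G0: "G \<eta> (1 - 1) y = 0" by (simp add: G_def)
    show ?thesis unfolding green closure w1 G0 by (simp add: algebra_simps)
  qed
  have second: "(\<Sum>y = Suc x..<N. w y * walk p (G \<eta> x) y)
      = p * w N * (G \<eta> x N - G \<eta> x (N - 1)) - p * w (Suc x) * ((1 - p) * (?g (Suc x) - ?g x))"
    if x: "x \<in> {1..<N}" for x
  proof -
    have closure: "G \<eta> x (Suc x) = (1 - p) * ?g (Suc x) + p * ?g x"
      using G_closure[OF assms, of x] x by simp
    have green: "(\<Sum>y = Suc x..<N. w y * walk p (G \<eta> x) y)
        = p * w N * (G \<eta> x N - G \<eta> x (N - 1)) - p * w (Suc x) * (G \<eta> x (Suc x) - G \<eta> x (Suc x - 1))"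
      using x by (intro w_green) auto
    show ?thesis unfolding green closure by (simp add: algebra_simps)
  qed
  have "bulk_drift N p A2 \<eta> = (\<Sum>y = 1..<N. \<Sum>x = 1..<y. (w x * w y) * bulk_drift N p (\<lambda>\<eta>. G \<eta> x y) \<eta>)"
    unfolding A2_def[abs_def] bulk_drift_sum1 bulk_drift_cmult ..
  also have "\<dots> = (\<Sum>y = 1..<N. \<Sum>x = 1..<y. w y * (w x * walk p (\<lambda>x. G \<eta> x y) x)
      + w x * (w y * walk p (G \<eta> x) y))"
    using assms by (intro sum.cong refl) (simp add: bulk_drift_G algebra_simps)
  also have "\<dots> = (\<Sum>y = 1..<N. w y * (\<Sum>x = 1..<y. w x * walk p (\<lambda>x. G \<eta> x y) x))
      + (\<Sum>x = 1..<N. w x * (\<Sum>y = Suc x..<N. w y * walk p (G \<eta> x) y))"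
    unfolding sum.distrib sum_distrib_left swap[of "\<lambda>x y. w x * (w y * walk p (G \<eta> x) y)"] ..
  also have "\<dots> = (\<Sum>y = 1..<N. w y * (p * w y * (p * (?g y - ?g (y - 1))) - (1 - p) * G \<eta> 1 y))
      + (\<Sum>x = 1..<N. w x * (p * w N * (G \<eta> x N - G \<eta> x (N - 1)) - p * w (Suc x) * ((1 - p) * (?g (Suc x) - ?g x))))"
    using first second by (intro arg_cong2[of _ _ _ _ "(+)"] sum.cong refl) auto
  also have "\<dots> = (\<Sum>x = 1..<N. (p * w x) ^ 2 * (?g x - ?g (x - 1)) - (p * w (Suc x)) ^ 2 * (?g (Suc x) - ?g x))
      + (\<Sum>x = 1..<N. p * w N * w x * G \<eta> x N) - (\<Sum>x = 1..<N. p * w N * w x * G \<eta> x (N - 1))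
      - (\<Sum>x = 1..<N. (1 - p) * w x * G \<eta> 1 x)"
  proof -
    have e: "w x * (p * w (Suc x) * ((1 - p) * r)) = (p * w (Suc x)) ^ 2 * r" for x r
    proof -
      have "w x * (p * w (Suc x) * ((1 - p) * r)) = ((1 - p) * w x) * (p * w (Suc x)) * r"
        by (simp only: mult_ac)
      then show ?thesis unfolding p_w_Suc[symmetric] by (simp only: power2_eq_square)
    qed
    show ?thesis
      unfolding sum.distrib[symmetric] sum_subtractf[symmetric]
      by (intro sum.cong refl) (simp only: right_diff_distrib e, simp add: power2_eq_square algebra_simps)
  qed
  finally have total: "bulk_drift N p A2 \<eta>
      = (\<Sum>x = 1..<N. (p * w x) ^ 2 * (?g x - ?g (x - 1)) - (p * w (Suc x)) ^ 2 * (?g (Suc x) - ?g x))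
      + (\<Sum>x = 1..<N. p * w N * w x * G \<eta> x N) - (\<Sum>x = 1..<N. p * w N * w x * G \<eta> x (N - 1))
      - (\<Sum>x = 1..<N. (1 - p) * w x * G \<eta> 1 x)" .
  have "(\<Sum>x = 1..<N. (p * w x) ^ 2 * (?g x - ?g (x - 1)) - (p * w (Suc x)) ^ 2 * (?g (Suc x) - ?g x))
      = (p * w 1) ^ 2 * (?g 1 - ?g 0) - (p * w N) ^ 2 * (?g N - ?g (N - 1))"
  proof -
    have "(\<Sum>x = 1..<N. (p * w x) ^ 2 * (?g x - ?g (x - 1)) - (p * w (Suc x)) ^ 2 * (?g (Suc x) - ?g x))
        = - (\<Sum>x = 1..<N. (p * w (Suc x)) ^ 2 * (?g (Suc x) - ?g (Suc x - 1)) - (p * w x) ^ 2 * (?g x - ?g (x - 1)))"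
      by (simp flip: sum_negf)
    also have "\<dots> = - ((p * w N) ^ 2 * (?g N - ?g (N - 1)) - (p * w 1) ^ 2 * (?g 1 - ?g (1 - 1)))"
      using N_ge by (subst sum_Suc_diff') auto
    finally show ?thesis by simp
  qed
  also have "\<dots> \<le> 0"
  proof -
    have "?g 1 = 0" "?g 0 = 0"
      using Z_1[OF assms] config_values[OF assms, of 1] N_ge by (auto simp: G_def)
    moreover have "?g (N - 1) \<le> ?g N"
    proof (cases "Z \<eta> (N - 1) = 1")
      case True
      then show ?thesis using G_nonneg[of N N] by (simp add: G_def)
    next
      case False
      then have "Z \<eta> (N - 1) \<ge> lam" using Z_cases by blast
      then show ?thesis using Z_mono[of "N - 1" N \<eta>] lam_gt_1 unfolding G_def
        by (intro mult_mono) auto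
    qed
    ultimately show ?thesis by (simp only: diff_0_right mult_zero_right) simp
  qed
  finally have diagonal: "(\<Sum>x = 1..<N. (p * w x) ^ 2 * (?g x - ?g (x - 1))
      - (p * w (Suc x)) ^ 2 * (?g (Suc x) - ?g x)) \<le> 0" .
  have inflow: "(\<Sum>x = 1..<N. p * w N * w x * G \<eta> x N) \<le> p * (w N * lam ^ particles \<eta> N) * A0 \<eta>"
    unfolding A0_def sum_distrib_left
  proof (rule sum_mono)
    fix x
    have "G \<eta> x N \<le> (Z \<eta> x - 1) * Z \<eta> N"
      using Z_ge_1[of \<eta> x] lam_gt_1 unfolding G_def by (intro mult_left_mono) auto
    then have "(p * w N * w x) * G \<eta> x N \<le> (p * w N * w x) * ((Z \<eta> x - 1) * Z \<eta> N)"
      using p_gt w_pos[of N] w_pos[of x] by (intro mult_left_mono) auto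
    then show "p * w N * w x * G \<eta> x N \<le> p * (w N * lam ^ particles \<eta> N) * (w x * (Z \<eta> x - 1))"
      by (simp add: Z_def mult_ac)
  qed
  have "0 \<le> (\<Sum>x = 1..<N. p * w N * w x * G \<eta> x (N - 1))"
    using p_gt w_pos by (intro sum_nonneg mult_nonneg_nonneg G_nonneg) (auto intro: less_imp_le)
  moreover have "p * (lam - 1) * real (\<eta> 1) * A (exit_left \<eta>) \<le> (\<Sum>x = 1..<N. (1 - p) * w x * G \<eta> 1 x)"
  proof (cases "\<eta> 1 = 1")
    case True
    have "p * (lam - 1) * A (exit_left \<eta>) \<le> (\<Sum>x = 1..<N. (1 - p) * w x * G \<eta> 1 x)"
      unfolding A_def sum_distrib_left
    proof (rule sum_mono)
      fix x assume x: "x \<in> {1..<N}"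
      have "G \<eta> 1 x = (lam - 1) * (lam * (Z (exit_left \<eta>) x - 1))"
        using Z_exit[of \<eta> x, OF True] Z_1[OF assms] True x by (simp add: G_def algebra_simps)
      then have "(1 - p) * w x * G \<eta> 1 x = ((1 - p) * lam) * (lam - 1) * (w x * (Z (exit_left \<eta>) x - 1))"
        by (simp only: mult_ac)
      then have eq: "(1 - p) * w x * G \<eta> 1 x = p * (lam - 1) * (w x * (Z (exit_left \<eta>) x - 1))"
        unfolding q_lam .
      have "(w x - w N) * (Z (exit_left \<eta>) x - 1) \<le> w x * (Z (exit_left \<eta>) x - 1)"
        using Z_ge_1[of "exit_left \<eta>" x] w_pos[of N] by (intro mult_right_mono) auto
      then show "p * (lam - 1) * ((w x - w N) * (Z (exit_left \<eta>) x - 1)) \<le> (1 - p) * w x * G \<eta> 1 x"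
        unfolding eq using p_gt lam_gt_1 by (intro mult_left_mono) auto
    qed
    then show ?thesis using True by simp
  next
    case False
    then have "\<eta> 1 = 0" using config_values[OF assms, of 1] N_ge by auto
    moreover have "0 \<le> (\<Sum>x = 1..<N. (1 - p) * w x * G \<eta> 1 x)"
      using p_less w_pos by (intro sum_nonneg mult_nonneg_nonneg G_nonneg) (auto intro: less_imp_le)
    ultimately show ?thesis by simp
  qed
  ultimately show ?thesis using total diagonal inflow by linarith
qed


lemma Z_exit_le: "Z (exit_left \<eta>) x \<le> Z \<eta> x"
  unfolding Z_def particles_def using lam_gt_1
  by (intro power_increasing sum_mono) (auto simp: exit_left_def)

lemma Z_enter_right: "x < N \<Longrightarrow> Z (enter_right N \<eta>) x = Z \<eta> x"
  by (simp add: Z_def particles_enter_right)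

lemma A_exit:
  assumes "\<eta> \<in> configs N"
  shows "A \<eta> - A (exit_left \<eta>) = real (\<eta> 1) * ((lam - 1) * (S + A (exit_left \<eta>)))"
proof (cases "\<eta> 1 = 1")
  case True
  have "A \<eta> = (\<Sum>x = 1..<N. (w x - w N) * (lam * Z (exit_left \<eta>) x - 1))"
    unfolding A_def by (intro sum.cong refl) (simp add: Z_exit[of \<eta>, OF True])
  also have "\<dots> = lam * A (exit_left \<eta>) + (lam - 1) * S"
    unfolding A_def S_def sum_distrib_left sum.distrib[symmetric]
    by (intro sum.cong refl) (simp add: algebra_simps)
  finally show ?thesis using True by (simp add: algebra_simps)
next
  case False
  then have "\<eta> 1 = 0" using config_values[OF assms, of 1] N_ge by auto
  then show ?thesis by (simp add: exit_left_idle)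
qed

lemma enter_right_potentials:
  "A (enter_right N \<eta>) = A \<eta>" "A1 (enter_right N \<eta>) = A1 \<eta>" "A2 (enter_right N \<eta>) = A2 \<eta>"
  by (auto simp: A_def A1_def A2_def G_def Z_enter_right intro!: sum.cong)

lemma weight_nonneg: "x \<le> N \<Longrightarrow> w x - w N \<ge> 0"
  using w_antimono[of x N] by simp

lemma S_nonneg: "S \<ge> 0"
  unfolding S_def by (intro sum_nonneg weight_nonneg) auto

lemma S_le: "(lam - 1) * S \<le> 1"
proof -
  have "(lam - 1) * (\<Sum>x = 1..<n. w x) = 1 - w (n - 1)" if "1 \<le> n" for n
    using that
  proof (induction n rule: dec_induct)
    case (step n)
    then obtain k where "n = Suc k" by (cases n) auto
    then show ?case using step w_Suc[of k] by (simp add: algebra_simps)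
  qed simp
  from this[of N] have geometric: "(lam - 1) * (\<Sum>x = 1..<N. w x) \<le> 1"
    using N_ge w_pos[of "N - 1"] by simp
  have "S \<le> (\<Sum>x = 1..<N. w x)"
    unfolding S_def using w_pos[of N] by (intro sum_mono) simp
  then have "(lam - 1) * S \<le> (lam - 1) * (\<Sum>x = 1..<N. w x)"
    using lam_gt_1 by (intro mult_left_mono) auto
  with geometric show ?thesis by linarith
qed

lemma weighted_Z_le_1:
  assumes "\<eta> \<in> configs N" "x \<le> N"
  shows "w x * (Z \<eta> x - 1) \<le> 1"
proof -
  have "w x * (Z \<eta> x - 1) \<le> w x * lam ^ x"
    using Z_le[OF assms] w_pos[of x] by (intro mult_left_mono) auto
  then show ?thesis by (simp add: w_lam_power)
qed

lemma A0_nonneg: "A0 \<eta> \<ge> 0"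
  unfolding A0_def using w_pos Z_ge_1 by (intro sum_nonneg mult_nonneg_nonneg) (auto intro: less_imp_le)

lemma A0_le: "\<eta> \<in> configs N \<Longrightarrow> A0 \<eta> \<le> real N"
  using sum_bounded_above[of "{1..<N}" "\<lambda>x. w x * (Z \<eta> x - 1)" 1] weighted_Z_le_1[of \<eta>]
  unfolding A0_def by force

lemma A_nonneg: "A \<eta> \<ge> 0"
  unfolding A_def using Z_ge_1 by (intro sum_nonneg mult_nonneg_nonneg weight_nonneg) auto

lemma A_le: "\<eta> \<in> configs N \<Longrightarrow> A \<eta> \<le> real N"
proof -
  assume \<eta>: "\<eta> \<in> configs N"
  have "A \<eta> \<le> A0 \<eta>"
    unfolding A_def A0_def using w_pos[of N] Z_ge_1 by (intro sum_mono mult_right_mono) auto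
  then show ?thesis using A0_le[OF \<eta>] by simp
qed

lemma A1_nonneg: "A1 \<eta> \<ge> 0"
  unfolding A1_def using w_pos Z_ge_1
  by (intro sum_nonneg mult_nonneg_nonneg) (auto intro: less_imp_le)

lemma A1_le: "\<eta> \<in> configs N \<Longrightarrow> A1 \<eta> \<le> real N ^ 2"
proof -
  assume \<eta>: "\<eta> \<in> configs N"
  have "A1 \<eta> \<le> (\<Sum>x = 1..<N. real N * (w x * (Z \<eta> x - 1)))"
    unfolding A1_def mult.assoc using w_pos Z_ge_1
    by (intro sum_mono mult_right_mono mult_nonneg_nonneg) (auto intro: less_imp_le)
  also have "\<dots> = real N * A0 \<eta>" by (simp add: A0_def sum_distrib_left)
  also have "\<dots> \<le> real N * real N" using A0_le[OF \<eta>] by (intro mult_left_mono) auto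
  finally show ?thesis by (simp add: power2_eq_square)
qed

lemma A2_nonneg: "A2 \<eta> \<ge> 0"
  unfolding A2_def using w_pos
  by (intro sum_nonneg mult_nonneg_nonneg G_nonneg) (auto intro: less_imp_le)

lemma A2_le: "\<eta> \<in> configs N \<Longrightarrow> A2 \<eta> \<le> real N ^ 2"
proof -
  assume \<eta>: "\<eta> \<in> configs N"
  have 1: "(w x * w y) * G \<eta> x y \<le> 1" if "x \<le> N" "y \<le> N" "x \<le> y" for x y
  proof -
    have "(w x * w y) * G \<eta> x y \<le> (w x * w y) * (lam ^ x * lam ^ y)"
    proof (rule mult_left_mono)
      show "G \<eta> x y \<le> lam ^ x * lam ^ y"
      proof (cases "Z \<eta> y - lam \<ge> 0")
        case True
        then show ?thesis unfolding G_def using Z_le[OF \<eta> that(1)] Z_le[OF \<eta> that(2)] lam_gt_1 Z_ge_1[of \<eta> x]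
          by (intro mult_mono) auto
      next
        case False
        then have "G \<eta> x y \<le> 0" unfolding G_def using Z_ge_1[of \<eta> x] by (intro mult_nonneg_nonpos) auto
        then show ?thesis using lam_gt_1 by (smt (verit) mult_nonneg_nonneg zero_le_power)
      qed
    qed (use w_pos[of x] w_pos[of y] in auto)
    also have "\<dots> = (w x * lam ^ x) * (w y * lam ^ y)" by (simp only: mult_ac)
    finally show ?thesis by (simp add: w_lam_power)
  qed
  have "A2 \<eta> \<le> (\<Sum>y = 1..<N. \<Sum>x = 1..<y. 1)"
    unfolding A2_def by (intro sum_mono 1) auto
  also have "\<dots> \<le> (\<Sum>y = 1..<N. real N)"
    by (intro sum_mono) auto
  also have "\<dots> \<le> real N * real N"
    by (simp add: mult_right_mono)
  finally show ?thesis by (simp add: power2_eq_square)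
qed

lemma A1_exit_le: "A1 (exit_left \<eta>) \<le> A1 \<eta>"
  unfolding A1_def using Z_exit_le w_pos
  by (intro sum_mono mult_left_mono) (auto intro: less_imp_le)

lemma A2_exit_le: "A2 (exit_left \<eta>) \<le> A2 \<eta>"
proof -
  have "G (exit_left \<eta>) x y \<le> G \<eta> x y" if "x \<le> y" for x y
  proof (cases "Z (exit_left \<eta>) x = 1")
    case True
    then show ?thesis using G_nonneg[OF that, of \<eta>] by (simp add: G_def)
  next
    case False
    then have "Z (exit_left \<eta>) x \<ge> lam" using Z_cases by blast
    then show ?thesis
      unfolding G_def using Z_exit_le[of \<eta> x] Z_exit_le[of \<eta> y] Z_mono[OF that, of "exit_left \<eta>"] lam_gt_1
      by (intro mult_mono) auto
  qed
  then show ?thesis unfolding A2_def using w_pos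
    by (intro sum_mono mult_left_mono) (auto intro: less_imp_le)
qed

subsection \<open>Drifts with reservoirs\<close>

text \<open>The order of magnitude of the exit rate, \<open>lam ^ (k - N)\<close> for \<open>k\<close> particles.\<close>

definition \<tau> :: "config \<Rightarrow> real" where "\<tau> \<eta> = w N * lam ^ particles \<eta> N"

lemma \<tau>_pos: "\<tau> \<eta> > 0"
  using w_pos[of N] lam_gt_1 by (simp add: \<tau>_def)

lemma \<tau>_le_1: "\<eta> \<in> configs N \<Longrightarrow> \<tau> \<eta> \<le> 1"
proof -
  assume "\<eta> \<in> configs N"
  then have "\<tau> \<eta> \<le> w N * lam ^ N"
    using Z_le[of \<eta> N] w_pos[of N] unfolding \<tau>_def Z_def by (intro mult_left_mono) auto
  then show ?thesis by (simp add: w_lam_power)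
qed

lemma \<tau>_mirror:
  assumes "\<eta> \<in> configs N"
  shows "\<tau> \<eta> * \<tau> (mirror N \<eta>) = w N"
proof -
  have "particles \<eta> N \<le> N" using particles_le[OF assms] by simp
  then have "lam ^ particles \<eta> N * lam ^ (N - particles \<eta> N) = lam ^ N" by (simp flip: power_add)
  then have "\<tau> \<eta> * \<tau> (mirror N \<eta>) = w N * (w N * lam ^ N)"
    unfolding \<tau>_def particles_mirror[OF assms] by (metis mult.assoc mult.left_commute)
  then show ?thesis by (simp add: w_lam_power)
qed

lemma \<tau>_below:
  assumes "(\<eta>, \<zeta>) \<in> below N" "\<eta> \<noteq> \<zeta>"
  shows "lam * \<tau> \<eta> \<le> \<tau> \<zeta>"
proof -
  have "lam ^ Suc (particles \<eta> N) \<le> lam ^ particles \<zeta> N"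
    using particles_below_less[OF assms] lam_gt_1 by (intro power_increasing) auto
  then have "w N * lam ^ Suc (particles \<eta> N) \<le> w N * lam ^ particles \<zeta> N"
    using w_pos[of N] by (intro mult_left_mono) auto
  then show ?thesis by (simp add: \<tau>_def mult_ac)
qed

lemma drift_count:
  assumes "\<eta> \<in> configs N"
  shows "drift N p \<gamma> \<delta> (\<lambda>\<eta>. real (particles \<eta> N)) \<eta> = - \<gamma> * real (\<eta> 1) + \<delta> * (1 - real (\<eta> N))"
proof -
  have "bulk_drift N p (\<lambda>\<eta>. real (particles \<eta> N)) \<eta> = bulk_drift N p (\<lambda>_. real (particles \<eta> N)) \<eta>"
    using bulk_drift_count[of N p "\<lambda>k _. real k"] .
  also have "\<dots> = 0" by (simp add: bulk_drift_def bond_drift_def)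
  finally have "bulk_drift N p (\<lambda>\<eta>. real (particles \<eta> N)) \<eta> = 0" .
  moreover have "real (particles (exit_left \<eta>) N) - real (particles \<eta> N) = - real (\<eta> 1)"
    using particles_exit_left[of N \<eta>] N_ge by simp
  moreover have "real (particles (enter_right N \<eta>) N) - real (particles \<eta> N) = 1 - real (\<eta> N)"
    using particles_enter_right_N[of N \<eta>] N_ge by simp
  ultimately show ?thesis by (simp add: drift_def)
qed

lemma drift_A:
  assumes "\<eta> \<in> configs N"
  shows "drift N p \<gamma> \<delta> A \<eta> = c * (\<tau> \<eta> - w N) - c * (1 - w N) * real (\<eta> 1)
    - \<gamma> * (real (\<eta> 1) * ((lam - 1) * (S + A (exit_left \<eta>))))"
proof -
  have "A (exit_left \<eta>) - A \<eta> = - (real (\<eta> 1) * ((lam - 1) * (S + A (exit_left \<eta>))))"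
    using A_exit[OF assms] by simp
  then show ?thesis
    by (simp add: drift_def bulk_drift_A[OF assms] enter_right_potentials \<tau>_def)
qed

lemma drift_A1:
  assumes "\<eta> \<in> configs N" "\<gamma> \<ge> 0"
  shows "drift N p \<gamma> \<delta> A1 \<eta> \<le> p * real N * \<tau> \<eta> - c * A0 \<eta>"
proof -
  have "\<gamma> * (A1 (exit_left \<eta>) - A1 \<eta>) \<le> 0"
    using A1_exit_le[of \<eta>] assms(2) by (intro mult_nonneg_nonpos) auto
  then show ?thesis using bulk_drift_A1[OF assms(1)]
    by (simp add: drift_def enter_right_potentials \<tau>_def)
qed

lemma drift_A2:
  assumes "\<eta> \<in> configs N" "\<gamma> \<ge> 0"
  shows "drift N p \<gamma> \<delta> A2 \<eta> \<le> p * \<tau> \<eta> * A0 \<eta> - p * (lam - 1) * real (\<eta> 1) * A (exit_left \<eta>)"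
proof -
  have "\<gamma> * (A2 (exit_left \<eta>) - A2 \<eta>) \<le> 0"
    using A2_exit_le[of \<eta>] assms(2) by (intro mult_nonneg_nonpos) auto
  then show ?thesis using bulk_drift_A2[OF assms(1)]
    by (simp add: drift_def enter_right_potentials \<tau>_def)
qed

text \<open>A function that decreases fast at high density: \<open>lam ^ k\<close> as a function of the particle number \<open>k\<close>
grows at entries, which \<open>b * A (mirror N \<eta>)\<close> pays for, and decreases at exits, whose rate \<open>- A \<eta>\<close>
provides.\<close>

definition U :: "real \<Rightarrow> real \<Rightarrow> config \<Rightarrow> real" where
  "U a b \<eta> = lam ^ particles \<eta> N * (a - A \<eta> + b * A (mirror N \<eta>))"

lemma drift_U:
  assumes \<eta>: "\<eta> \<in> configs N" and rates: "\<gamma> > 0" "\<delta> \<ge> 0"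
    and a: "a \<ge> 0" "a * (lam - 1) / lam * \<gamma> \<ge> \<gamma> * real N + c"
    and b: "b \<ge> 0" "b * c * (1 - w N) \<ge> \<delta> * (lam - 1) * a"
  shows "drift N p \<gamma> \<delta> (U a b) \<eta> \<le> - c * \<tau> \<eta> ^ 2 / w N + c * (1 + b)"
proof -
  define L where "L = lam ^ particles \<eta> N"
  have L: "L > 0" using lam_gt_1 by (simp add: L_def)
  define H where "H \<eta> = a - A \<eta> + b * A (mirror N \<eta>)" for \<eta>
  have m\<eta>: "mirror N \<eta> \<in> configs N" by (rule mirror_configs[OF \<eta>])
  have N1: "1 \<le> N" using N_ge by simp
  have m1: "real (mirror N \<eta> 1) = 1 - real (\<eta> N)"
    using config_values[OF \<eta>, of N] N1 by (auto simp: mirror_def)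
  have bulk_mirror: "bulk_drift N p (\<lambda>\<eta>. A (mirror N \<eta>)) \<eta> = bulk_drift N p A (mirror N \<eta>)"
    using drift_mirror[OF \<eta> N1, of p 0 0 A] by (simp add: drift_def)
  have "bulk_drift N p H \<eta> = - bulk_drift N p A \<eta> + b * bulk_drift N p (\<lambda>\<eta>. A (mirror N \<eta>)) \<eta>"
    unfolding H_def[abs_def] bulk_drift_def bond_drift_def
    by (simp add: sum_distrib_left sum.distrib sum_subtractf algebra_simps)
  also have "\<dots> = - c * (\<tau> \<eta> - w N) + c * (1 - w N) * real (\<eta> 1)
      + b * (c * (\<tau> (mirror N \<eta>) - w N) - c * (1 - w N) * (1 - real (\<eta> N)))"
    unfolding bulk_mirror bulk_drift_A[OF \<eta>] bulk_drift_A[OF m\<eta>] m1 by (simp add: \<tau>_def algebra_simps)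
  finally have bulk_H: "bulk_drift N p H \<eta> = - c * (\<tau> \<eta> - w N) + c * (1 - w N) * real (\<eta> 1)
      + b * (c * (\<tau> (mirror N \<eta>) - w N) - c * (1 - w N) * (1 - real (\<eta> N)))" .
  have U_eq: "U a b = (\<lambda>\<eta>. lam ^ particles \<eta> N * H \<eta>)"
    by (simp add: U_def H_def fun_eq_iff)
  have bulk_U0: "bulk_drift N p (U a b) \<eta> = L * bulk_drift N p H \<eta>"
    unfolding U_eq bulk_drift_count[of N p "\<lambda>k \<eta>. lam ^ k * H \<eta>"] bulk_drift_cmult L_def ..
  have bulk_U: "bulk_drift N p (U a b) \<eta> = - c * (L * \<tau> \<eta>) + c * (L * w N) + b * c * (L * \<tau> (mirror N \<eta>)) - b * c * (L * w N)
      + L * (c * (1 - w N) * real (\<eta> 1)) - L * (b * c * (1 - w N) * (1 - real (\<eta> N)))"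
    unfolding bulk_U0 bulk_H by (simp add: algebra_simps)
  have L\<tau>: "L * \<tau> (mirror N \<eta>) = 1" "L * w N = \<tau> \<eta>"
  proof -
    show "L * w N = \<tau> \<eta>" by (simp add: L_def \<tau>_def)
    then have "(L * \<tau> (mirror N \<eta>)) * w N = w N"
      using \<tau>_mirror[OF \<eta>] by (metis mult.assoc mult.commute)
    then show "L * \<tau> (mirror N \<eta>) = 1" using w_pos[of N] by simp
  qed
  have "L * \<tau> \<eta> = \<tau> \<eta> ^ 2 / w N"
    unfolding L\<tau>(2)[symmetric] using w_pos[of N] by (simp add: power2_eq_square)
  with bulk_U have "bulk_drift N p (U a b) \<eta> = - c * (\<tau> \<eta> ^ 2 / w N) + c * \<tau> \<eta> + b * c - b * c * \<tau> \<eta>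
      + L * (c * (1 - w N) * real (\<eta> 1)) - L * (b * c * (1 - w N) * (1 - real (\<eta> N)))"
    unfolding L\<tau> by simp
  moreover have "c * \<tau> \<eta> \<le> c" using \<tau>_le_1[OF \<eta>] c_pos by simp
  moreover have "b * c * \<tau> \<eta> \<ge> 0" using \<tau>_pos[of \<eta>] c_pos b by simp
  moreover have "\<gamma> * (U a b (exit_left \<eta>) - U a b \<eta>) + L * (c * (1 - w N) * real (\<eta> 1)) \<le> 0"
  proof (cases "\<eta> 1 = 1")
    case True
    have "lam * lam ^ particles (exit_left \<eta>) N = L"
      using Z_exit[of \<eta> N, OF True N1] by (simp add: Z_def L_def)
    then have L': "lam ^ particles (exit_left \<eta>) N = L / lam" using lam_gt_1 by (simp add: field_simps)
    have "A (mirror N (exit_left \<eta>)) = A (mirror N \<eta>)"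
      by (simp only: mirror_ends[OF N1] enter_right_potentials)
    then have "U a b (exit_left \<eta>) - U a b \<eta> = (L / lam) * (a - A (exit_left \<eta>) + b * A (mirror N \<eta>))
        - L * (a - A \<eta> + b * A (mirror N \<eta>))"
      by (simp add: U_def L' L_def)
    also have "\<dots> = L * (- (a * (lam - 1) / lam) + A \<eta> - A (exit_left \<eta>) / lam
        - b * A (mirror N \<eta>) * ((lam - 1) / lam))"
      using lam_gt_1 by (simp add: field_simps)
    also have "\<dots> \<le> L * (- (a * (lam - 1) / lam) + real N)"
    proof (rule mult_left_mono)
      have "A (exit_left \<eta>) / lam \<ge> 0" "b * A (mirror N \<eta>) * ((lam - 1) / lam) \<ge> 0"
        using A_nonneg lam_gt_1 b by simp_all
      then show "- (a * (lam - 1) / lam) + A \<eta> - A (exit_left \<eta>) / lam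
          - b * A (mirror N \<eta>) * ((lam - 1) / lam) \<le> - (a * (lam - 1) / lam) + real N"
        using A_le[OF \<eta>] by linarith
    qed (use L in simp)
    finally have "\<gamma> * (U a b (exit_left \<eta>) - U a b \<eta>) \<le> \<gamma> * (L * (- (a * (lam - 1) / lam) + real N))"
      using rates by (intro mult_left_mono) auto
    also have "\<dots> = L * (- (a * (lam - 1) / lam * \<gamma>) + \<gamma> * real N)"
      by (simp add: algebra_simps)
    finally have 1: "\<gamma> * (U a b (exit_left \<eta>) - U a b \<eta>) \<le> L * (- (a * (lam - 1) / lam * \<gamma>) + \<gamma> * real N)" .
    have "c * (1 - w N) \<le> c * 1"
      using c_pos w_pos[of N] by (intro mult_left_mono) auto
    then have "L * (c * (1 - w N) * real (\<eta> 1)) \<le> L * c"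
      using L True by (intro mult_left_mono) auto
    with 1 have "\<gamma> * (U a b (exit_left \<eta>) - U a b \<eta>) + L * (c * (1 - w N) * real (\<eta> 1))
        \<le> L * (- (a * (lam - 1) / lam * \<gamma>) + \<gamma> * real N + c)"
      by (simp add: distrib_left)
    also have "\<dots> \<le> 0" using a(2) L by (intro mult_nonneg_nonpos) auto
    finally show ?thesis .
  next
    case False
    then have "\<eta> 1 = 0" using config_values[OF \<eta>, of 1] N1 by auto
    then show ?thesis by (simp add: exit_left_idle)
  qed
  moreover have "\<delta> * (U a b (enter_right N \<eta>) - U a b \<eta>) - L * (b * c * (1 - w N) * (1 - real (\<eta> N))) \<le> 0"
  proof (cases "\<eta> N = 0")
    case True
    let ?A' = "A (mirror N (enter_right N \<eta>))"
    have "particles (enter_right N \<eta>) N = Suc (particles \<eta> N)"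
      using particles_enter_right_N[OF N1, of \<eta>] True by simp
    then have L': "lam ^ particles (enter_right N \<eta>) N = lam * L" by (simp add: L_def)
    have "A (mirror N \<eta>) = ?A' + (lam - 1) * (S + ?A')"
      using A_exit[OF m\<eta>] m1 True by (simp only: mirror_ends[OF N1]) simp
    then have "A (mirror N \<eta>) = lam * ?A' + (lam - 1) * S" by (simp add: algebra_simps)
    moreover have "(lam - 1) * S \<ge> 0" using S_nonneg lam_gt_1 by simp
    ultimately have A': "lam * ?A' \<le> A (mirror N \<eta>)" by linarith
    have "U a b (enter_right N \<eta>) - U a b \<eta>
        = L * ((lam - 1) * a - (lam - 1) * A \<eta> + b * (lam * ?A' - A (mirror N \<eta>)))"
      by (simp add: U_def L' L_def enter_right_potentials algebra_simps)
    also have "\<dots> \<le> L * ((lam - 1) * a)"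
    proof (rule mult_left_mono)
      have "(lam - 1) * A \<eta> \<ge> 0" "b * (lam * ?A' - A (mirror N \<eta>)) \<le> 0"
        using A_nonneg[of \<eta>] lam_gt_1 b A' by (simp_all add: mult_nonneg_nonpos)
      then show "(lam - 1) * a - (lam - 1) * A \<eta> + b * (lam * ?A' - A (mirror N \<eta>)) \<le> (lam - 1) * a"
        by linarith
    qed (use L in simp)
    finally have "\<delta> * (U a b (enter_right N \<eta>) - U a b \<eta>) \<le> \<delta> * (L * ((lam - 1) * a))"
      using rates by (intro mult_left_mono) auto
    also have "\<dots> = L * (\<delta> * (lam - 1) * a)" by (simp only: mult_ac)
    also have "\<dots> \<le> L * (b * c * (1 - w N))" using b L by (intro mult_left_mono) auto
    finally show ?thesis using True by simp
  next
    case False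
    then have "\<eta> N = 1" using config_values[OF \<eta>, of N] N1 by auto
    then show ?thesis by (simp add: enter_right_idle)
  qed
  ultimately show ?thesis by (simp add: drift_def algebra_simps)
qed


section \<open>The pair function for two open ends\<close>

text \<open>A discrepancy between two copies makes \<open>c * \<tau>\<close> differ by at least \<open>2 * gain * \<tau>\<close>; half of this pays
for the correction \<open>E\<close> below.\<close>

definition gain :: real where "gain = c * (lam - 1) / (2 * lam)"

text \<open>The correction for simultaneous exits. The coefficients are forced: that of \<open>A2\<close> by the term to be
paid for, that of \<open>A1\<close> by the cost of \<open>A2\<close> for \<open>\<tau> \<eta> \<le> 1 / (K * N)\<close>, and that of \<open>U\<close> by the same cost
for larger \<open>\<tau> \<eta>\<close>. As \<open>w N * U\<close> is at most polynomial in \<open>N\<close>, so are all three terms.\<close>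

definition E :: "real \<Rightarrow> real \<Rightarrow> config \<Rightarrow> real" where
  "E \<gamma> K \<eta> = \<gamma> / p * A2 \<eta> + \<gamma> / (c * (K * real N)) * A1 \<eta>
    + K ^ 3 * real N ^ 3 * w N * U (K * real N) (K ^ 2 * real N) \<eta>"

text \<open>All constants of the construction are replaced by powers of a single \<open>K\<close>. The lower bounds that \<open>K\<close>
has to meet are independent of \<open>N\<close>.\<close>

definition large :: "real \<Rightarrow> real \<Rightarrow> real \<Rightarrow> bool" where
  "large \<gamma> \<delta> K \<longleftrightarrow> 1 \<le> K \<and> \<gamma> + c \<le> K * ((lam - 1) / lam) * \<gamma> \<and> \<delta> * lam \<le> K * c
    \<and> \<gamma> \<le> K * c \<and> \<gamma> * p \<le> K * (c * gain) \<and> \<gamma> \<le> K * p"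

lemma gain_pos: "gain > 0"
  using c_pos lam_gt_1 by (simp add: gain_def)

lemma N1: "1 \<le> N"
  using N_ge by simp

lemma w_N_le: "w N \<le> 1 / lam"
  using w_antimono[of 1 N] N1 by (simp add: w_def)

lemma drift_E:
  assumes \<eta>: "\<eta> \<in> configs N" and rates: "\<gamma> > 0" "\<delta> \<ge> 0" and K: "large \<gamma> \<delta> K"
  shows "drift N p \<gamma> \<delta> (E \<gamma> K) \<eta> \<le> gain * \<tau> \<eta> + K ^ 3 * real N ^ 3 * w N * (c * (1 + K ^ 2 * real N))
    - \<gamma> * (lam - 1) * (real (\<eta> 1) * A (exit_left \<eta>))"
proof -
  define n where "n = real N"
  have n: "n \<ge> 1" using N1 by (simp add: n_def)
  have K1: "K \<ge> 1" using K by (simp add: large_def)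
  have p0: "p > 0" using p_gt by simp
  define X where "X = real (\<eta> 1) * A (exit_left \<eta>)"
  define a0 where "a0 = A0 \<eta>"
  have a0: "0 \<le> a0" "a0 \<le> n" using A0_nonneg A0_le[OF \<eta>] by (auto simp: a0_def n_def)
  let ?s = "K ^ 3 * n ^ 3 * w N"
  have s_nonneg: "?s \<ge> 0" using K1 n w_pos[of N] by (intro mult_nonneg_nonneg) auto
  have "drift N p \<gamma> \<delta> (E \<gamma> K) \<eta> = \<gamma> / p * drift N p \<gamma> \<delta> A2 \<eta> + \<gamma> / (c * (K * n)) * drift N p \<gamma> \<delta> A1 \<eta>
      + ?s * drift N p \<gamma> \<delta> (U (K * n) (K ^ 2 * n)) \<eta>"
    unfolding E_def[abs_def] drift_add drift_cmult n_def ..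
  also have "\<gamma> / p * drift N p \<gamma> \<delta> A2 \<eta> \<le> \<gamma> / p * (p * \<tau> \<eta> * a0 - p * (lam - 1) * X)"
    using drift_A2[OF \<eta>, of \<gamma> \<delta>] rates p0 by (intro mult_left_mono) (auto simp: a0_def X_def mult.assoc)
  also have "\<gamma> / p * (p * \<tau> \<eta> * a0 - p * (lam - 1) * X) = \<gamma> * \<tau> \<eta> * a0 - \<gamma> * (lam - 1) * X"
    using p0 by (simp add: field_simps)
  also have "\<gamma> / (c * (K * n)) * drift N p \<gamma> \<delta> A1 \<eta> \<le> \<gamma> / (c * (K * n)) * (p * n * \<tau> \<eta> - c * a0)"
    using drift_A1[OF \<eta>, of \<gamma> \<delta>] rates c_pos K1 n
    by (intro mult_left_mono) (auto simp: a0_def n_def)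
  also have "\<gamma> / (c * (K * n)) * (p * n * \<tau> \<eta> - c * a0) = \<gamma> * p / (K * c) * \<tau> \<eta> - \<gamma> * a0 * (1 / (K * n))"
    using c_pos K1 n by (simp add: field_simps)
  also have "\<gamma> * p / (K * c) * \<tau> \<eta> \<le> gain * \<tau> \<eta>"
  proof (rule mult_right_mono)
    have "K * c > 0" using K1 c_pos by simp
    then show "\<gamma> * p / (K * c) \<le> gain"
      using K by (subst pos_divide_le_eq) (auto simp: large_def mult_ac)
  qed (use \<tau>_pos[of \<eta>] in simp)
  also have "?s * drift N p \<gamma> \<delta> (U (K * n) (K ^ 2 * n)) \<eta> \<le> ?s * (- c * \<tau> \<eta> ^ 2 / w N + c * (1 + K ^ 2 * n))"
  proof (intro mult_left_mono drift_U[OF \<eta> rates] s_nonneg)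
    show "K * n \<ge> 0" "K ^ 2 * n \<ge> 0" using K1 n by simp_all
    have "(\<gamma> + c) * n \<le> K * ((lam - 1) / lam) * \<gamma> * n"
      using K n by (intro mult_right_mono) (auto simp: large_def)
    moreover have "c * 1 \<le> c * n" using c_pos n by (intro mult_left_mono) auto
    ultimately show "\<gamma> * real N + c \<le> K * n * (lam - 1) / lam * \<gamma>"
      by (simp add: n_def field_simps)
    have "\<delta> * (lam - 1) * (K * n) = (\<delta> * lam) * ((lam - 1) / lam) * (K * n)"
      using lam_gt_1 by simp
    also have "\<dots> \<le> (K * c) * (1 - w N) * (K * n)"
    proof (rule mult_right_mono)
      have "(lam - 1) / lam \<le> 1 - w N" using w_N_le lam_gt_1 by (simp add: diff_divide_distrib)
      moreover have "\<delta> * lam \<le> K * c" using K by (simp add: large_def)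
      ultimately show "(\<delta> * lam) * ((lam - 1) / lam) \<le> (K * c) * (1 - w N)"
        using lam_gt_1 K1 c_pos by - (rule mult_mono, auto)
    qed (use K1 n in simp)
    finally show "\<delta> * (lam - 1) * (K * n) \<le> K ^ 2 * n * c * (1 - w N)"
      by (simp add: power2_eq_square mult_ac)
  qed
  also have "?s * (- c * \<tau> \<eta> ^ 2 / w N + c * (1 + K ^ 2 * n))
      = - (K ^ 3 * n ^ 3 * c * \<tau> \<eta> ^ 2) + ?s * (c * (1 + K ^ 2 * n))"
    using w_pos[of N] by (simp add: field_simps)
  finally have "drift N p \<gamma> \<delta> (E \<gamma> K) \<eta> \<le> gain * \<tau> \<eta> + ?s * (c * (1 + K ^ 2 * n)) - \<gamma> * (lam - 1) * X
      + (\<gamma> * a0 * (\<tau> \<eta> - 1 / (K * n)) - K ^ 3 * n ^ 3 * c * \<tau> \<eta> ^ 2)"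
    by (simp add: algebra_simps)
  \<comment> \<open>Low density: the dissipation of \<open>A1\<close> wins. High density: the dissipation of \<open>U\<close> wins.\<close>
  moreover have "\<gamma> * a0 * (\<tau> \<eta> - 1 / (K * n)) \<le> K ^ 3 * n ^ 3 * c * \<tau> \<eta> ^ 2"
  proof (cases "\<tau> \<eta> \<le> 1 / (K * n)")
    case True
    then have "\<gamma> * a0 * (\<tau> \<eta> - 1 / (K * n)) \<le> 0"
      using rates a0 by (intro mult_nonneg_nonpos) auto
    also have "0 \<le> K ^ 3 * n ^ 3 * c * \<tau> \<eta> ^ 2"
      using K1 n c_pos by simp
    finally show ?thesis .
  next
    case False
    have Kn: "K * n \<ge> 1" using K1 n by (metis mult_mono mult_1 zero_le_one order_trans)
    then have "1 \<le> K * n * \<tau> \<eta>" using False by (simp add: field_simps)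
    have "\<gamma> * a0 * (\<tau> \<eta> - 1 / (K * n)) \<le> \<gamma> * n * \<tau> \<eta>"
      using rates a0 n Kn \<tau>_pos[of \<eta>] False by (intro mult_mono) auto
    also have "\<dots> \<le> (K * c) * n * \<tau> \<eta>"
      using K n \<tau>_pos[of \<eta>] by (intro mult_right_mono) (auto simp: large_def)
    also have "\<dots> \<le> (K * c) * n * \<tau> \<eta> * ((K * n) * (K * n * \<tau> \<eta>))"
    proof -
      have "1 * 1 \<le> (K * n) * (K * n * \<tau> \<eta>)"
        using Kn \<open>1 \<le> K * n * \<tau> \<eta>\<close> by (intro mult_mono) auto
      moreover have "0 \<le> (K * c) * n * \<tau> \<eta>" using K1 c_pos n \<tau>_pos[of \<eta>] by simp
      ultimately show ?thesis using mult_left_mono[of 1 "(K * n) * (K * n * \<tau> \<eta>)" "(K * c) * n * \<tau> \<eta>"] by simp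
    qed
    also have "\<dots> = K ^ 3 * n ^ 3 * c * \<tau> \<eta> ^ 2"
      by (simp add: power2_eq_square power3_eq_cube mult_ac)
    finally show ?thesis .
  qed
  ultimately show ?thesis unfolding n_def X_def by linarith
qed

lemma E_bounds:
  assumes \<eta>: "\<eta> \<in> configs N" and "\<gamma> > 0" and K: "large \<gamma> \<delta> K"
  shows "0 \<le> E \<gamma> K \<eta>" "E \<gamma> K \<eta> \<le> 4 * K ^ 5 * real N ^ 5"
proof -
  define n where "n = real N"
  have n: "n \<ge> 1" using N1 by (simp add: n_def)
  have K1: "K \<ge> 1" using K by (simp add: large_def)
  have p0: "p > 0" using p_gt by simp
  have m: "mirror N \<eta> \<in> configs N" by (rule mirror_configs[OF \<eta>])
  have Kn: "n \<le> K * n" using K1 n by (simp add: mult_le_cancel_right1)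
  have inner: "0 \<le> K * n - A \<eta> + K ^ 2 * n * A (mirror N \<eta>)"
    using order_trans[OF A_le[OF \<eta>, folded n_def] Kn] A_nonneg[of "mirror N \<eta>"] K1 n
    by (intro add_nonneg_nonneg) auto
  have U0: "0 \<le> U (K * n) (K ^ 2 * n) \<eta>"
    unfolding U_def using inner lam_gt_1 by simp
  show "0 \<le> E \<gamma> K \<eta>"
    unfolding E_def n_def[symmetric] using assms(2) p0 c_pos K1 n w_pos[of N] U0 A1_nonneg A2_nonneg by simp
  have pow: "K ^ i * n ^ j \<le> K ^ 5 * n ^ 5" if "i \<le> 5" "j \<le> 5" for i j
    using K1 n that by (intro mult_mono power_increasing) auto
  have "\<gamma> / p * A2 \<eta> \<le> K * n ^ 2"
    using A2_le[OF \<eta>] A2_nonneg[of \<eta>] K p0 K1 unfolding n_def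
    by (intro mult_mono) (auto simp: large_def pos_divide_le_eq)
  also have "\<dots> \<le> K ^ 5 * n ^ 5" using pow[of 1 2] by simp
  finally have 1: "\<gamma> / p * A2 \<eta> \<le> K ^ 5 * n ^ 5" .
  have "\<gamma> / (c * (K * n)) \<le> 1"
  proof -
    have "\<gamma> \<le> c * K * 1" using K by (simp add: large_def mult_ac)
    also have "\<dots> \<le> c * K * n" using c_pos K1 n by (intro mult_left_mono) auto
    finally show ?thesis using c_pos K1 n by (subst pos_divide_le_eq) auto
  qed
  then have "\<gamma> / (c * (K * n)) * A1 \<eta> \<le> 1 * n ^ 2"
    using A1_le[OF \<eta>] A1_nonneg[of \<eta>] unfolding n_def by (intro mult_mono) auto
  also have "\<dots> \<le> K ^ 5 * n ^ 5" using pow[of 0 2] by simp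
  finally have 2: "\<gamma> / (c * (K * n)) * A1 \<eta> \<le> K ^ 5 * n ^ 5" .
  have "K ^ 2 * n * A (mirror N \<eta>) \<le> K ^ 2 * n * n"
    using A_le[OF m] K1 n by (intro mult_left_mono) (auto simp: n_def)
  then have "K * n - A \<eta> + K ^ 2 * n * A (mirror N \<eta>) \<le> K * n + K ^ 2 * n * n"
    using A_nonneg[of \<eta>] by linarith
  also have "\<dots> \<le> K ^ 2 * n ^ 2 + K ^ 2 * n ^ 2"
  proof -
    have "K ^ 1 * n ^ 1 \<le> K ^ 2 * n ^ 2" using K1 n by (intro mult_mono power_increasing) auto
    then show ?thesis by (simp add: power2_eq_square mult_ac)
  qed
  finally have "\<tau> \<eta> * (K * n - A \<eta> + K ^ 2 * n * A (mirror N \<eta>)) \<le> 1 * (2 * K ^ 2 * n ^ 2)"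
    using \<tau>_le_1[OF \<eta>] inner by (intro mult_mono) auto
  moreover have "w N * U (K * n) (K ^ 2 * n) \<eta> = \<tau> \<eta> * (K * n - A \<eta> + K ^ 2 * n * A (mirror N \<eta>))"
    by (simp add: U_def \<tau>_def)
  ultimately have "K ^ 3 * n ^ 3 * (w N * U (K * n) (K ^ 2 * n) \<eta>) \<le> K ^ 3 * n ^ 3 * (2 * K ^ 2 * n ^ 2)"
    using K1 n by (intro mult_left_mono) auto
  also have "\<dots> = 2 * (K ^ 5 * n ^ 5)"
    by (simp add: eval_nat_numeral mult_ac)
  finally have 3: "K ^ 3 * n ^ 3 * w N * U (K * n) (K ^ 2 * n) \<eta> \<le> 2 * (K ^ 5 * n ^ 5)"
    by (simp add: mult.assoc)
  show "E \<gamma> K \<eta> \<le> 4 * K ^ 5 * real N ^ 5"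
    using 1 2 3 unfolding E_def n_def by simp
qed

text \<open>The parts of the pair function that belong to the upper and to the lower copy, for the particles;
the parts for the holes are their mirror images, with the roles of the copies exchanged.\<close>

definition Hi :: "real \<Rightarrow> real \<Rightarrow> config \<Rightarrow> real" where
  "Hi \<gamma> K \<eta> = K * real N * real (particles \<eta> N) - A \<eta> + E \<gamma> K \<eta>"

definition Lo :: "real \<Rightarrow> config \<Rightarrow> real" where
  "Lo K \<eta> = A \<eta> - K * real N * real (particles \<eta> N)"

lemma below_ends:
  assumes "(\<eta>, \<zeta>) \<in> below N"
  shows "real (\<eta> 1) \<le> real (\<zeta> 1)" "real (\<eta> N) \<le> real (\<zeta> N)"
  using assms N1 by (auto simp: below_def)

text \<open>When only the upper copy occupies site 1, it alone loses a particle, and the term \<open>K * N\<close> times the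
number of discrepancies pays for everything. When both copies do, that number stays constant, the change
of \<open>- A\<close> is an error, and \<open>E\<close> pays for it. The gain is the difference of \<open>c * \<tau>\<close> at the two copies.\<close>

lemma pair_drift:
  assumes below: "(\<eta>, \<zeta>) \<in> below N" and "\<eta> \<noteq> \<zeta>"
    and rates: "\<gamma> > 0" "\<delta> \<ge> 0" and K: "large \<gamma> \<delta> K"
  shows "drift N p \<gamma> \<delta> (Hi \<gamma> K) \<zeta> + drift N p \<gamma> \<delta> (Lo K) \<eta>
    \<le> - gain * \<tau> \<zeta> + K ^ 3 * real N ^ 3 * w N * (c * (1 + K ^ 2 * real N))"
proof -
  have \<eta>: "\<eta> \<in> configs N" and \<zeta>: "\<zeta> \<in> configs N" using below by (auto simp: below_def)
  have K1: "K \<ge> 1" using K by (simp add: large_def)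
  define d where "d = real (\<zeta> 1) - real (\<eta> 1)"
  have d: "d \<ge> 0" using below_ends[OF below] by (simp add: d_def)
  define C where "C = K * real N"
  have CK: "C \<ge> K" using K1 N1 by (simp add: C_def mult_le_cancel_left1)
  define X Y where "X = real (\<zeta> 1) * A (exit_left \<zeta>)" and "Y = real (\<eta> 1) * A (exit_left \<eta>)"
  have Y: "Y \<ge> 0" using A_nonneg by (simp add: Y_def)
  define R where "R = K ^ 3 * real N ^ 3 * w N * (c * (1 + K ^ 2 * real N))"
  have "drift N p \<gamma> \<delta> (Hi \<gamma> K) \<zeta> = C * drift N p \<gamma> \<delta> (\<lambda>\<eta>. real (particles \<eta> N)) \<zeta>
      - drift N p \<gamma> \<delta> A \<zeta> + drift N p \<gamma> \<delta> (E \<gamma> K) \<zeta>"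
    unfolding Hi_def[abs_def] drift_add drift_diff drift_cmult C_def ..
  also have "\<dots> \<le> C * (- \<gamma> * real (\<zeta> 1) + \<delta> * (1 - real (\<zeta> N)))
      - (c * (\<tau> \<zeta> - w N) - c * (1 - w N) * real (\<zeta> 1) - \<gamma> * (lam - 1) * S * real (\<zeta> 1) - \<gamma> * (lam - 1) * X)
      + (gain * \<tau> \<zeta> + R - \<gamma> * (lam - 1) * X)"
    using drift_E[OF \<zeta> rates K] unfolding drift_count[OF \<zeta>] drift_A[OF \<zeta>] X_def R_def
    by (simp add: algebra_simps)
  finally have 1: "drift N p \<gamma> \<delta> (Hi \<gamma> K) \<zeta> \<le> C * (- \<gamma> * real (\<zeta> 1) + \<delta> * (1 - real (\<zeta> N)))
      - c * (\<tau> \<zeta> - w N) + c * (1 - w N) * real (\<zeta> 1) + \<gamma> * (lam - 1) * S * real (\<zeta> 1) + gain * \<tau> \<zeta> + R"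
    by simp
  have "drift N p \<gamma> \<delta> (Lo K) \<eta> = drift N p \<gamma> \<delta> A \<eta> - C * drift N p \<gamma> \<delta> (\<lambda>\<eta>. real (particles \<eta> N)) \<eta>"
    unfolding Lo_def[abs_def] drift_diff drift_cmult C_def ..
  also have "\<dots> = c * (\<tau> \<eta> - w N) - c * (1 - w N) * real (\<eta> 1) - \<gamma> * (lam - 1) * S * real (\<eta> 1)
      - \<gamma> * (lam - 1) * Y - C * (- \<gamma> * real (\<eta> 1) + \<delta> * (1 - real (\<eta> N)))"
    unfolding drift_count[OF \<eta>] drift_A[OF \<eta>] Y_def by (simp add: algebra_simps)
  also have "\<dots> \<le> c * (\<tau> \<eta> - w N) - c * (1 - w N) * real (\<eta> 1) - \<gamma> * (lam - 1) * S * real (\<eta> 1)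
      - C * (- \<gamma> * real (\<eta> 1) + \<delta> * (1 - real (\<eta> N)))"
    using Y rates lam_gt_1 by simp
  finally have 2: "drift N p \<gamma> \<delta> (Lo K) \<eta> \<le> c * (\<tau> \<eta> - w N) - c * (1 - w N) * real (\<eta> 1)
      - \<gamma> * (lam - 1) * S * real (\<eta> 1) - C * (- \<gamma> * real (\<eta> 1) + \<delta> * (1 - real (\<eta> N)))" .
  have "drift N p \<gamma> \<delta> (Hi \<gamma> K) \<zeta> + drift N p \<gamma> \<delta> (Lo K) \<eta> \<le> - c * (\<tau> \<zeta> - \<tau> \<eta>) + gain * \<tau> \<zeta> + R
      + (c * (1 - w N) + \<gamma> * ((lam - 1) * S) - C * \<gamma>) * d - C * \<delta> * (real (\<zeta> N) - real (\<eta> N))"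
    using add_mono[OF 1 2] by (simp add: d_def algebra_simps)
  moreover have "C * \<delta> * (real (\<zeta> N) - real (\<eta> N)) \<ge> 0"
    using below_ends[OF below] CK K1 rates by simp
  moreover have "(c * (1 - w N) + \<gamma> * ((lam - 1) * S) - C * \<gamma>) * d \<le> 0"
  proof (rule mult_nonpos_nonneg)
    have "c * (1 - w N) \<le> c * 1" using c_pos w_pos[of N] by (intro mult_left_mono) auto
    moreover have "\<gamma> * ((lam - 1) * S) \<le> \<gamma> * 1" using S_le rates by (intro mult_left_mono) auto
    moreover have "\<gamma> + c \<le> C * \<gamma>"
    proof -
      have "\<gamma> + c \<le> K * ((lam - 1) / lam) * \<gamma>" using K by (simp add: large_def)
      also have "\<dots> \<le> C * 1 * \<gamma>"
        using CK K1 lam_gt_1 rates by (intro mult_mono) auto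
      finally show ?thesis by simp
    qed
    ultimately show "c * (1 - w N) + \<gamma> * ((lam - 1) * S) - C * \<gamma> \<le> 0" by linarith
  qed (rule d)
  moreover have "- c * (\<tau> \<zeta> - \<tau> \<eta>) \<le> - (2 * gain) * \<tau> \<zeta>"
  proof -
    have "\<tau> \<eta> \<le> \<tau> \<zeta> / lam"
      using \<tau>_below[OF below assms(2)] lam_gt_1 by (simp add: field_simps)
    then have "c * (\<tau> \<zeta> - \<tau> \<zeta> / lam) \<le> c * (\<tau> \<zeta> - \<tau> \<eta>)"
      using c_pos by (intro mult_left_mono) auto
    moreover have "c * (\<tau> \<zeta> - \<tau> \<zeta> / lam) = 2 * gain * \<tau> \<zeta>"
      using lam_gt_1 by (simp add: gain_def field_simps)
    ultimately show ?thesis by simp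
  qed
  ultimately show ?thesis unfolding R_def[symmetric] by simp
qed


section \<open>Metastable particle numbers\<close>

definition threshold :: real where "threshold = ((lam - 1) / lam) ^ 2"

text \<open>The order of the rate at which \<open>k\<close> packed particles lose one or, counted if \<open>\<theta> = 1\<close>, gain one.\<close>

abbreviation leak :: "real \<Rightarrow> nat \<Rightarrow> real" where
  "leak \<theta> k \<equiv> w N * lam ^ k + \<theta> * (w N * lam ^ (N - k))"

text \<open>The function is 0 as soon as an exit is possible, since \<open>A \<eta> \<ge> threshold\<close> whenever site 1 is
occupied; likewise for entries if \<open>\<theta> = 1\<close>. If there are no entries, \<open>\<theta> = 0\<close> is taken.\<close>

definition test :: "real \<Rightarrow> nat \<Rightarrow> config \<Rightarrow> real" where
  "test \<theta> k \<eta> =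
    (if particles \<eta> N = k then max 0 (1 - (A \<eta> + \<theta> * A (mirror N \<eta>)) / threshold) else 0)"

definition packed :: "nat \<Rightarrow> config" where
  "packed k = (\<lambda>x. if x \<in> {1..N} then if N - k < x then 1 else 0 else undefined)"

lemma threshold_pos: "threshold > 0"
  using lam_gt_1 by (simp add: threshold_def)

lemma A_ge_threshold:
  assumes "\<eta> \<in> configs N" "\<eta> 1 = 1"
  shows "A \<eta> \<ge> threshold"
proof -
  have "w N \<le> w 2" using w_antimono N_ge by blast
  then have "1 / lam - 1 / lam ^ 2 \<le> w 1 - w N" by (simp add: w_def power_divide)
  moreover have "1 / lam - 1 / lam ^ 2 = (lam - 1) / lam ^ 2"
    using lam_gt_1 by (simp add: field_simps power2_eq_square)
  ultimately have "(lam - 1) / lam ^ 2 * (lam - 1) \<le> (w 1 - w N) * (lam - 1)"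
    using lam_gt_1 by (intro mult_right_mono) auto
  also have "(w 1 - w N) * (lam - 1) = (w 1 - w N) * (Z \<eta> 1 - 1)"
    using Z_1[OF assms(1)] assms(2) by simp
  also have "\<dots> \<le> A \<eta>"
    unfolding A_def using N_ge Z_ge_1
    by (intro member_le_sum[of 1 _ "\<lambda>x. (w x - w N) * (Z \<eta> x - 1)"] mult_nonneg_nonneg weight_nonneg) auto
  finally show ?thesis by (simp add: threshold_def power_divide power2_eq_square)
qed

lemma test_nonneg: "test \<theta> k \<eta> \<ge> 0"
  by (simp add: test_def)

lemma test_le_1: "\<theta> \<ge> 0 \<Longrightarrow> test \<theta> k \<eta> \<le> 1"
  using A_nonneg threshold_pos by (simp add: test_def)

lemma test_sum_le_1: "\<theta> \<ge> 0 \<Longrightarrow> k \<noteq> l \<Longrightarrow> test \<theta> k \<eta> + test \<theta> l \<eta> \<le> 1"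
  using test_le_1[of \<theta> k \<eta>] test_le_1[of \<theta> l \<eta>] by (auto simp: test_def)

lemma drift_test:
  assumes \<eta>: "\<eta> \<in> configs N" and rates: "\<gamma> \<ge> 0" "\<delta> \<ge> 0" and \<theta>: "\<theta> \<ge> 0" "\<delta> = 0 \<or> \<theta> = 1"
    and k: "k \<le> N"
  shows "drift N p \<gamma> \<delta> (test \<theta> k) \<eta> \<ge> - (c / threshold * leak \<theta> k)"
proof (cases "test \<theta> k \<eta> > 0")
  case False
  then have "test \<theta> k \<eta> = 0" using test_nonneg[of \<theta> k \<eta>] by simp
  then have "drift N p \<gamma> \<delta> (test \<theta> k) \<eta> \<ge> 0"
    unfolding drift_def bulk_drift_def bond_drift_def using rates test_nonneg p_gt p_less
    by (intro add_nonneg_nonneg sum_nonneg mult_nonneg_nonneg) auto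
  moreover have "c / threshold * leak \<theta> k \<ge> 0"
    using c_pos threshold_pos w_pos[of N] lam_gt_1 \<theta> by (intro mult_nonneg_nonneg add_nonneg_nonneg) auto
  ultimately show ?thesis by linarith
next
  case True
  define B where "B \<eta> = (A \<eta> + \<theta> * A (mirror N \<eta>)) / threshold" for \<eta>
  have m\<eta>: "mirror N \<eta> \<in> configs N" by (rule mirror_configs[OF \<eta>])
  have m1: "mirror N \<eta> 1 = 1 - \<eta> N" using N1 by (simp add: mirror_def)
  have cnt: "particles \<eta> N = k" and B: "B \<eta> < 1" and tB: "test \<theta> k \<eta> = 1 - B \<eta>"
    using True by (auto simp: test_def B_def split: if_splits)
  have small: "A \<eta> + \<theta> * A (mirror N \<eta>) < threshold"
    using B threshold_pos by (simp add: B_def)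
  have "A \<eta> < threshold" using small \<theta> A_nonneg[of "mirror N \<eta>"] by (smt (verit) mult_nonneg_nonneg)
  then have "\<eta> 1 = 0" using A_ge_threshold[OF \<eta>] config_values[OF \<eta>, of 1] N1 by force
  then have exit: "exit_left \<eta> = \<eta>" by (rule exit_left_idle)
  have enter: "\<delta> * (test \<theta> k (enter_right N \<eta>) - test \<theta> k \<eta>) = 0"
  proof (cases "\<delta> = 0")
    case False
    then have "A (mirror N \<eta>) < threshold" using \<theta> small A_nonneg[of \<eta>] by simp
    then have "mirror N \<eta> 1 \<noteq> 1" using A_ge_threshold[OF m\<eta>] by force
    then have "\<eta> N = 1" using m1 config_values[OF \<eta>, of N] N1 by auto
    then show ?thesis by (simp add: enter_right_idle)
  qed simp
  have bulk_mirror: "bulk_drift N p (\<lambda>\<eta>. A (mirror N \<eta>)) \<eta> = bulk_drift N p A (mirror N \<eta>)"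
    using drift_mirror[OF \<eta> N1, of p 0 0 A] by (simp add: drift_def)
  have "bulk_drift N p B \<eta> = (bulk_drift N p A \<eta> + \<theta> * bulk_drift N p A (mirror N \<eta>)) / threshold"
  proof -
    have "bulk_drift N p B \<eta> = drift N p 0 0 (\<lambda>\<eta>. (1 / threshold) * (A \<eta> + \<theta> * A (mirror N \<eta>))) \<eta>"
      by (simp add: drift_def B_def[abs_def])
    also have "\<dots> = (1 / threshold) * (drift N p 0 0 A \<eta> + \<theta> * drift N p 0 0 (\<lambda>\<eta>. A (mirror N \<eta>)) \<eta>)"
      by (simp only: drift_cmult drift_add)
    finally show ?thesis by (simp add: drift_def bulk_mirror)
  qed
  also have "\<dots> \<le> (c * (w N * lam ^ k) + \<theta> * (c * (w N * lam ^ (N - k)))) / threshold"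
  proof -
    have le: "bulk_drift N p A \<zeta> \<le> c * (w N * lam ^ particles \<zeta> N)" if \<zeta>: "\<zeta> \<in> configs N" for \<zeta>
    proof -
      have "c * (1 - w N) * real (\<zeta> 1) \<ge> 0" "c * w N \<ge> 0"
        using c_pos w_antimono[of 0 N] w_pos[of N] by simp_all
      then show ?thesis unfolding bulk_drift_A[OF \<zeta>] by (simp add: right_diff_distrib)
    qed
    have "\<theta> * bulk_drift N p A (mirror N \<eta>) \<le> \<theta> * (c * (w N * lam ^ (N - k)))"
      using le[OF m\<eta>] \<theta> unfolding particles_mirror[OF \<eta>] cnt by (intro mult_left_mono) auto
    then show ?thesis using le[OF \<eta>] threshold_pos unfolding cnt by (intro divide_right_mono add_mono) auto
  qed
  also have "\<dots> = c / threshold * leak \<theta> k"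
    by (simp add: field_simps)
  finally have bulk_B: "bulk_drift N p B \<eta> \<le> c / threshold * leak \<theta> k" .
  have "- bulk_drift N p B \<eta> \<le> bulk_drift N p (test \<theta> k) \<eta>"
    unfolding bulk_drift_def sum_negf[symmetric]
  proof (rule sum_mono)
    fix x assume x: "x \<in> {1..<N}"
    have "particles (jump_right x \<eta>) N = k" "particles (jump_left x \<eta>) N = k"
      using x cnt by (auto simp: particles_jump_right particles_jump_left)
    then have "- (B (jump_right x \<eta>) - B \<eta>) \<le> test \<theta> k (jump_right x \<eta>) - test \<theta> k \<eta>"
      "- (B (jump_left x \<eta>) - B \<eta>) \<le> test \<theta> k (jump_left x \<eta>) - test \<theta> k \<eta>"
      unfolding tB by (auto simp: test_def B_def)
    then have "p * - (B (jump_right x \<eta>) - B \<eta>) + (1 - p) * - (B (jump_left x \<eta>) - B \<eta>)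
        \<le> bond_drift p x (test \<theta> k) \<eta>"
      unfolding bond_drift_def using p_gt p_less by (intro add_mono mult_left_mono) auto
    then show "- bond_drift p x B \<eta> \<le> bond_drift p x (test \<theta> k) \<eta>"
      by (simp add: bond_drift_def algebra_simps)
  qed
  then show ?thesis
    using bulk_B by (simp only: drift_def exit enter diff_self mult_zero_right add_0_right)
qed

lemma packed_configs: "packed k \<in> configs N"
  by (rule configsI) (auto simp: packed_def)

lemma particles_packed: "x \<le> N \<Longrightarrow> particles (packed k) x = x - (N - k)"
proof (induction x)
  case (Suc x)
  then show ?case by (auto simp: particles_Suc packed_def)
qed simp

lemma mirror_packed: "k \<le> N \<Longrightarrow> mirror N (packed k) = packed (N - k)"
proof (rule configs_eqI[of _ N])
  show "mirror N (packed k) \<in> configs N" "packed (N - k) \<in> configs N"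
    by (intro mirror_configs packed_configs)+
qed (auto simp: mirror_def packed_def)

lemma A_packed:
  assumes "k \<le> N"
  shows "A (packed k) \<le> real N * (w N * lam ^ k)"
proof -
  have pos: "w N * lam ^ k > 0" using w_pos[of N] lam_gt_1 by simp
  have "(w x - w N) * (Z (packed k) x - 1) \<le> w N * lam ^ k" if x: "x \<in> {1..<N}" for x
  proof (cases "x \<le> N - k")
    case True
    then show ?thesis using x pos by (simp add: Z_def particles_packed)
  next
    case False
    have "(w x - w N) * (Z (packed k) x - 1) \<le> w x * Z (packed k) x"
      using w_pos[of N] w_pos[of x] Z_ge_1[of "packed k" x] x w_antimono[of x N]
      by (intro mult_mono) auto
    also have "\<dots> = w N * lam ^ k"
    proof -
      have "lam ^ (x - (N - k)) * lam ^ (N - k) = lam ^ x" "lam ^ k * lam ^ (N - k) = lam ^ N"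
        using False assms by (simp_all flip: power_add)
      then have "(w x * Z (packed k) x) * lam ^ (N - k) = (w N * lam ^ k) * lam ^ (N - k)"
        using x w_lam_power[of x] w_lam_power[of N] by (simp add: Z_def particles_packed mult.assoc)
      then show ?thesis using lam_gt_1 by simp
    qed
    finally show ?thesis .
  qed
  then have "A (packed k) \<le> real (card {1..<N}) * (w N * lam ^ k)"
    unfolding A_def by (intro sum_bounded_above)
  also have "\<dots> \<le> real N * (w N * lam ^ k)"
    using pos by (intro mult_right_mono) auto
  finally show ?thesis .
qed

lemma test_packed:
  assumes "k \<le> N" "\<theta> \<ge> 0"
  shows "test \<theta> k (packed k) \<ge> 1 - real N / threshold * leak \<theta> k"
proof -
  have "A (packed k) + \<theta> * A (packed (N - k))
      \<le> real N * (w N * lam ^ k) + \<theta> * (real N * (w N * lam ^ (N - k)))"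
    using A_packed[of k] A_packed[of "N - k"] assms by (intro add_mono mult_left_mono) auto
  then have "(A (packed k) + \<theta> * A (packed (N - k))) / threshold
      \<le> (real N * (w N * lam ^ k) + \<theta> * (real N * (w N * lam ^ (N - k)))) / threshold"
    using threshold_pos by (intro divide_right_mono) auto
  also have "\<dots> = real N / threshold * leak \<theta> k"
    by (simp add: field_simps)
  finally show ?thesis using assms by (simp add: test_def particles_packed mirror_packed)
qed

section \<open>Mixing time bounds\<close>

subsection \<open>Two open ends\<close>

text \<open>The assumption \<open>small\<close> says that the errors, of order \<open>w N\<close> times a polynomial, are below half of the
gain, of order \<open>sqrt (w N)\<close>; it holds for all large \<open>N\<close>.\<close>

theorem two_sided_bounds:
  assumes rates: "\<gamma> > 0" "\<delta> > 0" and K: "large \<gamma> \<delta> K" "large \<delta> \<gamma> K" and \<epsilon>: "\<epsilon> > 0"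
    and small: "K ^ 3 * real N ^ 3 * sqrt (w N) * (c * (1 + K ^ 2 * real N)) \<le> gain / 2"
  shows "(1 / 2 - 2 * lam * real N / threshold * sqrt (w N) - \<epsilon>) / (2 * lam * c / threshold * sqrt (w N))
      \<le> mixing_time N p 0 0 \<gamma> \<delta> \<epsilon>
    \<and> mixing_time N p 0 0 \<gamma> \<delta> \<epsilon> \<le> (2 * (12 * K ^ 5 * real N ^ 5) + 1) / (gain * sqrt (w N) * \<epsilon>)"
proof -
  define \<sigma> where "\<sigma> = sqrt (w N)"
  have \<sigma>: "\<sigma> > 0" "\<sigma> ^ 2 = w N" using w_pos[of N] by (simp_all add: \<sigma>_def)
  define n where "n = real N"
  have n: "n \<ge> 1" using N1 by (simp add: n_def)
  have K1: "K \<ge> 1" using K by (simp add: large_def)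
  define k where "k = N div 2"
  have exps: "w N * lam ^ i \<le> lam * \<sigma>" if "2 * i \<le> N + 2" for i
  proof -
    have "lam ^ (2 * i) \<le> lam ^ (N + 2)" using that lam_gt_1 by (intro power_increasing) auto
    moreover have "lam ^ (2 * i) = (lam ^ i) ^ 2" by (rule power_even_eq)
    moreover have "lam ^ (N + 2) = lam ^ N * lam ^ 2" by (rule power_add)
    ultimately have "(lam ^ i) ^ 2 \<le> lam ^ N * lam ^ 2" by (simp only:)
    then have "w N ^ 2 * (lam ^ i) ^ 2 \<le> w N ^ 2 * (lam ^ N * lam ^ 2)"
      by (rule mult_left_mono) simp
    also have "\<dots> = (w N * lam ^ N) * (w N * lam ^ 2)" by (simp only: power2_eq_square mult_ac)
    also have "\<dots> = (lam * \<sigma>) ^ 2" unfolding w_lam_power power_mult_distrib \<sigma>(2) by simp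
    finally show ?thesis
      using \<sigma>(1) lam_gt_1 by - (rule power2_le_imp_le, simp_all add: power_mult_distrib)
  qed
  have k_exps: "leak 1 i \<le> 2 * lam * \<sigma>" if "i = k \<or> i = Suc k" for i
  proof -
    have "2 * i \<le> N + 2" "2 * (N - i) \<le> N + 2" using that unfolding k_def by presburger+
    then show ?thesis using exps[of i] exps[of "N - i"] by linarith
  qed
  have kN: "Suc k \<le> N" using N_ge by (simp add: k_def)
  show ?thesis
    unfolding \<sigma>_def[symmetric] n_def[symmetric]
  proof (rule mixing_time_bounds[where D = "below N" and b = "full N"
        and F = "\<lambda>\<eta>. Lo K \<eta> + Hi \<delta> K (mirror N \<eta>)" and G = "\<lambda>\<zeta>. Hi \<gamma> K \<zeta> + Lo K (mirror N \<zeta>)"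
        and ?u1.0 = "test 1 k" and ?u2.0 = "test 1 (Suc k)" and ?\<eta>1.0 = "packed k" and ?\<eta>2.0 = "packed (Suc k)"])
    have pack: "test 1 i (packed i) \<ge> 1 - 2 * lam * n / threshold * \<sigma>" if "i = k \<or> i = Suc k" for i
    proof -
      have "i \<le> N" using that kN by auto
      then have "test 1 i (packed i) \<ge> 1 - n / threshold * leak 1 i"
        unfolding n_def by (rule test_packed) simp
      moreover have "n / threshold * leak 1 i \<le> n / threshold * (2 * lam * \<sigma>)"
        using n threshold_pos by (intro mult_left_mono k_exps that) auto
      ultimately show ?thesis by (simp add: mult_ac)
    qed
    show "1 - 2 * lam * n / threshold * \<sigma> \<le> test 1 k (packed k)"
      "1 - 2 * lam * n / threshold * \<sigma> \<le> test 1 (Suc k) (packed (Suc k))" by (intro pack; simp)+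
    have low: "- (2 * lam * c / threshold * \<sigma>) \<le> drift N p \<gamma> \<delta> (test 1 i) \<eta>" if "i = k \<or> i = Suc k" "\<eta> \<in> configs N" for i \<eta>
    proof -
      have "drift N p \<gamma> \<delta> (test 1 i) \<eta> \<ge> - (c / threshold * leak 1 i)"
        using that kN rates by (intro drift_test) auto
      moreover have "c / threshold * leak 1 i \<le> c / threshold * (2 * lam * \<sigma>)"
        using c_pos threshold_pos by (intro mult_left_mono k_exps that) auto
      ultimately show ?thesis by (simp add: mult_ac)
    qed
    show "- (2 * lam * c / threshold * \<sigma>) \<le> drift N p \<gamma> \<delta> (test 1 k) \<eta>"
      "- (2 * lam * c / threshold * \<sigma>) \<le> drift N p \<gamma> \<delta> (test 1 (Suc k)) \<eta>" if "\<eta> \<in> configs N" for \<eta>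
      using that by (intro low; simp)+
    show "2 * lam * c / threshold * \<sigma> > 0" "gain * \<sigma> > 0"
      using lam_gt_1 c_pos threshold_pos gain_pos \<sigma> by (auto intro!: mult_pos_pos divide_pos_pos)
    show "0 \<le> test 1 k \<eta> \<and> 0 \<le> test 1 (Suc k) \<eta> \<and> test 1 k \<eta> + test 1 (Suc k) \<eta> \<le> 1" for \<eta>
      by (simp add: test_nonneg test_sum_le_1)
    show "below N \<subseteq> configs N \<times> configs N" by (auto simp: below_def)
    fix \<eta> \<zeta> assume below: "(\<eta>, \<zeta>) \<in> below N"
    then have \<eta>: "\<eta> \<in> configs N" and \<zeta>: "\<zeta> \<in> configs N" by (auto simp: below_def)
    have m\<eta>: "mirror N \<eta> \<in> configs N" and m\<zeta>: "mirror N \<zeta> \<in> configs N"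
      using \<eta> \<zeta> by (auto intro: mirror_configs)
    show "(apply_move N i \<eta>, apply_move N i \<zeta>) \<in> below N" if "i \<in> moves N" for i
      using apply_move_below[OF that below N1] .
    show "0 \<le> Lo K \<eta> + Hi \<delta> K (mirror N \<eta>) + (Hi \<gamma> K \<zeta> + Lo K (mirror N \<zeta>))"
    proof (cases "\<eta> = \<zeta>")
      case True
      then show ?thesis
        using E_bounds(1)[OF m\<eta> rates(2) K(2)] E_bounds(1)[OF \<zeta> rates(1) K(1)]
        by (simp add: Lo_def Hi_def)
    next
      case False
      define a where "a = real (particles \<zeta> N) - real (particles \<eta> N)"
      have a: "a \<ge> 1" using particles_below_less[OF below False] by (simp add: a_def)
      have "real (particles (mirror N \<eta>) N) - real (particles (mirror N \<zeta>) N) = a"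
        using particles_le[OF \<eta>, of N] particles_le[OF \<zeta>, of N]
        by (simp add: particles_mirror[OF \<eta>] particles_mirror[OF \<zeta>] a_def of_nat_diff)
      then have "Lo K \<eta> + Hi \<delta> K (mirror N \<eta>) + (Hi \<gamma> K \<zeta> + Lo K (mirror N \<zeta>))
          = 2 * (K * n * a) + A \<eta> - A (mirror N \<eta>) - A \<zeta> + A (mirror N \<zeta>)
            + E \<delta> K (mirror N \<eta>) + E \<gamma> K \<zeta>"
        unfolding Lo_def Hi_def a_def n_def by (simp add: algebra_simps) (simp flip: distrib_left right_diff_distrib)?
      moreover have "n \<le> K * n * a"
      proof -
        have "1 * n * 1 \<le> K * n * a" using K1 n a by (intro mult_mono) auto
        then show ?thesis by simp
      qed
      ultimately show ?thesis
        using A_nonneg[of \<eta>] A_nonneg[of "mirror N \<zeta>"] A_le[OF m\<eta>] A_le[OF \<zeta>]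
          E_bounds(1)[OF m\<eta> rates(2) K(2)] E_bounds(1)[OF \<zeta> rates(1) K(1)]
        unfolding n_def[symmetric] by linarith
    qed
    assume "\<eta> \<noteq> \<zeta>"
    then have "mirror N \<zeta> \<noteq> mirror N \<eta>" using mirror_mirror[OF \<eta>] mirror_mirror[OF \<zeta>] by metis
    define R where "R = K ^ 3 * real N ^ 3 * w N * (c * (1 + K ^ 2 * real N))"
    have "drift N p \<gamma> \<delta> (\<lambda>\<eta>. Lo K \<eta> + Hi \<delta> K (mirror N \<eta>)) \<eta>
        + drift N p \<gamma> \<delta> (\<lambda>\<zeta>. Hi \<gamma> K \<zeta> + Lo K (mirror N \<zeta>)) \<zeta>
        = (drift N p \<gamma> \<delta> (Hi \<gamma> K) \<zeta> + drift N p \<gamma> \<delta> (Lo K) \<eta>)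
        + (drift N p \<delta> \<gamma> (Hi \<delta> K) (mirror N \<eta>) + drift N p \<delta> \<gamma> (Lo K) (mirror N \<zeta>))"
      by (simp only: drift_add drift_mirror[OF \<eta> N1] drift_mirror[OF \<zeta> N1] add_ac)
    also have "\<dots> \<le> (- gain * \<tau> \<zeta> + R) + (- gain * \<tau> (mirror N \<eta>) + R)"
      unfolding R_def using below mirror_below[OF below] \<open>\<eta> \<noteq> \<zeta>\<close> \<open>mirror N \<zeta> \<noteq> mirror N \<eta>\<close> rates K
      by (intro add_mono pair_drift) auto
    also have "\<dots> \<le> - (gain * \<sigma>)"
    proof -
      have "\<tau> \<eta> \<le> \<tau> \<zeta>"
        using \<tau>_below[OF below \<open>\<eta> \<noteq> \<zeta>\<close>] lam_gt_1 \<tau>_pos[of \<eta>]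
        by (smt (verit) mult_le_cancel_right1)
      then have "w N \<le> \<tau> \<zeta> * \<tau> (mirror N \<eta>)"
        unfolding \<tau>_mirror[OF \<eta>, symmetric] using \<tau>_pos[of "mirror N \<eta>"] by (intro mult_right_mono) auto
      \<comment> \<open>The gains of particles and holes have product at least \<open>w N\<close>, whatever the densities are.\<close>
      then have "\<sigma> \<le> sqrt (\<tau> \<zeta> * \<tau> (mirror N \<eta>))" unfolding \<sigma>_def by simp
      also have "\<dots> \<le> (\<tau> \<zeta> + \<tau> (mirror N \<eta>)) / 2"
        using \<tau>_pos by (intro arith_geo_mean_sqrt) (auto intro: less_imp_le)
      finally have "gain * (2 * \<sigma>) \<le> gain * (\<tau> \<zeta> + \<tau> (mirror N \<eta>))"
        using gain_pos by (intro mult_left_mono) auto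
      moreover have "R \<le> gain / 2 * \<sigma>"
      proof -
        have "R = K ^ 3 * real N ^ 3 * \<sigma> * (c * (1 + K ^ 2 * real N)) * \<sigma>"
          unfolding R_def \<sigma>(2)[symmetric] by (simp add: power2_eq_square mult_ac)
        also have "\<dots> \<le> gain / 2 * \<sigma>"
          using small \<sigma> by (intro mult_right_mono) (auto simp: \<sigma>_def)
        finally show ?thesis .
      qed
      ultimately show ?thesis by (simp add: algebra_simps)
    qed
    finally show "drift N p \<gamma> \<delta> (\<lambda>\<eta>. Lo K \<eta> + Hi \<delta> K (mirror N \<eta>)) \<eta>
        + drift N p \<gamma> \<delta> (\<lambda>\<zeta>. Hi \<gamma> K \<zeta> + Lo K (mirror N \<zeta>)) \<zeta> \<le> - (gain * \<sigma>)" .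
  next
    fix \<eta> assume \<eta>: "\<eta> \<in> configs N"
    have Lo: "Lo K \<zeta> \<le> K ^ 5 * n ^ 5" if \<zeta>: "\<zeta> \<in> configs N" for \<zeta>
    proof -
      have "K * n * real (particles \<zeta> N) \<ge> 0" using K1 n by simp
      then have "Lo K \<zeta> \<le> n" using A_le[OF \<zeta>] unfolding Lo_def n_def by linarith
      also have "n = 1 * n ^ 1" by simp
      also have "\<dots> \<le> K ^ 5 * n ^ 5" using K1 n by (intro mult_mono power_increasing) auto
      finally show ?thesis .
    qed
    have Hi: "Hi g K \<zeta> \<le> 5 * (K ^ 5 * n ^ 5)" if \<zeta>: "\<zeta> \<in> configs N" and "g > 0" "large g d K" for \<zeta> g d
    proof -
      have "K * n * real (particles \<zeta> N) \<le> K * n * n"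
        using particles_le[OF \<zeta>, of N] K1 n by (intro mult_left_mono) (auto simp: n_def)
      also have "\<dots> = K ^ 1 * n ^ 2" by (simp add: power2_eq_square)
      also have "\<dots> \<le> K ^ 5 * n ^ 5" using K1 n by (intro mult_mono power_increasing) auto
      finally have "K * n * real (particles \<zeta> N) \<le> K ^ 5 * n ^ 5" .
      then show ?thesis
        using A_nonneg[of \<zeta>] E_bounds(2)[OF \<zeta> that(2,3)] unfolding Hi_def n_def[symmetric] by linarith
    qed
    show "Lo K \<eta> + Hi \<delta> K (mirror N \<eta>) + (Hi \<gamma> K (full N) + Lo K (mirror N (full N))) \<le> 12 * K ^ 5 * n ^ 5"
      using Lo[OF \<eta>] Lo[OF mirror_configs[OF full_configs]] Hi[OF mirror_configs[OF \<eta>] rates(2) K(2)]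
        Hi[OF full_configs rates(1) K(1)] by linarith
  qed (use N_ge p_gt p_less rates \<epsilon> packed_configs full_configs below_full in auto)
qed

subsection \<open>One open end\<close>

definition vacant :: config where
  "vacant = packed 0"

lemma one_sided_drift:
  assumes \<eta>: "\<eta> \<in> configs N" "\<eta> \<noteq> vacant" and \<gamma>: "\<gamma> > 0" and C: "C * \<gamma> \<ge> c + \<gamma> + \<gamma> * (lam - 1) * real N"
  shows "drift N p \<gamma> 0 (\<lambda>\<eta>. C * real (particles \<eta> N) - A \<eta>) \<eta> \<le> - (c * (lam - 1) * w N)"
proof -
  have "\<exists>x\<in>{1..N}. \<eta> x \<noteq> 0"
    using \<eta> configs_eqI[OF \<eta>(1) packed_configs[of 0]] by (fastforce simp: vacant_def packed_def)
  then have "particles \<eta> N \<ge> 1"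
    unfolding particles_def by (metis One_nat_def Suc_leI finite_atLeastAtMost not_gr_zero sum_eq_0_iff)
  then have "lam ^ 1 \<le> lam ^ particles \<eta> N" using lam_gt_1 by (intro power_increasing) auto
  then have "c * (w N * (lam - 1)) \<le> c * (\<tau> \<eta> - w N)"
    using c_pos w_pos[of N] by (intro mult_left_mono) (auto simp: \<tau>_def algebra_simps)
  moreover have "c * (1 - w N) * real (\<eta> 1) + \<gamma> * (real (\<eta> 1) * ((lam - 1) * (S + A (exit_left \<eta>))))
      - C * \<gamma> * real (\<eta> 1) \<le> 0"
  proof -
    have "c * (1 - w N) \<le> c * 1" using c_pos w_pos[of N] by (intro mult_left_mono) auto
    moreover have "\<gamma> * ((lam - 1) * S) \<le> \<gamma> * 1" using S_le \<gamma> by (intro mult_left_mono) auto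
    moreover have "\<gamma> * (lam - 1) * A (exit_left \<eta>) \<le> \<gamma> * (lam - 1) * real N"
      using A_le[OF exit_left_configs[OF \<eta>(1) N1]] \<gamma> lam_gt_1 by (intro mult_left_mono) auto
    ultimately have "c * (1 - w N) + \<gamma> * ((lam - 1) * (S + A (exit_left \<eta>))) - C * \<gamma> \<le> 0"
      using C by (simp add: algebra_simps)
    then have "(c * (1 - w N) + \<gamma> * ((lam - 1) * (S + A (exit_left \<eta>))) - C * \<gamma>) * real (\<eta> 1) \<le> 0"
      by (intro mult_nonpos_nonneg) auto
    then show ?thesis by (simp add: algebra_simps)
  qed
  ultimately show ?thesis
    unfolding drift_diff drift_cmult drift_count[OF \<eta>(1)] drift_A[OF \<eta>(1)] by (simp add: algebra_simps)
qed

text \<open>Both one-sided cases at once: \<open>\<Psi>\<close> is the identity or \<open>mirror N\<close>. The second copy starts in the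
  absorbing state and stays there, so \<open>C * k - A\<close> at \<open>\<Psi>\<close> of the first copy serves as the pair function.\<close>

lemma one_sided_bounds_aux:
  assumes \<gamma>: "\<gamma> > 0" and K: "K \<ge> 1" "K * \<gamma> \<ge> c + \<gamma> + \<gamma> * (lam - 1)" and \<epsilon>: "\<epsilon> > 0"
    and rates: "g \<ge> 0" "d \<ge> 0"
    and \<Psi>: "\<And>\<eta>. \<eta> \<in> configs N \<Longrightarrow> \<Psi> \<eta> \<in> configs N" "\<And>\<eta>. \<eta> \<in> configs N \<Longrightarrow> \<Psi> (\<Psi> \<eta>) = \<eta>"
    and conj: "\<And>f \<eta>. \<eta> \<in> configs N \<Longrightarrow> drift N p g d (\<lambda>\<eta>. f (\<Psi> \<eta>)) \<eta> = drift N p \<gamma> 0 f (\<Psi> \<eta>)"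
    and fixed: "\<And>i. i \<in> moves N \<Longrightarrow> move_rate p g d i \<noteq> 0 \<Longrightarrow> apply_move N i (\<Psi> vacant) = \<Psi> vacant"
  shows "(1 / 2 - lam * real N / threshold * w N - \<epsilon>) / (lam * c / threshold * w N)
      \<le> mixing_time N p 0 0 g d \<epsilon>
    \<and> mixing_time N p 0 0 g d \<epsilon> \<le> (2 * (K * real N ^ 2) + 1) / (c * (lam - 1) * w N * \<epsilon>)"
proof -
  define C where "C = K * real N"
  have C: "C * \<gamma> \<ge> c + \<gamma> + \<gamma> * (lam - 1) * real N" "C \<ge> real N"
  proof -
    have "(c + \<gamma>) * 1 \<le> (c + \<gamma>) * real N" using c_pos \<gamma> N1 by (intro mult_left_mono) auto
    moreover have "(c + \<gamma> + \<gamma> * (lam - 1)) * real N \<le> K * \<gamma> * real N"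
      using K by (intro mult_right_mono) auto
    ultimately show "C * \<gamma> \<ge> c + \<gamma> + \<gamma> * (lam - 1) * real N" by (simp add: C_def algebra_simps)
    show "C \<ge> real N" using K by (simp add: C_def mult_le_cancel_right1)
  qed
  define V where "V \<eta> = C * real (particles \<eta> N) - A \<eta>" for \<eta>
  have V: "0 \<le> V \<eta>" "V \<eta> \<le> K * real N ^ 2" if \<eta>: "\<eta> \<in> configs N" for \<eta>
  proof -
    show "0 \<le> V \<eta>"
    proof (cases "particles \<eta> N")
      case 0
      have "Z \<eta> x = 1" if "x \<le> N" for x
        using particles_mono[OF that, of \<eta>] 0 by (simp add: Z_def)
      then have "A \<eta> = 0" unfolding A_def by (intro sum.neutral) auto
      then show ?thesis using 0 by (simp add: V_def)
    next
      case (Suc j)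
      then have "C * 1 \<le> C * real (particles \<eta> N)" using C(2) by (intro mult_left_mono) auto
      then show ?thesis using A_le[OF \<eta>] C(2) by (simp add: V_def)
    qed
    have "C * real (particles \<eta> N) \<le> C * real N"
      using particles_le[OF \<eta>, of N] C(2) by (intro mult_left_mono) auto
    then show "V \<eta> \<le> K * real N ^ 2"
      using A_nonneg[of \<eta>] by (simp add: V_def C_def power2_eq_square)
  qed
  have vac: "vacant \<in> configs N" by (simp add: vacant_def packed_configs)
  define D where "D = (\<lambda>\<eta>. (\<eta>, \<Psi> vacant)) ` configs N"
  show ?thesis
  proof (rule mixing_time_bounds[where D = D and b = "\<Psi> vacant"
        and F = "\<lambda>\<eta>. V (\<Psi> \<eta>)" and G = "\<lambda>\<zeta>. 0"
        and ?u1.0 = "\<lambda>\<eta>. test 0 0 (\<Psi> \<eta>)" and ?u2.0 = "\<lambda>\<eta>. test 0 1 (\<Psi> \<eta>)"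
        and ?\<eta>1.0 = "\<Psi> (packed 0)" and ?\<eta>2.0 = "\<Psi> (packed 1)"])
    have k_exps: "leak 0 i \<le> lam * w N" if "i \<le> 1" for i
    proof -
      have "lam ^ i \<le> lam ^ 1" using that lam_gt_1 by (intro power_increasing) auto
      then show ?thesis using w_pos[of N] by (simp add: mult.commute)
    qed
    have pack: "test 0 i (\<Psi> (\<Psi> (packed i))) \<ge> 1 - lam * real N / threshold * w N" if "i \<le> 1" for i
    proof -
      have "i \<le> N" using that N1 by auto
      then have "test 0 i (packed i) \<ge> 1 - real N / threshold * leak 0 i"
        by (rule test_packed) simp
      moreover have "real N / threshold * leak 0 i \<le> real N / threshold * (lam * w N)"
        using threshold_pos by (intro mult_left_mono k_exps that) auto
      ultimately show ?thesis by (simp add: \<Psi>(2)[OF packed_configs] mult_ac)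
    qed
    show "1 - lam * real N / threshold * w N \<le> test 0 0 (\<Psi> (\<Psi> (packed 0)))"
      "1 - lam * real N / threshold * w N \<le> test 0 1 (\<Psi> (\<Psi> (packed 1)))" by (intro pack; simp)+
    have low: "- (lam * c / threshold * w N) \<le> drift N p g d (\<lambda>\<eta>. test 0 i (\<Psi> \<eta>)) \<eta>" if "i \<le> 1" "\<eta> \<in> configs N" for i \<eta>
    proof -
      have "drift N p \<gamma> 0 (test 0 i) (\<Psi> \<eta>) \<ge> - (c / threshold * leak 0 i)"
        using that N1 \<gamma> \<Psi>(1) by (intro drift_test) auto
      moreover have "c / threshold * leak 0 i \<le> c / threshold * (lam * w N)"
        using c_pos threshold_pos by (intro mult_left_mono k_exps that) auto
      ultimately show ?thesis unfolding conj[OF that(2)] by (simp add: mult_ac)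
    qed
    show "- (lam * c / threshold * w N) \<le> drift N p g d (\<lambda>\<eta>. test 0 0 (\<Psi> \<eta>)) \<eta>"
      "- (lam * c / threshold * w N) \<le> drift N p g d (\<lambda>\<eta>. test 0 1 (\<Psi> \<eta>)) \<eta>" if "\<eta> \<in> configs N" for \<eta>
      using that by (intro low; simp)+
    show "lam * c / threshold * w N > 0" "c * (lam - 1) * w N > 0"
      using lam_gt_1 c_pos threshold_pos w_pos[of N] by (auto intro!: mult_pos_pos divide_pos_pos)
    show "0 \<le> test 0 0 (\<Psi> \<eta>) \<and> 0 \<le> test 0 1 (\<Psi> \<eta>) \<and> test 0 0 (\<Psi> \<eta>) + test 0 1 (\<Psi> \<eta>) \<le> 1" for \<eta>
      by (simp add: test_nonneg test_sum_le_1)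
    show "D \<subseteq> configs N \<times> configs N" using vac \<Psi> by (auto simp: D_def)
    show "(apply_move N i \<eta>, apply_move N i \<zeta>) \<in> D"
      if "i \<in> moves N" "move_rate p g d i \<noteq> 0" "(\<eta>, \<zeta>) \<in> D" for i \<eta> \<zeta>
      using that fixed[OF that(1,2)] apply_move_configs[OF that(1) _ N1] by (auto simp: D_def)
    show "drift N p g d (\<lambda>\<eta>. V (\<Psi> \<eta>)) \<eta> + drift N p g d (\<lambda>\<zeta>. 0) \<zeta> \<le> - (c * (lam - 1) * w N)"
      if "(\<eta>, \<zeta>) \<in> D" "\<eta> \<noteq> \<zeta>" for \<eta> \<zeta>
    proof -
      have \<eta>: "\<eta> \<in> configs N" "\<zeta> = \<Psi> vacant" using that by (auto simp: D_def)
      then have "\<Psi> \<eta> \<noteq> vacant" using that(2) \<Psi>(2) by metis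
      then have "drift N p \<gamma> 0 V (\<Psi> \<eta>) \<le> - (c * (lam - 1) * w N)"
        unfolding V_def[abs_def] by (intro one_sided_drift \<Psi> \<eta> \<gamma> C)
      then show ?thesis
        unfolding conj[OF \<eta>(1), of V] drift_const by simp
    qed
  qed (use N_ge p_gt p_less rates \<epsilon> packed_configs vac \<Psi> V in \<open>auto simp: D_def\<close>)
qed

lemma vacant_fixed:
  "exit_left vacant = vacant" "x \<in> {1..<N} \<Longrightarrow> jump_right x vacant = vacant"
  "x \<in> {1..<N} \<Longrightarrow> jump_left x vacant = vacant"
  using N1 by (auto simp: vacant_def packed_def exit_left_def jump_right_def jump_left_def fun_eq_iff)

theorem one_sided_bounds:
  assumes \<gamma>: "\<gamma> > 0" and K: "K \<ge> 1" "K * \<gamma> \<ge> c + \<gamma> + \<gamma> * (lam - 1)" and \<epsilon>: "\<epsilon> > 0"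
    and gd: "(g, d) = (\<gamma>, 0) \<or> (g, d) = (0, \<gamma>)"
  shows "(1 / 2 - lam * real N / threshold * w N - \<epsilon>) / (lam * c / threshold * w N)
      \<le> mixing_time N p 0 0 g d \<epsilon>
    \<and> mixing_time N p 0 0 g d \<epsilon> \<le> (2 * (K * real N ^ 2) + 1) / (c * (lam - 1) * w N * \<epsilon>)"
  using gd
proof
  assume "(g, d) = (\<gamma>, 0)"
  then have [simp]: "g = \<gamma>" "d = 0" by auto
  have "apply_move N i (id vacant) = id vacant" if "i \<in> moves N" "move_rate p g d i \<noteq> 0" for i
    using that vacant_fixed by (cases i) (auto simp: moves_def)
  with \<gamma> show ?thesis by (intro one_sided_bounds_aux[OF \<gamma> K \<epsilon>, of _ _ id]) auto
next
  assume "(g, d) = (0, \<gamma>)"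
  then have [simp]: "g = 0" "d = \<gamma>" by auto
  have vac: "vacant \<in> configs N" by (simp add: vacant_def packed_configs)
  have "apply_move N i (mirror N vacant) = mirror N vacant"
    if i: "i \<in> moves N" "move_rate p g d i \<noteq> 0" for i
  proof (cases i)
    case (Jump_right x)
    then have x: "x \<in> {1..<N}" "N - x \<in> {1..<N}" using i by (auto simp: moves_def)
    then show ?thesis
      using mirror_jump(1)[OF vac x(2)] vacant_fixed(2)[OF x(2)] Jump_right by simp
  next
    case (Jump_left x)
    then have x: "x \<in> {1..<N}" "N - x \<in> {1..<N}" using i by (auto simp: moves_def)
    then show ?thesis
      using mirror_jump(2)[OF vac x(2)] vacant_fixed(3)[OF x(2)] Jump_left by simp
  next
    case Enter_right
    then show ?thesis using mirror_ends(1)[OF N1, of vacant] vacant_fixed(1) by simp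
  qed (use i in simp)
  with \<gamma> show ?thesis
    by (intro one_sided_bounds_aux[OF \<gamma> K \<epsilon>, of _ _ "mirror N"])
      (auto simp: mirror_configs mirror_mirror drift_mirror[OF _ N1])
qed

end

section \<open>Exponential growth rates\<close>

text \<open>The polynomial factor in the upper bound and the slowly vanishing corrections in the lower bound
disappear on the logarithmic scale.\<close>

lemma growth_rate_from_bounds:
  fixes t :: "nat \<Rightarrow> real"
  assumes \<rho>: "\<rho> > 0" and r: "r > 0" and m: "m > 0" and M: "M > 0" and \<epsilon>: "\<epsilon> < 1 / 2"
    and bounds: "\<forall>\<^sub>F N in sequentially.
      (1 / 2 - m * real N * exp (- (\<rho> * real N)) - \<epsilon>) / (r * exp (- (\<rho> * real N))) \<le> t N
      \<and> t N \<le> M * real N ^ 5 / exp (- (\<rho> * real N))"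
  shows "(\<lambda>N. ln (t N) / real N) \<longlonglongrightarrow> \<rho>"
proof -
  define a where "a = (1 / 2 - \<epsilon>) / (2 * r)"
  have a: "a > 0" using \<epsilon> r by (simp add: a_def)
  have "(\<lambda>N. m * real N * exp (- (\<rho> * real N))) \<longlonglongrightarrow> 0"
    using \<rho> m by real_asymp
  then have "\<forall>\<^sub>F N in sequentially. m * real N * exp (- (\<rho> * real N)) < (1 / 2 - \<epsilon>) / 2"
    by (rule order_tendstoD(2)) (use \<epsilon> in simp)
  with bounds eventually_gt_at_top[of "0 :: nat"]
  have ev: "\<forall>\<^sub>F N in sequentially. (ln a + \<rho> * real N) / real N \<le> ln (t N) / real N
      \<and> ln (t N) / real N \<le> (ln M + 5 * ln (real N) + \<rho> * real N) / real N"
  proof eventually_elim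
    case (elim N)
    have inv: "exp (\<rho> * real N) = inverse (exp (- (\<rho> * real N)))"
      by (simp add: exp_minus)
    have "a * exp (\<rho> * real N) = ((1 / 2 - \<epsilon>) / 2) / (r * exp (- (\<rho> * real N)))"
      using r unfolding inv a_def by (simp only: divide_inverse inverse_mult_distrib mult_ac)
    also have "\<dots> \<le> (1 / 2 - m * real N * exp (- (\<rho> * real N)) - \<epsilon>) / (r * exp (- (\<rho> * real N)))"
      using elim(3) r by (intro divide_right_mono) simp_all
    finally have lower: "a * exp (\<rho> * real N) \<le> t N" using elim(1) by linarith
    have upper: "t N \<le> M * real N ^ 5 * exp (\<rho> * real N)"
      using elim(1) unfolding inv by (simp only: divide_inverse)
    have pos: "0 < a * exp (\<rho> * real N)" using a by simp
    have "ln (a * exp (\<rho> * real N)) \<le> ln (t N)" using lower pos by (subst ln_le_cancel_iff) auto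
    moreover have "ln (t N) \<le> ln (M * real N ^ 5 * exp (\<rho> * real N))"
      using lower upper pos by (subst ln_le_cancel_iff) auto
    moreover have "ln (M * real N ^ 5 * exp (\<rho> * real N)) = ln M + 5 * ln (real N) + \<rho> * real N"
      using M elim(2) by (simp add: ln_mult ln_realpow)
    moreover have "ln (a * exp (\<rho> * real N)) = ln a + \<rho> * real N"
      using a by (simp add: ln_mult)
    ultimately show ?case by (auto intro!: divide_right_mono)
  qed
  show ?thesis
  proof (rule tendsto_sandwich)
    show "\<forall>\<^sub>F N in sequentially. (ln a + \<rho> * real N) / real N \<le> ln (t N) / real N"
      "\<forall>\<^sub>F N in sequentially. ln (t N) / real N \<le> (ln M + 5 * ln (real N) + \<rho> * real N) / real N"
      using ev by (auto elim: eventually_mono)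
    show "(\<lambda>N. (ln a + \<rho> * real N) / real N) \<longlonglongrightarrow> \<rho>"
      by real_asymp
    show "(\<lambda>N. (ln M + 5 * ln (real N) + \<rho> * real N) / real N) \<longlonglongrightarrow> \<rho>"
      by real_asymp
  qed
qed

context asymmetric
begin

lemma exists_large:
  assumes "\<gamma> > 0" "\<delta> > 0"
  shows "\<exists>K. large \<gamma> \<delta> K \<and> large \<delta> \<gamma> K"
proof -
  have lin: "\<forall>\<^sub>F K in at_top. x \<le> K * y" if "y > 0" for x y :: real
    using eventually_ge_at_top[of "x / y"] by eventually_elim (use that in \<open>simp add: field_simps\<close>)
  have lin': "\<forall>\<^sub>F K in at_top. x \<le> K * ((lam - 1) / lam) * y" if "y > 0" for x y :: real
    using lin[of "(lam - 1) / lam * y" x] lam_gt_1 that by (simp add: mult.assoc)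
  have "\<forall>\<^sub>F K in at_top. large \<gamma> \<delta> K \<and> large \<delta> \<gamma> K"
    unfolding large_def using assms c_pos gain_pos p_gt
    by (intro eventually_conj lin lin' eventually_ge_at_top) auto
  then show ?thesis by (rule eventually_happens'[rotated]) simp
qed

lemma w_exp: "w n = exp (- (ln lam * real n))"
proof -
  have "w n = exp (- ln lam) ^ n"
    using lam_gt_1 by (simp add: w_def exp_minus inverse_eq_divide)
  then show ?thesis by (simp flip: exp_of_nat_mult)
qed

lemma sqrt_w_exp: "sqrt (w n) = exp (- (ln lam / 2 * real n))"
proof -
  have "w n = exp (- (ln lam / 2 * real n)) ^ 2"
    unfolding w_exp by (simp flip: exp_of_nat_mult)
  then show ?thesis by simp
qed

end

theorem theorem1p4:
  fixes p \<gamma> \<delta> \<epsilon> :: real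
  assumes "1 / 2 < p" and "p < 1"
    and "\<gamma> \<ge> 0" and "\<delta> \<ge> 0"
    and "0 < \<epsilon>" and "\<epsilon> < 1 / 2"
  shows "(min \<gamma> \<delta> = 0 \<and> max \<gamma> \<delta> > 0 \<longrightarrow>
           (\<lambda>N. ln (mixing_time N p 0 0 \<gamma> \<delta> \<epsilon>) / real N) \<longlonglongrightarrow> ln (p / (1 - p)))
       \<and> (min \<gamma> \<delta> > 0 \<longrightarrow>
           (\<lambda>N. ln (mixing_time N p 0 0 \<gamma> \<delta> \<epsilon>) / real N) \<longlonglongrightarrow> (1 / 2) * ln (p / (1 - p)))"
proof -
  interpret base: asymmetric 2 p using assms by unfold_locales auto
  have asym: "asymmetric N p" if "N \<ge> 2" for N using that assms by unfold_locales auto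
  have ln_lam: "ln base.lam > 0" using base.lam_gt_1 by simp
  have lam: "base.lam = p / (1 - p)" by (rule base.lam_def)
  note pos = base.lam_gt_1 base.c_pos base.threshold_pos base.gain_pos
  show ?thesis
  proof (intro conjI impI)
    assume "min \<gamma> \<delta> = 0 \<and> max \<gamma> \<delta> > 0"
    then obtain g where g: "g > 0" "(\<gamma>, \<delta>) = (g, 0) \<or> (\<gamma>, \<delta>) = (0, g)"
      using assms(3,4) by (auto simp: min_def max_def split: if_splits)
    define K where "K = max 1 ((base.c + g + g * (base.lam - 1)) / g)"
    have K: "K \<ge> 1" "K * g \<ge> base.c + g + g * (base.lam - 1)"
    proof -
      show "K \<ge> 1" by (simp add: K_def)
      have "(base.c + g + g * (base.lam - 1)) / g * g \<le> K * g"
        using g(1) by (intro mult_right_mono) (auto simp: K_def)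
      then show "K * g \<ge> base.c + g + g * (base.lam - 1)" using g(1) by simp
    qed
    show "(\<lambda>N. ln (mixing_time N p 0 0 \<gamma> \<delta> \<epsilon>) / real N) \<longlonglongrightarrow> ln (p / (1 - p))"
      unfolding lam[symmetric]
    proof (rule growth_rate_from_bounds[OF ln_lam _ _ _ assms(6)])
      show "base.lam * base.c / base.threshold > 0" "base.lam / base.threshold > 0" "3 * K / (base.c * (base.lam - 1) * \<epsilon>) > 0"
        using pos K assms(5) by (auto intro!: divide_pos_pos mult_pos_pos)
      show "\<forall>\<^sub>F N in sequentially.
        (1 / 2 - base.lam / base.threshold * real N * exp (- (ln base.lam * real N)) - \<epsilon>)
          / (base.lam * base.c / base.threshold * exp (- (ln base.lam * real N))) \<le> mixing_time N p 0 0 \<gamma> \<delta> \<epsilon>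
        \<and> mixing_time N p 0 0 \<gamma> \<delta> \<epsilon>
          \<le> 3 * K / (base.c * (base.lam - 1) * \<epsilon>) * real N ^ 5 / exp (- (ln base.lam * real N))"
        using eventually_ge_at_top[of "2 :: nat"]
      proof eventually_elim
        case (elim N)
        interpret asymmetric N p by (rule asym[OF elim])
        have N: "real N \<ge> 1" using elim by simp
        have pow: "1 \<le> K * real N ^ 5" "K * real N ^ 2 \<le> K * real N ^ 5"
        proof -
          have "1 * 1 \<le> K * real N ^ 5" using K N by (intro mult_mono) auto
          then show "1 \<le> K * real N ^ 5" by simp
          show "K * real N ^ 2 \<le> K * real N ^ 5"
            using K N by (intro mult_left_mono power_increasing) auto
        qed
        have "(2 * (K * real N ^ 2) + 1) / (c * (lam - 1) * w N * \<epsilon>) \<le> (3 * (K * real N ^ 5)) / (c * (lam - 1) * w N * \<epsilon>)"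
          using pow c_pos lam_gt_1 w_pos[of N] assms(5) by (intro divide_right_mono mult_nonneg_nonneg) auto
        also have "\<dots> = 3 * K / (c * (lam - 1) * \<epsilon>) * real N ^ 5 / w N"
          by (simp add: field_simps)
        finally show ?case
          using one_sided_bounds[OF g(1) K assms(5) g(2)] unfolding w_exp
          by (simp add: mult_ac)
      qed
    qed
  next
    assume "min \<gamma> \<delta> > 0"
    then have rates: "\<gamma> > 0" "\<delta> > 0" by auto
    obtain K where K: "base.large \<gamma> \<delta> K" "base.large \<delta> \<gamma> K" using base.exists_large[OF rates] by blast
    have K1: "K \<ge> 1" using K by (simp add: base.large_def)
    define \<rho> where "\<rho> = ln base.lam / 2"
    have \<rho>: "\<rho> > 0" using ln_lam by (simp add: \<rho>_def)
    have "(\<lambda>N. K ^ 3 * real N ^ 3 * exp (- (\<rho> * real N)) * (base.c * (1 + K ^ 2 * real N))) \<longlonglongrightarrow> 0"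
    proof -
      have "K > 0" using K1 by simp
      then show ?thesis using \<rho> pos by real_asymp
    qed
    then have "\<forall>\<^sub>F N in sequentially. K ^ 3 * real N ^ 3 * exp (- (\<rho> * real N)) * (base.c * (1 + K ^ 2 * real N)) < base.gain / 2"
      by (rule order_tendstoD(2)) (use pos in simp)
    note small = this
    have "(\<lambda>N. ln (mixing_time N p 0 0 \<gamma> \<delta> \<epsilon>) / real N) \<longlonglongrightarrow> \<rho>"
    proof (rule growth_rate_from_bounds[OF \<rho> _ _ _ assms(6)])
      show "2 * base.lam * base.c / base.threshold > 0" "2 * base.lam / base.threshold > 0" "25 * K ^ 5 / (base.gain * \<epsilon>) > 0"
        using pos K1 assms(5) by (auto intro!: divide_pos_pos mult_pos_pos)
      show "\<forall>\<^sub>F N in sequentially.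
        (1 / 2 - 2 * base.lam / base.threshold * real N * exp (- (\<rho> * real N)) - \<epsilon>)
          / (2 * base.lam * base.c / base.threshold * exp (- (\<rho> * real N))) \<le> mixing_time N p 0 0 \<gamma> \<delta> \<epsilon>
        \<and> mixing_time N p 0 0 \<gamma> \<delta> \<epsilon> \<le> 25 * K ^ 5 / (base.gain * \<epsilon>) * real N ^ 5 / exp (- (\<rho> * real N))"
        using eventually_ge_at_top[of "2 :: nat"] small
      proof eventually_elim
        case (elim N)
        interpret asymmetric N p by (rule asym[OF elim(1)])
        have N: "real N \<ge> 1" using elim by simp
        have s: "sqrt (w N) = exp (- (\<rho> * real N))" unfolding \<rho>_def by (rule sqrt_w_exp)
        have "1 * 1 \<le> K ^ 5 * real N ^ 5" using K1 N by (intro mult_mono) auto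
        then have "(2 * (12 * K ^ 5 * real N ^ 5) + 1) / (gain * sqrt (w N) * \<epsilon>) \<le> (25 * K ^ 5 * real N ^ 5) / (gain * sqrt (w N) * \<epsilon>)"
          using gain_pos w_pos[of N] assms(5) by (intro divide_right_mono) auto
        also have "\<dots> = 25 * K ^ 5 / (gain * \<epsilon>) * real N ^ 5 / sqrt (w N)"
          by (simp add: field_simps)
        finally show ?case
          using two_sided_bounds[OF rates K assms(5)] elim(2) unfolding s
          by (simp add: mult_ac)
      qed
    qed
    then show "(\<lambda>N. ln (mixing_time N p 0 0 \<gamma> \<delta> \<epsilon>) / real N) \<longlonglongrightarrow> (1 / 2) * ln (p / (1 - p))"
      by (simp add: \<rho>_def lam)
  qed
qed

end
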